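(* Let $x_0>0$. For $L>x_0$ large enough there are critical values $\beta_{0,L}>0$ and $\beta_{1,L}>\beta_{0,L}$ such that, as the parameter $\beta$ increases from $0$, genuinely complex (non-real) eigenvalues appear in the spectrum of $A_{L,\beta}$ at $\beta=\beta_{0,L}$, and at $\beta=\beta_{1,L}$ a complex conjugate pair of eigenvalues crosses the imaginary axis.
   Context: For $0<x_0<L<\infty$ let $\mathrm{H}^1_L=\mathrm{H}^1_0((-L,L))$, $\mathrm{H}^{-1}_L$ its dual (complexified for spectral questions), $A_L:\mathrm{H}^1_L\subset\mathrm{H}^{-1}_L\to\mathrm{H}^{-1}_L$ given by $\langle A_Lu,v\rangle=\int_{-L}^Lu_xv_x\,dx$, and, for $\beta\in\mathbb{R}$, $A_{L,\beta}u=A_Lu+\beta u(x_0)\delta_0$ with domain $\mathrm{H}^1_L$, where $\delta_0$ is the Dirac distribution at $0$. *)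

theory Defs
  imports "HOL-Analysis.Analysis"
begin

section \<open>The complex Sobolev space \<open>H\<^sup>1\<^sub>0((-L,L))\<close>\<close>

text \<open>\<open>W\<^sup>1\<^sup>,\<^sup>2\<close> and \<open>W\<^sup>1\<^sup>,\<^sup>2\<^sub>0\<close> of an interval follow Brezis, Functional Analysis, Sobolev Spaces
  and Partial Differential Equations, Chapter 8: weak derivatives are tested against
  \<open>C\<^sup>1\<close> functions of compact support, and \<open>W\<^sup>1\<^sup>,\<^sup>2\<^sub>0\<close> is the closure of these functions in the
  \<open>W\<^sup>1\<^sup>,\<^sup>2\<close> norm.\<close>

definition test_fun :: "real \<Rightarrow> (real \<Rightarrow> complex) set" where
  "test_fun L = {\<phi>. \<phi> C1_differentiable_on UNIV \<and>
     (\<exists>K. compact K \<and> K \<subseteq> {-L<..<L} \<and> (\<forall>x. x \<notin> K \<longrightarrow> \<phi> x = 0))}"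

definition L2 :: "real \<Rightarrow> (real \<Rightarrow> complex) set" where
  "L2 L = {f. set_borel_measurable lborel {-L<..<L} f \<and>
     set_integrable lborel {-L<..<L} (\<lambda>x. (cmod (f x))\<^sup>2)}"

definition weak_deriv :: "real \<Rightarrow> (real \<Rightarrow> complex) \<Rightarrow> (real \<Rightarrow> complex) \<Rightarrow> bool" where
  "weak_deriv L u g \<longleftrightarrow> (\<forall>\<phi>\<in>test_fun L.
     set_lebesgue_integral lborel {-L<..<L} (\<lambda>x. u x * vector_derivative \<phi> (at x)) =
     - set_lebesgue_integral lborel {-L<..<L} (\<lambda>x. g x * \<phi> x))"

definition H1 :: "real \<Rightarrow> (real \<Rightarrow> complex) set" where
  "H1 L = {u \<in> L2 L. \<exists>g\<in>L2 L. weak_deriv L u g}"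

text \<open>The weak derivative is determined only up to a null set; it is used below
  only under integrals over \<open>(-L,L)\<close>, so the choice is immaterial.\<close>

definition wderiv :: "real \<Rightarrow> (real \<Rightarrow> complex) \<Rightarrow> real \<Rightarrow> complex" where
  "wderiv L u = (SOME g. g \<in> L2 L \<and> weak_deriv L u g)"

definition H1_norm :: "real \<Rightarrow> (real \<Rightarrow> complex) \<Rightarrow> real" where
  "H1_norm L u = sqrt (set_lebesgue_integral lborel {-L<..<L} (\<lambda>x. (cmod (u x))\<^sup>2) +
     set_lebesgue_integral lborel {-L<..<L} (\<lambda>x. (cmod (wderiv L u x))\<^sup>2))"

text \<open>Each class in \<open>H\<^sup>1\<^sub>0((-L,L))\<close> is represented by its unique representative that is
  continuous on \<open>[-L,L]\<close>, set to zero outside. Thus point values such as \<open>u(x\<^sub>0)\<close> and \<open>v(0)\<close> make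
  sense, and \<open>u \<noteq> (\<lambda>x. 0)\<close> says that the class is nonzero.
  The boundary values \<open>u(-L) = u(L) = 0\<close> are not imposed; they follow from the closure.\<close>

definition H10 :: "real \<Rightarrow> (real \<Rightarrow> complex) set" where
  "H10 L = {u \<in> H1 L. continuous_on {-L..L} u \<and> (\<forall>x. x \<notin> {-L..L} \<longrightarrow> u x = 0) \<and>
     (\<forall>\<epsilon>>0. \<exists>\<phi>\<in>test_fun L. H1_norm L (\<lambda>x. u x - \<phi> x) < \<epsilon>)}"


section \<open>The operator \<open>A\<^sub>L\<^sub>,\<^sub>\<beta>\<close>\<close>

text \<open>Elements of \<open>H\<^sup>-\<^sup>1((-L,L))\<close> are functionals on \<open>H10 L\<close>, written as functions that are
  \<open>undefined\<close> off this set, so that equality of functions is equality in the dual space.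
  The pairing is complex bilinear (not sesquilinear), as it comes from complexifying the
  real spaces, and \<open>emb\<close> is the resulting inclusion of \<open>H\<^sup>1\<^sub>0\<close> in \<open>H\<^sup>-\<^sup>1\<close>.\<close>

definition emb :: "real \<Rightarrow> (real \<Rightarrow> complex) \<Rightarrow> (real \<Rightarrow> complex) \<Rightarrow> complex" where
  "emb L u = (\<lambda>v\<in>H10 L. set_lebesgue_integral lborel {-L<..<L} (\<lambda>x. u x * v x))"

definition A :: "real \<Rightarrow> (real \<Rightarrow> complex) \<Rightarrow> (real \<Rightarrow> complex) \<Rightarrow> complex" where
  "A L u = (\<lambda>v\<in>H10 L. set_lebesgue_integral lborel {-L<..<L} (\<lambda>x. wderiv L u x * wderiv L v x))"

definition dirac0 :: "real \<Rightarrow> (real \<Rightarrow> complex) \<Rightarrow> complex" where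
  "dirac0 L = (\<lambda>v\<in>H10 L. v 0)"

definition A_beta :: "real \<Rightarrow> real \<Rightarrow> real \<Rightarrow> (real \<Rightarrow> complex) \<Rightarrow> (real \<Rightarrow> complex) \<Rightarrow> complex" where
  "A_beta x0 L \<beta> u = (\<lambda>v\<in>H10 L. A L u v + of_real \<beta> * u x0 * dirac0 L v)"

definition eigenvalues :: "real \<Rightarrow> real \<Rightarrow> real \<Rightarrow> complex set" where
  "eigenvalues x0 L \<beta> = {\<mu>. \<exists>u\<in>H10 L. u \<noteq> (\<lambda>x. 0) \<and>
     A_beta x0 L \<beta> u = (\<lambda>v\<in>H10 L. \<mu> * emb L u v)}"


section \<open>Crossing of the imaginary axis\<close>

text \<open>A conjugate pair of non-real points of the family of sets \<open>\<sigma>\<close>, depending continuously on the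
  parameter, passes from the open right to the open left half-plane at the value \<open>b\<close>.\<close>

definition pair_crosses_imaginary_axis :: "(real \<Rightarrow> complex set) \<Rightarrow> real \<Rightarrow> bool" where
  "pair_crosses_imaginary_axis \<sigma> b \<longleftrightarrow>
     (\<exists>\<epsilon>>0. \<exists>z. continuous_on {b-\<epsilon><..<b+\<epsilon>} z \<and>
        (\<forall>\<beta>\<in>{b-\<epsilon><..<b+\<epsilon>}. z \<beta> \<in> \<sigma> \<beta> \<and> cnj (z \<beta>) \<in> \<sigma> \<beta> \<and> Im (z \<beta>) \<noteq> 0) \<and>
        (\<forall>\<beta>\<in>{b-\<epsilon><..<b}. Re (z \<beta>) > 0) \<and> Re (z b) = 0 \<and>
        (\<forall>\<beta>\<in>{b<..<b+\<epsilon>}. Re (z \<beta>) < 0))"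

end

theory Submission
  imports Defs "HOL-Complex_Analysis.Complex_Analysis"
begin

text \<open>
  Write \<open>\<mu> = k\<^sup>2\<close> and \<open>a = L - x\<^sub>0\<close>. For every \<open>y\<close> in \<open>(-L,L)\<close> let \<open>w\<^sub>y\<close> be the continuous function that
  vanishes at \<open>-L\<close> and \<open>L\<close> and solves \<open>-w'' = k\<^sup>2 w\<close> off \<open>y\<close>, scaled so that its derivative drops by
  \<open>s(2L)\<close> at \<open>y\<close>, where \<open>s(x) = sin (k x) / k\<close>; it is \<open>s(2L)\<close> times Green's function if \<open>s(2L)\<close>
  is nonzero. Then
  \<open>\<integral> w\<^sub>y' v' = k\<^sup>2 \<integral> w\<^sub>y v + s(2L) v(y)\<close> for all \<open>v\<close> in \<open>H\<^sup>1\<^sub>0\<close> (\<open>green_identity\<close>). If \<open>v\<close> is an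
  eigenfunction, this expresses \<open>v(y)\<close> through \<open>v(x\<^sub>0)\<close>, and \<open>y = x\<^sub>0\<close> shows that for \<open>\<beta> \<ge> 0\<close> an eigenvalue
  which is not a positive real number satisfies \<open>2 k cos (k L) + \<beta> sin (k a) = 0\<close>. Conversely \<open>w\<^sub>0\<close> is an
  eigenfunction at each root \<open>k\<close> off the real axis. The pairing is known on test functions by
  integration by parts; it extends to \<open>H\<^sup>1\<^sub>0\<close> because weak derivatives are unique and because
  convergence in \<open>H\<^sup>1\<close> of test functions implies convergence of point values.

  By the symmetries \<open>k \<mapsto> -k\<close> and \<open>k \<mapsto> cnj k\<close>, for \<open>\<beta> \<ge> 0\<close> the eigenvalues that are not positive
  reals are the numbers \<open>k\<^sup>2\<close> and their conjugates, where \<open>k\<close> lies in the open first quadrant \<open>Q\<close> and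
  \<open>h(k) = \<beta>\<close> for the meromorphic function \<open>h(k) = -2 k cos (k L) / sin (k a)\<close>. So
  \<open>\<beta>\<^sub>0\<close> is the infimum of the nonnegative \<open>\<beta>\<close> in \<open>h(Q)\<close>, and \<open>\<beta>\<^sub>1\<close> the infimum of those
  attained at points with \<open>Re k \<le> Im k\<close>, that is \<open>Re k\<^sup>2 \<le> 0\<close>. Real and imaginary parts of the
  equation give \<open>\<beta> a \<ge> 1\<close>, \<open>Re k \<ge> \<pi> / (2 L)\<close> and an upper bound for \<open>\<bar>k\<bar>\<close> in terms of \<open>\<beta>\<close>, so both
  infima are positive and roots along a convergent sequence of parameters accumulate at a root.

  Since \<open>h\<close> is open on \<open>Q\<close>, \<open>\<beta>\<^sub>0\<close> is not attained, and the nonreal roots for \<open>\<beta> \<down> \<beta>\<^sub>0\<close> accumulate at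
  a positive real \<open>x\<close>. After removing a possible singularity, \<open>h - \<beta>\<^sub>0\<close> is near \<open>x\<close> the \<open>n\<close>-th power
  of a local coordinate, so the roots for \<open>\<beta>\<^sub>0 + t\<^sup>n\<close> are values at \<open>t\<close> of finitely many analytic
  arcs through \<open>x\<close>. The imaginary part of an arc that leaves the real axis has an isolated zero at
  \<open>t = 0\<close>; hence nonreal eigenvalues exist for all \<open>\<beta>\<close> in an interval to the right of \<open>\<beta>\<^sub>0\<close>
  (\<open>nonreal_branch\<close>).

  The value \<open>\<beta>\<^sub>1\<close> is attained by compactness, and on the diagonal \<open>k = s (1 + i)\<close> because \<open>h\<close> is open.
  On the diagonal everything is explicit: with \<open>t = s x\<^sub>0\<close>, a root forces \<open>t > 1\<close>, roots with
  \<open>\<beta> > 0\<close> exist when \<open>L \<ge> 4 x\<^sub>0\<close>, and the logarithmic derivative of \<open>h\<close> shows that \<open>Re k\<^sup>2\<close> has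
  negative derivative in \<open>\<beta>\<close> at each of them (\<open>crossing_transversal\<close>). In the limit
  \<open>L \<rightarrow> \<infinity>\<close> the equation becomes \<open>\<beta> = 2 i k exp (- i k x\<^sub>0)\<close>, whose first diagonal root with \<open>\<beta> > 0\<close>
  has \<open>t = 3 \<pi> / 4\<close>; this explains the range \<open>1 \<le> t \<le> 5 \<pi> / 6\<close> in which a crossing is found.
\<close>

section \<open>Integrals over a bounded interval\<close>

abbreviation integ :: "real \<Rightarrow> (real \<Rightarrow> 'a::{banach, second_countable_topology}) \<Rightarrow> 'a" where
  "integ L f \<equiv> set_lebesgue_integral lborel {-L<..<L} f"

lemma set_borel_measurable_of_integrable:
  "set_integrable M S f \<Longrightarrow> set_borel_measurable M S f"
  unfolding set_integrable_def set_borel_measurable_def by (rule borel_measurable_integrable)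

text \<open>The fundamental theorem of calculus on both sides of a kink at \<open>y\<close>. The hypotheses hold on the
  whole line, so that continuity and differentiability never refer to the end points.\<close>
lemma split_FTC:
  fixes P1 P2 p1 p2 f :: "real \<Rightarrow> complex"
  assumes y: "-L < y" "y < L"
    and P1: "\<And>x. (P1 has_vector_derivative p1 x) (at x)" and p1: "continuous_on UNIV p1"
    and P2: "\<And>x. (P2 has_vector_derivative p2 x) (at x)" and p2: "continuous_on UNIV p2"
    and f1: "\<And>x. -L < x \<Longrightarrow> x \<le> y \<Longrightarrow> f x = p1 x" and f2: "\<And>x. y < x \<Longrightarrow> x < L \<Longrightarrow> f x = p2 x"
  shows "set_integrable lborel {-L<..<L} f"
    and "integ L f = (P1 y - P1 (-L)) + (P2 L - P2 y)"
proof -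
  have i1: "set_integrable lborel {-L..y} p1" "set_integrable lborel {y..L} p2"
    by (intro borel_integrable_atLeastAtMost' continuous_on_subset[OF p1] continuous_on_subset[OF p2]; simp)+
  have j1: "set_integrable lborel {-L<..y} p1" "set_integrable lborel {y<..<L} p2"
    by (rule set_integrable_subset[OF i1(1)], simp, force, rule set_integrable_subset[OF i1(2)], simp, force)
  have k1: "set_integrable lborel {-L<..y} f"
    using j1(1) f1 by (subst set_integrable_cong[of lborel lborel _ _ f p1]) auto
  have k2: "set_integrable lborel {y<..<L} f"
    using j1(2) f2 by (subst set_integrable_cong[of lborel lborel _ _ f p2]) auto
  have U: "{-L<..<L} = {-L<..y} \<union> {y<..<L}" "{-L<..y} \<inter> {y<..<L} = {}" using y by auto
  show "set_integrable lborel {-L<..<L} f"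
    unfolding U(1) using k1 k2 by (intro set_integrable_Un) auto
  have "integ L f
      = set_lebesgue_integral lborel {-L<..y} f + set_lebesgue_integral lborel {y<..<L} f"
    unfolding U(1) by (rule set_integral_Un[OF U(2) k1 k2])
  also have "set_lebesgue_integral lborel {-L<..y} f = set_lebesgue_integral lborel {-L<..y} p1"
    by (rule set_lebesgue_integral_cong) (use f1 in auto)
  also have "\<dots> = set_lebesgue_integral lborel {-L..y} p1"
  proof (rule set_integral_cong_set)
    show "AE x in lborel. (x \<in> {-L..y}) = (x \<in> {-L<..y})"
      using AE_lborel_singleton[of "-L"] by eventually_elim (use y in auto)
    show "set_borel_measurable lborel {-L..y} p1" "set_borel_measurable lborel {-L<..y} p1"
      using i1(1)[THEN set_borel_measurable_of_integrable] j1(1)[THEN set_borel_measurable_of_integrable] .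
  qed
  also have "\<dots> = P1 y - P1 (-L)"
    unfolding set_lebesgue_integral_def
  proof (rule integral_FTC_atLeastAtMost)
    show "-L \<le> y" using y by simp
    show "continuous_on {-L..y} p1" by (rule continuous_on_subset[OF p1]) simp
    show "(P1 has_vector_derivative p1 x) (at x within {-L..y})" for x
      by (rule has_vector_derivative_at_within[OF P1])
  qed
  also have "set_lebesgue_integral lborel {y<..<L} f = set_lebesgue_integral lborel {y<..<L} p2"
    by (rule set_lebesgue_integral_cong) (use f2 in auto)
  also have "\<dots> = set_lebesgue_integral lborel {y..L} p2"
  proof (rule set_integral_cong_set)
    show "AE x in lborel. (x \<in> {y..L}) = (x \<in> {y<..<L})"
      using AE_lborel_singleton[of "L"] AE_lborel_singleton[of "y"] by eventually_elim (use y in auto)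
    show "set_borel_measurable lborel {y..L} p2" "set_borel_measurable lborel {y<..<L} p2"
      using i1(2)[THEN set_borel_measurable_of_integrable] j1(2)[THEN set_borel_measurable_of_integrable] .
  qed
  also have "\<dots> = P2 L - P2 y"
    unfolding set_lebesgue_integral_def
  proof (rule integral_FTC_atLeastAtMost)
    show "y \<le> L" using y by simp
    show "continuous_on {y..L} p2" by (rule continuous_on_subset[OF p2]) simp
    show "(P2 has_vector_derivative p2 x) (at x within {y..L})" for x
      by (rule has_vector_derivative_at_within[OF P2])
  qed
  finally show "integ L f = (P1 y - P1 (-L)) + (P2 L - P2 y)" .
qed

lemma set_integrable_const_interval:
  fixes c :: "'a::{banach, second_countable_topology}"
  shows "set_integrable lborel {-L<..<L::real} (\<lambda>x. c)"
  by (rule set_integrable_subset[OF borel_integrable_atLeastAtMost'[of "-L" L]]) auto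

lemma L2_set_integrable:
  assumes "f \<in> L2 L" shows "set_integrable lborel {-L<..<L} f"
proof -
  have m: "set_borel_measurable lborel {-L<..<L} f"
    and i: "set_integrable lborel {-L<..<L} (\<lambda>x. (cmod (f x))\<^sup>2)" using assms by (auto simp: L2_def)
  have one: "set_integrable lborel {-L<..<L} (\<lambda>x. 1::real)"
    by (rule set_integrable_const_interval)
  have "set_integrable lborel {-L<..<L} (\<lambda>x. 1 + (cmod (f x))\<^sup>2)"
    by (intro set_integral_add one i)
  then show ?thesis
  proof (rule set_integrable_bound[OF _ m], intro AE_I2 impI)
    fix x
    have "2 * cmod (f x) \<le> 1 + (cmod (f x))\<^sup>2"
      using sum_squares_ge_zero[of "cmod (f x) - 1" 0] by (simp add: power2_eq_square algebra_simps)
    then show "cmod (f x) \<le> norm (1 + (cmod (f x))\<^sup>2)" using norm_ge_zero[of "f x"] by (simp add: abs_if)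
  qed
qed

lemma set_integrable_bounded_mult:
  fixes f g :: "real \<Rightarrow> complex"
  assumes f: "set_borel_measurable lborel S f" and S: "S \<in> sets lborel"
    and b: "\<And>x. x \<in> S \<Longrightarrow> cmod (f x) \<le> C" and g: "set_integrable lborel S g"
  shows "set_integrable lborel S (\<lambda>x. f x * g x)"
    and "cmod (set_lebesgue_integral lborel S (\<lambda>x. f x * g x)) \<le> C * set_lebesgue_integral lborel S (\<lambda>x. cmod (g x))"
proof -
  have m: "set_borel_measurable lborel S (\<lambda>x. f x * g x)"
  proof -
    have "(\<lambda>x. (indicator S x *\<^sub>R f x) * (indicator S x *\<^sub>R g x)) \<in> borel_measurable lborel"
      using f g unfolding set_borel_measurable_def set_integrable_def by (intro borel_measurable_times) auto
    moreover have "(\<lambda>x. (indicator S x *\<^sub>R f x) * (indicator S x *\<^sub>R g x)) = (\<lambda>x. indicator S x *\<^sub>R (f x * g x))"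
      by (auto simp: indicator_def)
    ultimately show ?thesis unfolding set_borel_measurable_def by simp
  qed
  have cg: "set_integrable lborel S (\<lambda>x. C * cmod (g x))"
    by (intro set_integrable_mult_right set_integrable_norm g)
  show i: "set_integrable lborel S (\<lambda>x. f x * g x)"
  proof (rule set_integrable_bound[OF cg m], intro AE_I2 impI)
    fix x assume "x \<in> S"
    then have "cmod (f x) * cmod (g x) \<le> C * cmod (g x)" by (intro mult_right_mono b) auto
    then show "norm (f x * g x) \<le> norm (C * cmod (g x))" by (simp add: norm_mult)
  qed
  have "cmod (set_lebesgue_integral lborel S (\<lambda>x. f x * g x)) \<le> set_lebesgue_integral lborel S (\<lambda>x. cmod (f x * g x))"
    by (rule set_integral_norm_bound[OF i])
  also have "\<dots> \<le> set_lebesgue_integral lborel S (\<lambda>x. C * cmod (g x))"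
    by (rule set_integral_mono[OF set_integrable_norm[OF i] cg]) (auto simp: norm_mult intro!: mult_right_mono b)
  finally show "cmod (set_lebesgue_integral lborel S (\<lambda>x. f x * g x)) \<le> C * set_lebesgue_integral lborel S (\<lambda>x. cmod (g x))"
    by simp
qed

text \<open>This replaces the Cauchy-Schwarz inequality: integrate
  \<open>2 \<delta> \<bar>f\<bar> \<le> \<delta>\<^sup>2 + \<bar>f\<bar>\<^sup>2\<close>.\<close>
lemma integral_norm_le_of_square:
  assumes "f \<in> L2 L" "L > 0" "\<delta> > 0"
    and "integ L (\<lambda>x. (cmod (f x))\<^sup>2) \<le> \<delta>\<^sup>2"
  shows "integ L (\<lambda>x. cmod (f x)) \<le> (L + 1/2) * \<delta>"
proof -
  have i: "set_integrable lborel {-L<..<L} (\<lambda>x. (cmod (f x))\<^sup>2)" using assms by (auto simp: L2_def)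
  have one: "set_integrable lborel {-L<..<L} (\<lambda>x. \<delta>/2)"
    by (rule set_integrable_const_interval)
  have "integ L (\<lambda>x. cmod (f x))
     \<le> integ L (\<lambda>x. \<delta>/2 + (cmod (f x))\<^sup>2 / (2*\<delta>))"
  proof (rule set_integral_mono)
    show "set_integrable lborel {-L<..<L} (\<lambda>x. cmod (f x))"
      by (intro set_integrable_norm L2_set_integrable assms)
    show "set_integrable lborel {-L<..<L} (\<lambda>x. \<delta>/2 + (cmod (f x))\<^sup>2 / (2*\<delta>))"
      using i by (intro set_integral_add one) (auto intro: set_integrable_divide)
    fix x
    have "2 * \<delta> * cmod (f x) \<le> \<delta>\<^sup>2 + (cmod (f x))\<^sup>2"
      using zero_le_power2[of "\<delta> - cmod (f x)"] by (simp add: power2_eq_square algebra_simps)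
    then show "cmod (f x) \<le> \<delta>/2 + (cmod (f x))\<^sup>2 / (2*\<delta>)"
      using \<open>\<delta>>0\<close> by (simp add: field_simps power2_eq_square)
  qed
  also have "\<dots> = L * \<delta> + integ L (\<lambda>x. (cmod (f x))\<^sup>2) / (2*\<delta>)"
    using i assms by (subst set_integral_add(2)[OF one]) (auto intro: set_integrable_divide simp: set_integral_const)
  also have "\<dots> \<le> L * \<delta> + \<delta>\<^sup>2 / (2*\<delta>)"
    using assms by (intro add_left_mono divide_right_mono) auto
  also have "\<dots> = (L + 1/2) * \<delta>" using \<open>\<delta>>0\<close> by (simp add: field_simps power2_eq_square)
  finally show ?thesis .
qed

lemma L2_bounded:
  assumes "set_borel_measurable lborel {-L<..<L} f" "\<And>x. x \<in> {-L<..<L} \<Longrightarrow> cmod (f x) \<le> C"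
  shows "f \<in> L2 L"
proof -
  have one: "set_integrable lborel {-L<..<L} (\<lambda>x. C\<^sup>2)"
    by (rule set_integrable_const_interval)
  have m: "set_borel_measurable lborel {-L<..<L} (\<lambda>x. (cmod (f x))\<^sup>2)"
  proof -
    have "(\<lambda>x. (norm (indicator {-L<..<L} x *\<^sub>R f x))\<^sup>2) \<in> borel_measurable lborel"
      using assms(1) unfolding set_borel_measurable_def by measurable
    moreover have "(\<lambda>x. (norm (indicator {-L<..<L} x *\<^sub>R f x))\<^sup>2) = (\<lambda>x. indicator {-L<..<L} x *\<^sub>R (cmod (f x))\<^sup>2)"
      by (auto simp: indicator_def)
    ultimately show ?thesis unfolding set_borel_measurable_def by simp
  qed
  have "set_integrable lborel {-L<..<L} (\<lambda>x. (cmod (f x))\<^sup>2)"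
    by (rule set_integrable_bound[OF one m]) (use assms in \<open>auto intro!: power_mono\<close>)
  then show ?thesis using assms by (auto simp: L2_def)
qed

lemma L2_diff:
  assumes f: "f \<in> L2 L" and g: "g \<in> L2 L" shows "(\<lambda>x. f x - g x) \<in> L2 L"
proof -
  have m: "set_borel_measurable lborel {-L<..<L} (\<lambda>x. f x - g x)"
  proof -
    have "(\<lambda>x. (indicator {-L<..<L} x *\<^sub>R f x) - (indicator {-L<..<L} x *\<^sub>R g x)) \<in> borel_measurable lborel"
      using f g unfolding L2_def set_borel_measurable_def by auto
    then show ?thesis unfolding set_borel_measurable_def by (simp add: scaleR_diff_right)
  qed
  have m2: "set_borel_measurable lborel {-L<..<L} (\<lambda>x. (cmod (f x - g x))\<^sup>2)"
  proof -
    have "(\<lambda>x. (norm (indicator {-L<..<L} x *\<^sub>R (f x - g x)))\<^sup>2) \<in> borel_measurable lborel"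
      using m unfolding set_borel_measurable_def by measurable
    moreover have "(\<lambda>x. (norm (indicator {-L<..<L} x *\<^sub>R (f x - g x)))\<^sup>2) = (\<lambda>x. indicator {-L<..<L} x *\<^sub>R (cmod (f x - g x))\<^sup>2)"
      by (auto simp: indicator_def)
    ultimately show ?thesis unfolding set_borel_measurable_def by simp
  qed
  have b: "set_integrable lborel {-L<..<L} (\<lambda>x. 2 * (cmod (f x))\<^sup>2 + 2 * (cmod (g x))\<^sup>2)"
    using f g by (intro set_integral_add set_integrable_mult_right) (auto simp: L2_def)
  have "set_integrable lborel {-L<..<L} (\<lambda>x. (cmod (f x - g x))\<^sup>2)"
  proof (rule set_integrable_bound[OF b m2], intro AE_I2 impI)
    fix x
    have "cmod (f x - g x) \<le> cmod (f x) + cmod (g x)" by (rule norm_triangle_ineq4)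
    then have "(cmod (f x - g x))\<^sup>2 \<le> (cmod (f x) + cmod (g x))\<^sup>2" by (intro power_mono) auto
    also have "\<dots> \<le> 2 * (cmod (f x))\<^sup>2 + 2 * (cmod (g x))\<^sup>2"
      using zero_le_power2[of "cmod (f x) - cmod (g x)"] by (simp add: power2_eq_square algebra_simps)
    finally show "norm ((cmod (f x - g x))\<^sup>2) \<le> norm (2 * (cmod (f x))\<^sup>2 + 2 * (cmod (g x))\<^sup>2)" by simp
  qed
  then show ?thesis using m by (auto simp: L2_def)
qed

section \<open>Test functions determine a function almost everywhere\<close>

text \<open>A continuously differentiable function that vanishes for \<open>t \<le> 0\<close> and tends to \<open>1\<close> at infinity;
  composed with \<open>n (x - c) (d - x)\<close> it approximates the indicator of \<open>(c,d)\<close>.\<close>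
definition smooth_step :: "real \<Rightarrow> real" where
  "smooth_step t = (max 0 t)\<^sup>2 / (1 + (max 0 t)\<^sup>2)"

lemma max0_square_deriv: "((\<lambda>t. (max 0 t)\<^sup>2) has_real_derivative 2 * max 0 t) (at (t::real))"
proof (cases t "0::real" rule: linorder_cases)
  case less
  have "((\<lambda>t. 0) has_real_derivative 0) (at t)" by simp
  then have "((\<lambda>t. (max 0 t)\<^sup>2) has_real_derivative 0) (at t)"
    by (rule has_field_derivative_transform_within_open[of _ _ _ "{..<0}"]) (use less in auto)
  then show ?thesis using less by simp
next
  case greater
  have "((\<lambda>t. t\<^sup>2) has_real_derivative 2 * t) (at t)" by (auto intro!: derivative_eq_intros)
  then have "((\<lambda>t. (max 0 t)\<^sup>2) has_real_derivative 2 * t) (at t)"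
    by (rule has_field_derivative_transform_within_open[of _ _ _ "{0<..}"]) (use greater in auto)
  then show ?thesis using greater by simp
next
  case equal
  have "((\<lambda>h. (max 0 h)\<^sup>2 / h) \<longlongrightarrow> 0) (at (0::real))"
  proof (rule Lim_null_comparison)
    have "norm ((max 0 h)\<^sup>2 / h) \<le> \<bar>h\<bar>" for h :: real
      by (cases "h \<le> 0") (simp_all add: power2_eq_square)
    then show "\<forall>\<^sub>F h in at (0::real). norm ((max 0 h)\<^sup>2 / h) \<le> \<bar>h\<bar>"
      by (simp add: always_eventually)
    show "((\<lambda>h::real. \<bar>h\<bar>) \<longlongrightarrow> 0) (at 0)" by (rule tendsto_rabs_zero) (rule tendsto_ident_at)
  qed
  then show ?thesis using equal by (simp add: DERIV_def)
qed

lemma one_add_square_nz: "1 + (x::real)\<^sup>2 \<noteq> 0"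
  by (metis add_pos_nonneg less_numeral_extra(1) less_numeral_extra(3) zero_le_power2)

lemma smooth_step_deriv:
  "(smooth_step has_real_derivative 2 * max 0 t / (1 + (max 0 t)\<^sup>2)\<^sup>2) (at t)"
proof -
  have "((\<lambda>t. (max 0 t)\<^sup>2 / (1 + (max 0 t)\<^sup>2)) has_real_derivative
     (2 * max 0 t * (1 + (max 0 t)\<^sup>2) - (max 0 t)\<^sup>2 * (0 + 2 * max 0 t)) / ((1 + (max 0 t)\<^sup>2) * (1 + (max 0 t)\<^sup>2))) (at t)"
    by (intro DERIV_divide DERIV_add DERIV_const max0_square_deriv one_add_square_nz)
  then show ?thesis by (simp add: smooth_step_def[abs_def] algebra_simps power2_eq_square)
qed

lemma smooth_step_tendsto: "(smooth_step \<longlongrightarrow> 1) at_top"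
proof -
  have "filterlim (\<lambda>t::real. 1 + t\<^sup>2) at_top at_top"
    by (intro filterlim_tendsto_add_at_top[OF tendsto_const] filterlim_pow_at_top filterlim_ident) simp
  then have "((\<lambda>t::real. 1 - 1 / (1 + t\<^sup>2)) \<longlongrightarrow> 1 - 0) at_top"
    by (intro tendsto_diff tendsto_const tendsto_divide_0[OF tendsto_const])
       (rule filterlim_mono[OF _ at_top_le_at_infinity order.refl])
  then have "((\<lambda>t::real. 1 - 1 / (1 + t\<^sup>2)) \<longlongrightarrow> 1) at_top" by simp
  then show ?thesis
  proof (rule Lim_transform_eventually)
    show "\<forall>\<^sub>F t in at_top. 1 - 1 / (1 + t\<^sup>2) = smooth_step t"
      using eventually_ge_at_top[of "0::real"]
    proof eventually_elim
      case (elim t)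
      then show ?case using one_add_square_nz[of t] by (simp add: smooth_step_def field_simps)
    qed
  qed
qed

lemma smooth_step_bounds: "0 \<le> smooth_step t" "smooth_step t \<le> 1" "t \<le> 0 \<Longrightarrow> smooth_step t = 0"
proof -
  have "0 < 1 + (max 0 t)\<^sup>2" by (simp add: add_pos_nonneg)
  then show "0 \<le> smooth_step t" "smooth_step t \<le> 1" "t \<le> 0 \<Longrightarrow> smooth_step t = 0"
    by (simp_all add: smooth_step_def)
qed

text \<open>These bumps supply enough test functions: for large \<open>n\<close> they approximate the indicator of \<open>(c,d)\<close>.\<close>
lemma test_fun_smooth_step:
  assumes "-L < c" and cd: "c \<le> d" and "d < L" and n: "n > 0"
  shows "(\<lambda>x. of_real (smooth_step (n * ((x - c) * (d - x))))) \<in> test_fun L"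
proof -
  define D where "D = (\<lambda>x::real. (2 * max 0 (n * ((x - c) * (d - x))) / (1 + (max 0 (n * ((x - c) * (d - x))))\<^sup>2)\<^sup>2) * (n * (c + d - 2 * x)))"
  have "((\<lambda>x. smooth_step (n * ((x - c) * (d - x)))) has_real_derivative D x) (at x)" for x
    unfolding D_def
    by (rule DERIV_chain'[OF _ smooth_step_deriv])
       (auto intro!: derivative_eq_intros simp: algebra_simps)
  then have 1: "((\<lambda>x. of_real (smooth_step (n * ((x - c) * (d - x)))) :: complex) has_vector_derivative of_real (D x)) (at x)" for x
    by (intro has_vector_derivative_of_real) (simp add: has_real_derivative_iff_has_vector_derivative)
  have ne: "(1 + (max 0 t)\<^sup>2)\<^sup>2 \<noteq> 0" for t :: real
    using one_add_square_nz by simp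
  have 2: "continuous_on UNIV (\<lambda>x. of_real (D x) :: complex)"
    unfolding D_def by (intro continuous_intros ballI) (use ne in auto)
  have 3: "\<exists>K. compact K \<and> K \<subseteq> {-L<..<L} \<and> (\<forall>x. x \<notin> K \<longrightarrow> of_real (smooth_step (n * ((x - c) * (d - x)))) = (0::complex))"
  proof (intro exI[of _ "{c..d}"] conjI allI impI)
    show "{c..d} \<subseteq> {-L<..<L}" using assms by auto
    fix x assume "x \<notin> {c..d}"
    then consider "x < c" "x \<le> d" | "d < x" "c \<le> x" | "d < x" "x < c" by fastforce
    then have "(x - c) * (d - x) \<le> 0 \<or> d < c" by cases (auto simp: mult_nonneg_nonpos mult_nonpos_nonneg)
    then have "(x - c) * (d - x) \<le> 0" using cd \<open>x \<notin> {c..d}\<close> by (simp add: not_less)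
    then have "n * ((x - c) * (d - x)) \<le> 0" using n by (simp add: mult_nonneg_nonpos)
    then show "of_real (smooth_step (n * ((x - c) * (d - x)))) = (0::complex)"
      by (simp add: smooth_step_bounds)
  qed simp
  show ?thesis unfolding test_fun_def C1_differentiable_on_def
    by (intro CollectI conjI exI[of _ "\<lambda>x. of_real (D x)"] ballI 1 2 3)
qed

text \<open>Bumps supported in \<open>[c + e\<^sub>n, d - e\<^sub>n]\<close> tend to the indicator of \<open>(c,d)\<close>. Shrinking the support
  keeps it compact in \<open>(-L,L)\<close> even if \<open>c = -L\<close> or \<open>d = L\<close>.\<close>
lemma interval_integral_zero:
  assumes g: "set_integrable lborel {-L<..<L} g"
    and z: "\<And>\<phi>. \<phi> \<in> test_fun L \<Longrightarrow> integ L (\<lambda>x. g x * \<phi> x) = 0"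
    and cd: "-L \<le> c" "c < d" "d \<le> L"
  shows "set_lebesgue_integral lborel {c<..<d} g = 0"
proof -
  \<comment> \<open>the \<open>3\<close> keeps \<open>c + e n \<le> d - e n\<close> from \<open>n = 0\<close> on\<close>
  define e where "e = (\<lambda>n::nat. (d - c) / (real n + 3))"
  define q where "q = (\<lambda>n x. real (Suc n) * ((x - (c + e n)) * ((d - e n) - x)))"
  define s where "s = (\<lambda>n x. indicator {-L<..<L} x *\<^sub>R (g x * of_real (smooth_step (q n x))))"
  have e: "e n > 0" for n using cd by (simp add: e_def)
  have ce: "c + e n \<le> d - e n" for n
  proof -
    have "e n \<le> (d - c) / 3" using cd unfolding e_def by (intro divide_left_mono) auto
    then show ?thesis using cd by simp
  qed
  have s0: "integral\<^sup>L lborel (s n) = 0" for n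
    using z[OF test_fun_smooth_step[of L "c + e n" "d - e n" "real (Suc n)"]] e[of n] cd ce[of n]
    by (simp add: s_def q_def set_lebesgue_integral_def)
  have mq[measurable]: "(\<lambda>x. smooth_step (q n x)) \<in> borel_measurable borel" for n
    unfolding smooth_step_def q_def by measurable
  have mg[measurable]: "(\<lambda>x. indicator {-L<..<L} x *\<^sub>R g x) \<in> borel_measurable lborel"
    using g unfolding set_integrable_def by auto
  have "(\<lambda>n. integral\<^sup>L lborel (s n)) \<longlonglongrightarrow> integral\<^sup>L lborel (\<lambda>x. indicator {c<..<d} x *\<^sub>R g x)"
  proof (rule integral_dominated_convergence)
    have "(\<lambda>x. (if x \<in> {c<..<d} then 1 else 0) * (indicator {-L<..<L} x *\<^sub>R g x)) \<in> borel_measurable lborel"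
      by measurable
    moreover have "(\<lambda>x. (if x \<in> {c<..<d} then 1 else 0) * (indicator {-L<..<L} x *\<^sub>R g x)) = (\<lambda>x. indicator {c<..<d} x *\<^sub>R g x)"
      using cd by (auto simp: indicator_def)
    ultimately show "(\<lambda>x. indicator {c<..<d} x *\<^sub>R g x) \<in> borel_measurable lborel" by simp
    fix n
    have "(\<lambda>x. (indicator {-L<..<L} x *\<^sub>R g x) * of_real (smooth_step (q n x))) \<in> borel_measurable lborel"
      by measurable
    then show "s n \<in> borel_measurable lborel" by (simp add: s_def[abs_def])
    show "AE x in lborel. norm (s n x) \<le> norm (indicator {-L<..<L} x *\<^sub>R g x)"
      using smooth_step_bounds by (auto simp: s_def norm_mult mult_left_le indicator_def)
  next
    show "integrable lborel (\<lambda>x. norm (indicator {-L<..<L} x *\<^sub>R g x))"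
      using g unfolding set_integrable_def by (rule integrable_norm)
    show "AE x in lborel. (\<lambda>n. s n x) \<longlonglongrightarrow> indicator {c<..<d} x *\<^sub>R g x"
    proof (intro AE_I2)
      fix x
      show "(\<lambda>n. s n x) \<longlonglongrightarrow> indicator {c<..<d} x *\<^sub>R g x"
      proof (cases "x \<in> {c<..<d}")
        case True
        have e0: "e \<longlonglongrightarrow> 0" unfolding e_def
        proof (rule tendsto_divide_0[OF tendsto_const])
          have "filterlim (\<lambda>n. 3 + real n) at_top sequentially"
            by (rule filterlim_tendsto_add_at_top[OF tendsto_const filterlim_real_sequentially])
          then show "filterlim (\<lambda>n. real n + 3) at_infinity sequentially"
            by (simp add: add.commute filterlim_mono[OF _ at_top_le_at_infinity order.refl])
        qed
        have "(\<lambda>n. (x - (c + e n)) * ((d - e n) - x)) \<longlonglongrightarrow> (x - (c + 0)) * ((d - 0) - x)"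
          by (intro tendsto_intros e0)
        moreover have "(x - (c + 0)) * ((d - 0) - x) > 0" using True by auto
        ultimately have "filterlim (\<lambda>n. ((x - (c + e n)) * ((d - e n) - x)) * real (Suc n)) at_top sequentially"
          by (rule filterlim_tendsto_pos_mult_at_top) (rule filterlim_compose[OF filterlim_real_sequentially filterlim_Suc])
        then have "filterlim (\<lambda>n. q n x) at_top sequentially" by (simp add: q_def mult.commute)
        then have "(\<lambda>n. smooth_step (q n x)) \<longlonglongrightarrow> 1"
          by (rule filterlim_compose[OF smooth_step_tendsto])
        then have "(\<lambda>n. indicator {-L<..<L} x *\<^sub>R (g x * of_real (smooth_step (q n x)))) \<longlonglongrightarrow> indicator {-L<..<L} x *\<^sub>R (g x * of_real 1)"
          by (intro tendsto_intros)
        then show ?thesis using True cd by (simp add: s_def)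
      next
        case False
        have "q n x \<le> 0" for n
        proof -
          have "x \<le> c \<or> x \<ge> d" using False by auto
          moreover note ce[of n]
          ultimately have "(x - (c + e n)) * ((d - e n) - x) \<le> 0"
            using e[of n] by (auto intro: mult_nonneg_nonpos mult_nonpos_nonneg)
          then show ?thesis by (simp add: q_def mult_nonneg_nonpos)
        qed
        then show ?thesis using False by (simp add: s_def smooth_step_bounds)
      qed
    qed
  qed
  with s0 have "(\<lambda>n. 0) \<longlonglongrightarrow> integral\<^sup>L lborel (\<lambda>x. indicator {c<..<d} x *\<^sub>R g x)" by simp
  then show ?thesis by (simp add: set_lebesgue_integral_def LIMSEQ_const_iff)
qed

text \<open>The half-lines form an intersection-stable generator of the Borel sets, so the integral of \<open>f\<close>
  vanishes over every Borel set.\<close>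
lemma AE_zero_of_atMost_integrals:
  fixes f :: "real \<Rightarrow> complex"
  assumes f: "integrable lborel f" and z: "\<And>a. set_lebesgue_integral lborel {..a} f = 0"
    and z1: "integral\<^sup>L lborel f = 0"
  shows "AE x in lborel. f x = 0"
proof (rule sigma_finite_measure.density_zero[OF sigma_finite_lborel f])
  fix A :: "real set" assume "A \<in> sets lborel"
  then have A: "A \<in> sigma_sets UNIV (range (\<lambda>a::real. {..a}))"
    by (simp add: borel_eq_atMost)
  have fi: "set_integrable lborel B f" if "B \<in> sets borel" for B
    using f that unfolding set_integrable_def by (intro integrable_mult_indicator) auto
  have sb: "B \<in> sets borel" if "B \<in> sigma_sets UNIV (range (\<lambda>a::real. {..a}))" for B
    using that by (simp add: borel_eq_atMost)
  show "set_lebesgue_integral lborel A f = 0"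
  proof (induction rule: sigma_sets_induct_disjoint[OF _ _ A, consumes 0])
    case 1
    show "Int_stable (range (\<lambda>a::real. {..a}))" by (auto simp: Int_stable_def)
  next
    case 2 show ?case by simp
  next
    case (3 B) then show ?case using z by auto
  next
    case 4 show ?case by (simp add: set_lebesgue_integral_def)
  next
    case (5 B)
    then have "set_lebesgue_integral lborel (B \<union> (UNIV - B)) f = set_lebesgue_integral lborel B f + set_lebesgue_integral lborel (UNIV - B) f"
      using sb[OF 5(1)] by (intro set_integral_Un fi) auto
    then show ?case using 5 z1 by (simp add: set_lebesgue_integral_def)
  next
    case (6 B)
    have "set_lebesgue_integral lborel (\<Union>i. B i) f = (\<Sum>i. set_lebesgue_integral lborel (B i) f)"
      using 6 sb[of "B _"] by (intro lebesgue_integral_countable_add fi sets.countable_UN) (auto simp: disjoint_family_on_def range_subsetD)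
    then show ?case using 6 by simp
  qed
qed

text \<open>The fundamental lemma of the calculus of variations.\<close>
lemma AE_zero_of_test_integrals:
  assumes g: "set_integrable lborel {-L<..<L} g" and L: "L > 0"
    and z: "\<And>\<phi>. \<phi> \<in> test_fun L \<Longrightarrow> integ L (\<lambda>x. g x * \<phi> x) = 0"
  shows "AE x in lborel. x \<in> {-L<..<L} \<longrightarrow> g x = 0"
proof -
  define f where "f = (\<lambda>x. indicator {-L<..<L} x *\<^sub>R g x)"
  have "AE x in lborel. f x = 0"
  proof (rule AE_zero_of_atMost_integrals)
    show "integrable lborel f" using g by (simp add: f_def set_integrable_def)
    show "integral\<^sup>L lborel f = 0"
      using interval_integral_zero[OF g z, of "-L" L] L by (simp add: f_def set_lebesgue_integral_def)
    fix a
    show "set_lebesgue_integral lborel {..a} f = 0"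
    proof (cases "a \<le> -L")
      case True
      then have "(\<lambda>x. indicator {..a} x *\<^sub>R f x) = (\<lambda>x. 0)" by (auto simp: f_def indicator_def)
      then show ?thesis by (simp add: set_lebesgue_integral_def)
    next
      case False
      define d where "d = min a L"
      have "set_lebesgue_integral lborel {-L<..<d} g = 0"
        using False L by (intro interval_integral_zero[OF g z]) (auto simp: d_def)
      moreover have "set_lebesgue_integral lborel {..a} f = set_lebesgue_integral lborel {-L<..<d} g"
        unfolding set_lebesgue_integral_def
      proof (rule integral_cong_AE)
        have m: "f \<in> borel_measurable lborel" using g by (simp add: f_def set_integrable_def)
        show "(\<lambda>x. indicat_real {..a} x *\<^sub>R f x) \<in> borel_measurable lborel" using m by auto
        have "(\<lambda>x. indicat_real {-L<..<d} x *\<^sub>R f x) \<in> borel_measurable lborel" using m by auto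
        moreover have "(\<lambda>x. indicat_real {-L<..<d} x *\<^sub>R f x) = (\<lambda>x. indicat_real {-L<..<d} x *\<^sub>R g x)"
          by (auto simp: f_def d_def indicator_def)
        ultimately show "(\<lambda>x. indicat_real {-L<..<d} x *\<^sub>R g x) \<in> borel_measurable lborel" by simp
        show "AE x in lborel. indicat_real {..a} x *\<^sub>R f x = indicat_real {-L<..<d} x *\<^sub>R g x"
          using AE_lborel_singleton[of d] by eventually_elim (auto simp: f_def d_def indicator_def)
      qed
      ultimately show ?thesis by simp
    qed
  qed
  then show ?thesis by eventually_elim (auto simp: f_def)
qed

section \<open>Weak derivatives\<close>

lemma test_fun_D:
  assumes "\<phi> \<in> test_fun L"
  shows "(\<phi> has_vector_derivative vector_derivative \<phi> (at x)) (at x)"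
    and "continuous_on UNIV (\<lambda>x. vector_derivative \<phi> (at x))"
    and "continuous_on UNIV \<phi>"
    and "\<phi> (-L) = 0" "\<phi> L = 0"
proof -
  have C1: "\<phi> C1_differentiable_on UNIV" using assms by (simp add: test_fun_def)
  then obtain D where D: "\<And>x. (\<phi> has_vector_derivative D x) (at x)" "continuous_on UNIV D"
    unfolding C1_differentiable_on_def by blast
  have eq: "vector_derivative \<phi> (at x) = D x" for x by (rule vector_derivative_at[OF D(1)])
  show "(\<phi> has_vector_derivative vector_derivative \<phi> (at x)) (at x)" using D eq by simp
  show "continuous_on UNIV (\<lambda>x. vector_derivative \<phi> (at x))" using D eq by simp
  show "continuous_on UNIV \<phi>"
    using D(1) by (intro continuous_at_imp_continuous_on ballI) (rule has_vector_derivative_continuous)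
  obtain K where "K \<subseteq> {-L<..<L}" "\<And>x. x \<notin> K \<Longrightarrow> \<phi> x = 0" using assms by (auto simp: test_fun_def)
  then show "\<phi> (-L) = 0" "\<phi> L = 0" by (metis greaterThanLessThan_iff less_irrefl subsetD)+
qed

lemma piecewise_bounded:
  fixes f p1 p2 :: "real \<Rightarrow> complex"
  assumes y: "-L < y" "y < L"
    and p1: "continuous_on UNIV p1" and p2: "continuous_on UNIV p2"
    and f1: "\<And>x. -L < x \<Longrightarrow> x \<le> y \<Longrightarrow> f x = p1 x" and f2: "\<And>x. y < x \<Longrightarrow> x < L \<Longrightarrow> f x = p2 x"
  obtains C where "C > 0" "\<And>x. x \<in> {-L<..<L} \<Longrightarrow> cmod (f x) \<le> C"
proof -
  have "bounded (p1 ` {-L..L})" "bounded (p2 ` {-L..L})"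
    by (intro compact_imp_bounded compact_continuous_image continuous_on_subset[OF p1]
      continuous_on_subset[OF p2] compact_Icc subset_UNIV)+
  then obtain C1 C2 where C: "\<And>x. x \<in> {-L..L} \<Longrightarrow> cmod (p1 x) \<le> C1" "\<And>x. x \<in> {-L..L} \<Longrightarrow> cmod (p2 x) \<le> C2"
    unfolding bounded_iff by blast
  show ?thesis
  proof (rule that[of "max 1 (max C1 C2)"])
    fix x assume x: "x \<in> {-L<..<L}"
    show "cmod (f x) \<le> max 1 (max C1 C2)"
      using x C(1)[of x] C(2)[of x] f1[of x] f2[of x] by (cases "x \<le> y") (auto simp: le_max_iff_disj)
  qed simp
qed

lemma piecewise_measurable:
  fixes f p1 p2 :: "real \<Rightarrow> complex"
  assumes p1: "continuous_on UNIV p1" and p2: "continuous_on UNIV p2"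
    and f1: "\<And>x. -L < x \<Longrightarrow> x \<le> y \<Longrightarrow> f x = p1 x" and f2: "\<And>x. y < x \<Longrightarrow> x < L \<Longrightarrow> f x = p2 x"
  shows "set_borel_measurable lborel {-L<..<L} f"
proof -
  have [measurable]: "p1 \<in> borel_measurable borel" "p2 \<in> borel_measurable borel"
    using p1 p2 by (auto intro: borel_measurable_continuous_onI)
  have "(\<lambda>x. if x \<in> {-L<..<L} then (if x \<le> y then p1 x else p2 x) else 0) \<in> borel_measurable lborel"
    by measurable
  moreover have "(\<lambda>x. if x \<in> {-L<..<L} then (if x \<le> y then p1 x else p2 x) else 0) = (\<lambda>x. indicator {-L<..<L} x *\<^sub>R f x)"
    using f1 f2 by (auto simp: fun_eq_iff indicator_def)
  ultimately show ?thesis unfolding set_borel_measurable_def by metis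
qed

lemma piecewise_L2:
  fixes f p1 p2 :: "real \<Rightarrow> complex"
  assumes y: "-L < y" "y < L"
    and p1: "continuous_on UNIV p1" and p2: "continuous_on UNIV p2"
    and f1: "\<And>x. -L < x \<Longrightarrow> x \<le> y \<Longrightarrow> f x = p1 x" and f2: "\<And>x. y < x \<Longrightarrow> x < L \<Longrightarrow> f x = p2 x"
  shows "f \<in> L2 L"
proof -
  obtain C where "\<And>x. x \<in> {-L<..<L} \<Longrightarrow> cmod (f x) \<le> C"
    using piecewise_bounded[where f = f, OF y p1 p2 f1 f2] by blast
  then show ?thesis by (intro L2_bounded[OF piecewise_measurable[OF p1 p2 f1 f2]])
qed

text \<open>The boundary terms at \<open>y\<close> cancel because the two pieces agree there.\<close>
lemma weak_deriv_piecewise: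
  assumes y: "-L < y" "y < L"
    and F1: "\<And>x. (F1 has_vector_derivative G1 x) (at x)" and G1: "continuous_on UNIV G1"
    and F2: "\<And>x. (F2 has_vector_derivative G2 x) (at x)" and G2: "continuous_on UNIV G2"
    and match: "F1 y = F2 y"
    and f1: "\<And>x. -L < x \<Longrightarrow> x \<le> y \<Longrightarrow> f x = F1 x" and f2: "\<And>x. y < x \<Longrightarrow> x < L \<Longrightarrow> f x = F2 x"
    and g1: "\<And>x. -L < x \<Longrightarrow> x \<le> y \<Longrightarrow> g x = G1 x" and g2: "\<And>x. y < x \<Longrightarrow> x < L \<Longrightarrow> g x = G2 x"
  shows "weak_deriv L f g"
  unfolding weak_deriv_def
proof
  fix \<phi> assume \<phi>: "\<phi> \<in> test_fun L"
  note T = test_fun_D[OF \<phi>]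
  have cF: "continuous_on UNIV F1" "continuous_on UNIV F2"
    using F1 F2 by (auto intro!: continuous_at_imp_continuous_on has_vector_derivative_continuous)
  let ?d = "\<lambda>x. vector_derivative \<phi> (at x)"
  have i1: "set_integrable lborel {-L<..<L} (\<lambda>x. f x * ?d x)"
  proof -
    obtain C where C: "\<And>x. x \<in> {-L<..<L} \<Longrightarrow> cmod (f x) \<le> C"
      using piecewise_bounded[where f = f, OF y cF f1 f2] by blast
    have "?d \<in> L2 L" by (rule piecewise_L2[OF y T(2) T(2)]) auto
    then show ?thesis
      by (intro set_integrable_bounded_mult(1)[OF piecewise_measurable[OF cF f1 f2] _ C] L2_set_integrable) auto
  qed
  have i2: "set_integrable lborel {-L<..<L} (\<lambda>x. g x * \<phi> x)"
  proof -
    obtain C where C: "\<And>x. x \<in> {-L<..<L} \<Longrightarrow> cmod (g x) \<le> C"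
      using piecewise_bounded[where f = g, OF y G1 G2 g1 g2] by blast
    have "\<phi> \<in> L2 L" by (rule piecewise_L2[OF y T(3) T(3)]) auto
    then show ?thesis
      by (intro set_integrable_bounded_mult(1)[OF piecewise_measurable[OF G1 G2 g1 g2] _ C] L2_set_integrable) auto
  qed
  have "integ L (\<lambda>x. f x * ?d x + g x * \<phi> x)
      = (F1 y * \<phi> y - F1 (-L) * \<phi> (-L)) + (F2 L * \<phi> L - F2 y * \<phi> y)"
    by (rule split_FTC(2)[where ?p1.0 = "\<lambda>x. F1 x * ?d x + G1 x * \<phi> x" and ?p2.0 = "\<lambda>x. F2 x * ?d x + G2 x * \<phi> x", OF y])
       (auto intro!: continuous_intros cF T G1 G2 has_vector_derivative_mult F1 F2 simp: f1 f2 g1 g2)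
  also have "\<dots> = 0" using T match by simp
  finally show "integ L (\<lambda>x. f x * ?d x) = - integ L (\<lambda>x. g x * \<phi> x)"
    using i1 i2 by (simp add: set_integral_add eq_neg_iff_add_eq_0)
qed

lemma weak_deriv_unique:
  assumes L: "L > 0" and w: "weak_deriv L u g" "weak_deriv L u h" and g: "g \<in> L2 L" "h \<in> L2 L"
  shows "AE x in lborel. x \<in> {-L<..<L} \<longrightarrow> g x = h x"
proof -
  have "AE x in lborel. x \<in> {-L<..<L} \<longrightarrow> g x - h x = 0"
  proof (rule AE_zero_of_test_integrals[OF _ L])
    show "set_integrable lborel {-L<..<L} (\<lambda>x. g x - h x)" by (intro L2_set_integrable L2_diff g)
    fix \<phi> assume \<phi>: "\<phi> \<in> test_fun L"
    note T = test_fun_D[OF \<phi>]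
    obtain C where C: "\<And>x. x \<in> {-L<..<L} \<Longrightarrow> cmod (\<phi> x) \<le> C"
      using piecewise_bounded[where f = \<phi> and y = 0 and L = L, OF _ _ T(3) T(3)] L by auto
    have m: "set_borel_measurable lborel {-L<..<L} \<phi>"
      by (rule piecewise_measurable[OF T(3) T(3)]) auto
    have i: "set_integrable lborel {-L<..<L} (\<lambda>x. f x * \<phi> x)" if "f \<in> L2 L" for f
      using set_integrable_bounded_mult(1)[OF m _ C L2_set_integrable[OF that]] by (simp add: mult.commute)
    have "integ L (\<lambda>x. g x * \<phi> x) = integ L (\<lambda>x. h x * \<phi> x)"
      using w \<phi> unfolding weak_deriv_def by fastforce
    then show "integ L (\<lambda>x. (g x - h x) * \<phi> x) = 0"
      by (simp add: left_diff_distrib set_integral_diff i g)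
  qed
  then show ?thesis by simp
qed

lemma weak_deriv_diff:
  assumes L: "L > 0" and w: "weak_deriv L u g" "weak_deriv L v h" and g: "g \<in> L2 L" "h \<in> L2 L" "u \<in> L2 L" "v \<in> L2 L"
  shows "weak_deriv L (\<lambda>x. u x - v x) (\<lambda>x. g x - h x)"
  unfolding weak_deriv_def
proof
  fix \<phi> assume \<phi>: "\<phi> \<in> test_fun L"
  note T = test_fun_D[OF \<phi>]
  have i: "set_integrable lborel {-L<..<L} (\<lambda>x. f x * p x)" if f: "f \<in> L2 L" and p: "continuous_on UNIV p" for f p
  proof -
    obtain C where C: "\<And>x. x \<in> {-L<..<L} \<Longrightarrow> cmod (p x) \<le> C"
      using piecewise_bounded[where f = p and y = 0 and L = L, OF _ _ p p] L by auto
    have m: "set_borel_measurable lborel {-L<..<L} p"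
      by (rule piecewise_measurable[OF p p]) auto
    show ?thesis
      using set_integrable_bounded_mult(1)[OF m _ C L2_set_integrable[OF f]] by (simp add: mult.commute)
  qed
  show "integ L (\<lambda>x. (u x - v x) * vector_derivative \<phi> (at x))
     = - integ L (\<lambda>x. (g x - h x) * \<phi> x)"
    using w \<phi> unfolding weak_deriv_def
    by (simp add: left_diff_distrib set_integral_diff i g T)
qed

lemma wderiv_H1:
  assumes "u \<in> H1 L" shows "wderiv L u \<in> L2 L" "weak_deriv L u (wderiv L u)"
proof -
  have "\<exists>g. g \<in> L2 L \<and> weak_deriv L u g" using assms by (auto simp: H1_def)
  then have "wderiv L u \<in> L2 L \<and> weak_deriv L u (wderiv L u)"
    unfolding wderiv_def by (rule someI_ex)
  then show "wderiv L u \<in> L2 L" "weak_deriv L u (wderiv L u)" by auto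
qed

text \<open>Makes the choice in \<open>wderiv\<close> harmless: any explicit weak derivative may replace it under an
  integral.\<close>
lemma AE_wderiv:
  assumes "L > 0" "u \<in> L2 L" "g \<in> L2 L" "weak_deriv L u g"
  shows "u \<in> H1 L" "AE x in lborel. x \<in> {-L<..<L} \<longrightarrow> wderiv L u x = g x"
proof -
  show u: "u \<in> H1 L" using assms by (auto simp: H1_def)
  show "AE x in lborel. x \<in> {-L<..<L} \<longrightarrow> wderiv L u x = g x"
    using weak_deriv_unique[OF assms(1) wderiv_H1(2)[OF u] assms(4) wderiv_H1(1)[OF u] assms(3)] .
qed

lemma test_fun_H1:
  assumes L: "L > 0" and \<phi>: "\<phi> \<in> test_fun L"
  shows "\<phi> \<in> L2 L" "(\<lambda>x. vector_derivative \<phi> (at x)) \<in> L2 L" "weak_deriv L \<phi> (\<lambda>x. vector_derivative \<phi> (at x))"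
proof -
  note T = test_fun_D[OF \<phi>]
  have y: "-L < 0" "0 < L" using L by auto
  show "\<phi> \<in> L2 L" by (rule piecewise_L2[OF y T(3) T(3)]) auto
  show "(\<lambda>x. vector_derivative \<phi> (at x)) \<in> L2 L" by (rule piecewise_L2[OF y T(2) T(2)]) auto
  show "weak_deriv L \<phi> (\<lambda>x. vector_derivative \<phi> (at x))"
    by (rule weak_deriv_piecewise[OF y T(1) T(2) T(1) T(2)]) auto
qed

lemma set_integral_cong_of_AE:
  fixes f g :: "real \<Rightarrow> 'a::{banach, second_countable_topology}"
  assumes "set_borel_measurable lborel S f" "set_borel_measurable lborel S g"
    and "AE x in lborel. x \<in> S \<longrightarrow> f x = g x"
  shows "set_lebesgue_integral lborel S f = set_lebesgue_integral lborel S g"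
  unfolding set_lebesgue_integral_def
proof (rule integral_cong_AE)
  show "AE x in lborel. indicat_real S x *\<^sub>R f x = indicat_real S x *\<^sub>R g x"
    using assms(3) by eventually_elim (auto simp: indicator_def)
qed (use assms in \<open>auto simp: set_borel_measurable_def\<close>)

lemma L2_norm_square_measurable:
  "f \<in> L2 L \<Longrightarrow> set_borel_measurable lborel {-L<..<L} (\<lambda>x. (cmod (f x))\<^sup>2)"
  by (rule set_borel_measurable_of_integrable) (simp add: L2_def)

lemma H1_norm_eq:
  assumes "L > 0" "u \<in> L2 L" "g \<in> L2 L" "weak_deriv L u g"
  shows "H1_norm L u = sqrt (integ L (\<lambda>x. (cmod (u x))\<^sup>2) +
     integ L (\<lambda>x. (cmod (g x))\<^sup>2))"
proof -
  have "AE x in lborel. x \<in> {-L<..<L} \<longrightarrow> (cmod (wderiv L u x))\<^sup>2 = (cmod (g x))\<^sup>2"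
    using AE_wderiv(2)[OF assms] by eventually_elim auto
  then have "integ L (\<lambda>x. (cmod (wderiv L u x))\<^sup>2) = integ L (\<lambda>x. (cmod (g x))\<^sup>2)"
    using assms wderiv_H1(1)[OF AE_wderiv(1)[OF assms]]
    by (intro set_integral_cong_of_AE L2_norm_square_measurable) auto
  then show ?thesis by (simp add: H1_norm_def)
qed

section \<open>Approximation of elements of the Sobolev space by test functions\<close>

text \<open>A primitive of a continuous compactly supported function has compact support exactly if the function
  has mean zero.\<close>
lemma primitive_test_fun:
  fixes \<psi> :: "real \<Rightarrow> complex"
  assumes r: "0 < r" "r < L" and c: "continuous_on UNIV \<psi>"
    and z: "\<And>x. r < \<bar>x\<bar> \<Longrightarrow> \<psi> x = 0"
    and i: "integral {-r..r} \<psi> = 0"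
  obtains \<phi> where "\<phi> \<in> test_fun L" "\<And>x. vector_derivative \<phi> (at x) = \<psi> x"
proof -
  define \<phi> where "\<phi> = (\<lambda>x. integral {-L..x} \<psi>)"
  have int: "\<psi> integrable_on {a..b}" for a b
    by (intro integrable_continuous_real continuous_on_subset[OF c]) simp
  have zero: "integral {a..b} \<psi> = 0" if "b \<le> -r \<or> r \<le> a" for a b
  proof -
    have "integral {a..b} \<psi> = integral {a..b} (\<lambda>x. 0)"
    proof (rule integral_spike[of "{-r, r}"])
      show "negligible {-r, r}" by simp
    qed (use that r z in \<open>auto simp: abs_if not_le\<close>)
    then show ?thesis by simp
  qed
  have D: "(\<phi> has_vector_derivative \<psi> x) (at x)" for x
  proof -
    define a where "a = min x (-L) - 1"
    have eq: "\<phi> u = integral {a..u} \<psi>" for u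
    proof (cases "-L \<le> u")
      case True
      have "integral {a..-L} \<psi> + integral {-L..u} \<psi> = integral {a..u} \<psi>"
        by (rule Henstock_Kurzweil_Integration.integral_combine) (use True int in \<open>auto simp: a_def\<close>)
      then show ?thesis using zero[of "-L" a] r by (simp add: \<phi>_def)
    next
      case False
      then show ?thesis using zero[of u a] r by (simp add: \<phi>_def)
    qed
    have "((\<lambda>u. integral {a..u} \<psi>) has_vector_derivative \<psi> x) (at x within {a..x+1})"
      by (rule integral_has_vector_derivative) (auto simp: a_def intro: continuous_on_subset[OF c])
    then have "((\<lambda>u. integral {a..u} \<psi>) has_vector_derivative \<psi> x) (at x within {a<..<x+1})"
      by (rule has_vector_derivative_within_subset) auto
    moreover have "x \<in> {a<..<x+1}" by (auto simp: a_def)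
    ultimately have "((\<lambda>u. integral {a..u} \<psi>) has_vector_derivative \<psi> x) (at x)"
      by (simp add: at_within_open[OF _ open_greaterThanLessThan])
    moreover have "(\<lambda>u. integral {a..u} \<psi>) = \<phi>" using eq by (intro ext) (rule sym)
    ultimately show ?thesis by simp
  qed
  have "\<phi> x = 0" if "x \<notin> {-r..r}" for x
  proof (cases "x < -r")
    case True then show ?thesis using zero[of x "-L"] by (simp add: \<phi>_def)
  next
    case False
    then have x: "x > r" using that by auto
    have "integral {-L..-r} \<psi> + integral {-r..x} \<psi> = integral {-L..x} \<psi>"
      "integral {-r..r} \<psi> + integral {r..x} \<psi> = integral {-r..x} \<psi>"
      by (rule Henstock_Kurzweil_Integration.integral_combine; use x r int in auto)+
    then show ?thesis using zero[of "-r" "-L"] zero[of x r] i by (simp add: \<phi>_def)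
  qed
  moreover have "{-r..r} \<subseteq> {-L<..<L}" using r by auto
  ultimately have "\<exists>K. compact K \<and> K \<subseteq> {-L<..<L} \<and> (\<forall>x. x \<notin> K \<longrightarrow> \<phi> x = 0)"
    by (intro exI[of _ "{-r..r}"]) auto
  then have "\<phi> \<in> test_fun L"
    using D c unfolding test_fun_def C1_differentiable_on_def by blast
  then show ?thesis by (rule that) (rule vector_derivative_at[OF D])
qed

lemma FTC_norm_bound:
  fixes P p f :: "real \<Rightarrow> complex"
  assumes P: "\<And>x. (P has_vector_derivative p x) (at x)" and p: "continuous_on UNIV p"
    and ab: "-L \<le> a" "a \<le> b" "b \<le> L"
    and f: "set_integrable lborel {-L<..<L} f" "\<And>x. a < x \<Longrightarrow> x < b \<Longrightarrow> f x = p x"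
  shows "cmod (P b - P a) \<le> integ L (\<lambda>x. cmod (f x))"
proof -
  have sub: "{a<..<b} \<subseteq> {-L<..<L}" using ab by auto
  have ip: "set_integrable lborel {a..b} p"
    by (intro borel_integrable_atLeastAtMost' continuous_on_subset[OF p]) simp
  have ip': "set_integrable lborel {a<..<b} p"
    by (rule set_integrable_subset[OF ip]) auto
  have "P b - P a = set_lebesgue_integral lborel {a..b} p"
    unfolding set_lebesgue_integral_def
  proof (rule integral_FTC_atLeastAtMost[symmetric])
    show "continuous_on {a..b} p" by (rule continuous_on_subset[OF p]) simp
    show "(P has_vector_derivative p x) (at x within {a..b})" for x
      by (rule has_vector_derivative_at_within[OF P])
  qed (rule ab)
  also have "\<dots> = set_lebesgue_integral lborel {a<..<b} p"
  proof (rule set_integral_cong_set)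
    show "AE x in lborel. (x \<in> {a<..<b}) = (x \<in> {a..b})"
      using AE_lborel_singleton[of a] AE_lborel_singleton[of b] by eventually_elim auto
  qed (intro set_borel_measurable_of_integrable ip ip')+
  finally have "cmod (P b - P a) \<le> set_lebesgue_integral lborel {a<..<b} (\<lambda>x. cmod (p x))"
    using set_integral_norm_bound[OF ip'] by simp
  also have "\<dots> = set_lebesgue_integral lborel {a<..<b} (\<lambda>x. cmod (f x))"
    by (rule set_lebesgue_integral_cong) (use f(2) in auto)
  also have "\<dots> \<le> integ L (\<lambda>x. cmod (f x))"
  proof -
    have i: "set_integrable lborel {-L<..<L} (\<lambda>x. cmod (f x))" by (intro set_integrable_norm f)
    show ?thesis unfolding set_lebesgue_integral_def
      using i set_integrable_subset[OF i _ sub] sub unfolding set_integrable_def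
      by (intro integral_mono) (auto simp: indicator_def)
  qed
  finally show ?thesis .
qed

lemma H10_approx_L1:
  assumes L: "L > 0" and v: "v \<in> H10 L" and \<delta>: "\<delta> > 0"
  obtains \<phi> where "\<phi> \<in> test_fun L"
    "integ L (\<lambda>x. cmod (v x - \<phi> x)) \<le> \<delta>"
    "integ L (\<lambda>x. cmod (wderiv L v x - vector_derivative \<phi> (at x))) \<le> \<delta>"
proof -
  define e where "e = \<delta> / (L + 1/2)"
  have e: "e > 0" "(L + 1/2) * e = \<delta>" using L \<delta> by (auto simp: e_def)
  have vH: "v \<in> H1 L" "v \<in> L2 L" using v by (auto simp: H10_def H1_def)
  obtain \<phi> where \<phi>: "\<phi> \<in> test_fun L" and n: "H1_norm L (\<lambda>x. v x - \<phi> x) < e"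
    using v e(1) by (auto simp: H10_def)
  note T = test_fun_H1[OF L \<phi>]
  note W = wderiv_H1[OF vH(1)]
  let ?g = "\<lambda>x. wderiv L v x - vector_derivative \<phi> (at x)"
  have l2: "(\<lambda>x. v x - \<phi> x) \<in> L2 L" "?g \<in> L2 L" by (intro L2_diff vH T W)+
  have wd: "weak_deriv L (\<lambda>x. v x - \<phi> x) ?g"
    by (intro weak_deriv_diff L W T vH)
  let ?A = "integ L (\<lambda>x. (cmod (v x - \<phi> x))\<^sup>2)"
  let ?B = "integ L (\<lambda>x. (cmod (?g x))\<^sup>2)"
  have AB: "?A \<ge> 0" "?B \<ge> 0" unfolding set_lebesgue_integral_def by (intro integral_nonneg_AE; simp)+
  have "sqrt (?A + ?B) < e" using n H1_norm_eq[OF L l2 wd] by simp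
  then have "(sqrt (?A + ?B))\<^sup>2 \<le> e\<^sup>2" using AB by (intro power_mono) auto
  then have "?A + ?B \<le> e\<^sup>2" using AB by simp
  then have "?A \<le> e\<^sup>2" "?B \<le> e\<^sup>2" using AB by linarith+
  then show ?thesis
    using integral_norm_le_of_square[OF l2(1) L e(1)] integral_norm_le_of_square[OF l2(2) L e(1)] e(2)
    by (intro that[OF \<phi>]) auto
qed

text \<open>Test functions vanish at \<open>-L\<close>, so the difference at \<open>y\<close> is the integral of the difference of the
  derivatives.\<close>
lemma test_fun_sup_bound:
  assumes L: "L > 0" and \<phi>: "\<phi> \<in> test_fun L" and \<theta>: "\<theta> \<in> test_fun L" and y: "y \<in> {-L..L}"
  shows "cmod (\<phi> y - \<theta> y) \<le> integ L (\<lambda>x. cmod (vector_derivative \<phi> (at x) - vector_derivative \<theta> (at x)))"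
proof -
  note T = test_fun_D[OF \<phi>] and S = test_fun_D[OF \<theta>]
  have "cmod ((\<phi> y - \<theta> y) - (\<phi> (-L) - \<theta> (-L))) \<le> integ L (\<lambda>x. cmod (vector_derivative \<phi> (at x) - vector_derivative \<theta> (at x)))"
    by (rule FTC_norm_bound[where P = "\<lambda>x. \<phi> x - \<theta> x" and p = "\<lambda>x. vector_derivative \<phi> (at x) - vector_derivative \<theta> (at x)"])
       (use y L in \<open>auto intro!: has_vector_derivative_diff T S continuous_intros L2_set_integrable L2_diff test_fun_H1(2)[OF L] \<phi> \<theta>\<close>)
  then show ?thesis using T S by simp
qed

text \<open>Convergence in \<open>H\<^sup>1\<close> controls point values. By the previous bound the approximations are uniformly
  close to each other; were \<open>\<phi>(y)\<close> far from \<open>v(y)\<close>, then by continuity a second, much better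
  approximation would differ from \<open>v\<close> on a whole neighbourhood of \<open>y\<close>, against its small
  \<open>L\<^sup>1\<close> distance to \<open>v\<close>.\<close>
lemma H10_approx:
  assumes L: "L > 0" and v: "v \<in> H10 L" and \<delta>: "\<delta> > 0" and y: "-L < y" "y < L"
  obtains \<phi> where "\<phi> \<in> test_fun L"
    "integ L (\<lambda>x. cmod (v x - \<phi> x)) \<le> \<delta>"
    "integ L (\<lambda>x. cmod (wderiv L v x - vector_derivative \<phi> (at x))) \<le> \<delta>"
    "cmod (v y - \<phi> y) \<le> 2 * \<delta>"
proof -
  have vH: "v \<in> H1 L" "v \<in> L2 L" and vc: "continuous_on {-L..L} v" using v by (auto simp: H10_def H1_def)
  note W = wderiv_H1[OF vH(1)]
  obtain \<phi> where \<phi>: "\<phi> \<in> test_fun L"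
    and a: "integ L (\<lambda>x. cmod (v x - \<phi> x)) \<le> \<delta>"
    and b: "integ L (\<lambda>x. cmod (wderiv L v x - vector_derivative \<phi> (at x))) \<le> \<delta>"
    using H10_approx_L1[OF L v \<delta>] .
  have "cmod (v y - \<phi> y) \<le> 2 * \<delta>"
  proof (rule ccontr)
    assume "\<not> ?thesis"
    then have big: "cmod (v y - \<phi> y) > 2 * \<delta>" by simp
    have "isCont (\<lambda>x. cmod (v x - \<phi> x)) y"
    proof -
      have "continuous_on {-L<..<L} (\<lambda>x. cmod (v x - \<phi> x))"
        by (intro continuous_intros continuous_on_subset[OF vc] continuous_on_subset[OF test_fun_D(3)[OF \<phi>]]) auto
      then show ?thesis using y by (simp add: continuous_on_eq_continuous_at)
    qed
    then have "((\<lambda>x. cmod (v x - \<phi> x)) \<longlongrightarrow> cmod (v y - \<phi> y)) (at y)" by (simp only: isCont_def)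
    then have "eventually (\<lambda>x. 2 * \<delta> < cmod (v x - \<phi> x)) (at y)"
      using big by (rule order_tendstoD(1))
    then obtain \<eta>1 where \<eta>1: "\<eta>1 > 0" "\<And>x. x \<noteq> y \<Longrightarrow> dist x y < \<eta>1 \<Longrightarrow> cmod (v x - \<phi> x) > 2 * \<delta>"
      unfolding eventually_at by blast
    have \<eta>1': "cmod (v x - \<phi> x) > 2 * \<delta>" if "dist x y < \<eta>1" for x
      using \<eta>1(2)[OF _ that] big by (cases "x = y") simp_all
    define \<eta> where "\<eta> = min \<eta>1 (min (y + L) (L - y))"
    have \<eta>: "\<eta> > 0" "\<eta> \<le> \<eta>1" "{y-\<eta><..<y+\<eta>} \<subseteq> {-L<..<L}" using \<eta>1 y by (auto simp: \<eta>_def)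
    \<comment> \<open>below the least \<open>L\<^sup>1\<close> distance that a gap of \<open>\<delta>/2\<close> on an interval of length \<open>2 \<eta>\<close> forces\<close>
    define d where "d = min (\<delta>/2) (\<eta> * \<delta> / 2)"
    have d: "d > 0" "d \<le> \<delta>/2" "d < \<eta> * \<delta>" using \<delta> \<eta> by (auto simp: d_def min_def)
    obtain \<theta> where \<theta>: "\<theta> \<in> test_fun L"
      and a': "integ L (\<lambda>x. cmod (v x - \<theta> x)) \<le> d"
      and b': "integ L (\<lambda>x. cmod (wderiv L v x - vector_derivative \<theta> (at x))) \<le> d"
      using H10_approx_L1[OF L v d(1)] .
    have i: "set_integrable lborel {-L<..<L} (\<lambda>x. cmod (wderiv L v x - vector_derivative \<psi> (at x)))" if "\<psi> \<in> test_fun L" for \<psi>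
      using that by (intro set_integrable_norm L2_set_integrable L2_diff W test_fun_H1(2)[OF L])
    have sup: "cmod (\<phi> x - \<theta> x) \<le> \<delta> + d" if x: "x \<in> {-L..L}" for x
    proof -
      have "cmod (\<phi> x - \<theta> x) \<le> integ L (\<lambda>x. cmod (vector_derivative \<phi> (at x) - vector_derivative \<theta> (at x)))"
        by (rule test_fun_sup_bound[OF L \<phi> \<theta> x])
      also have "\<dots> \<le> integ L (\<lambda>x. cmod (wderiv L v x - vector_derivative \<phi> (at x)) + cmod (wderiv L v x - vector_derivative \<theta> (at x)))"
      proof (rule set_integral_mono)
        show "set_integrable lborel {-L<..<L} (\<lambda>x. cmod (vector_derivative \<phi> (at x) - vector_derivative \<theta> (at x)))"
          by (intro set_integrable_norm L2_set_integrable L2_diff test_fun_H1(2)[OF L] \<phi> \<theta>)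
        show "set_integrable lborel {-L<..<L} (\<lambda>x. cmod (wderiv L v x - vector_derivative \<phi> (at x)) + cmod (wderiv L v x - vector_derivative \<theta> (at x)))"
          by (intro set_integral_add i \<phi> \<theta>)
        show "cmod (p - q) \<le> cmod (s - p) + cmod (s - q)" for p q s
          using norm_triangle_ineq4[of "s - q" "s - p"] by simp
      qed
      also have "\<dots> \<le> \<delta> + d" using b b' by (subst set_integral_add(2)) (auto intro: i \<phi> \<theta>)
      finally show ?thesis .
    qed
    have low: "cmod (v x - \<theta> x) \<ge> \<delta> / 2" if "x \<in> {y-\<eta><..<y+\<eta>}" for x
    proof -
      have "cmod (v x - \<phi> x) > 2 * \<delta>" using that \<eta> by (intro \<eta>1') (auto simp: dist_real_def)
      moreover have "cmod (\<phi> x - \<theta> x) \<le> \<delta> + d" using that \<eta>(3) by (intro sup) auto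
      moreover have "cmod (v x - \<phi> x) \<le> cmod (v x - \<theta> x) + cmod (\<phi> x - \<theta> x)"
        using norm_triangle_ineq4[of "v x - \<theta> x" "\<phi> x - \<theta> x"] by simp
      ultimately show ?thesis using d by linarith
    qed
    have iv: "set_integrable lborel {-L<..<L} (\<lambda>x. cmod (v x - \<theta> x))"
      by (intro set_integrable_norm L2_set_integrable L2_diff vH test_fun_H1(1)[OF L] \<theta>)
    have "\<eta> * \<delta> = set_lebesgue_integral lborel {y-\<eta><..<y+\<eta>} (\<lambda>x. \<delta>/2)"
      using \<eta> by (simp add: set_integral_const)
    also have "\<dots> \<le> integ L (\<lambda>x. cmod (v x - \<theta> x))"
      unfolding set_lebesgue_integral_def
    proof (rule integral_mono)
      show "integrable lborel (\<lambda>x. indicat_real {y - \<eta><..<y + \<eta>} x *\<^sub>R (\<delta> / 2))" 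
        using set_integrable_subset[OF set_integrable_const_interval _ \<eta>(3), of "\<delta>/2"] by (simp add: set_integrable_def)
      show "integrable lborel (\<lambda>x. indicat_real {-L<..<L} x *\<^sub>R cmod (v x - \<theta> x))"
        using iv by (simp add: set_integrable_def)
      show "indicat_real {y - \<eta><..<y + \<eta>} x *\<^sub>R (\<delta> / 2) \<le> indicat_real {-L<..<L} x *\<^sub>R cmod (v x - \<theta> x)" for x
        using low[of x] \<eta>(3) by (auto simp: indicator_def)
    qed
    finally show False using a' d by linarith
  qed
  then show ?thesis using that[OF \<phi> a b] by blast
qed

section \<open>Piecewise smooth functions with one kink\<close>

definition kink :: "real \<Rightarrow> real \<Rightarrow> (real \<Rightarrow> complex) \<Rightarrow> (real \<Rightarrow> complex) \<Rightarrow> real \<Rightarrow> complex" where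
  "kink L y F1 F2 x = (if x \<in> {-L..L} then if x \<le> y then F1 x else F2 x else 0)"

text \<open>The derivative of a function with a kink and zero boundary values is approximated in \<open>L\<^sup>2\<close> by
  derivatives of test functions: cut it off continuously near \<open>-L\<close>, \<open>y\<close> and \<open>L\<close>, and restore mean zero
  by subtracting a small multiple of a fixed hat function \<open>\<rho>\<close>, so that the primitive is a test function.\<close>
lemma cutoff_approximation:
  fixes G1 G2 :: "real \<Rightarrow> complex"
  assumes y: "-L < y" "y < L"
    and G1: "continuous_on UNIV G1" and G2: "continuous_on UNIV G2"
    and g_def: "g = (\<lambda>x. if x \<le> y then G1 x else G2 x)"
    and mean: "integ L g = 0"
    and \<delta>: "\<delta> > 0"
  obtains \<phi> where "\<phi> \<in> test_fun L"
    "integ L (\<lambda>x. (cmod (g x - vector_derivative \<phi> (at x)))\<^sup>2) \<le> \<delta>"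
proof -
  have L: "L > 0" using y by simp
  define m where "m = (\<lambda>x. min \<bar>x - y\<bar> (L - \<bar>x\<bar>))"
  define \<eta> where "\<eta> = (\<lambda>(n::nat) x. max 0 (min 1 (real (Suc n) * m x - 1)))"
  define \<psi>0 where "\<psi>0 = (\<lambda>n x. g x * of_real (\<eta> n x))"
  define \<rho> where "\<rho> = (\<lambda>x. of_real (max 0 (L/2 - \<bar>x\<bar>)) :: complex)"
  define c where "c = (\<lambda>n. integ L (\<psi>0 n))"
  define R where "R = integ L \<rho>"
  define \<psi> where "\<psi> = (\<lambda>n x. \<psi>0 n x - c n / R * \<rho> x)"
  have g1: "g x = G1 x" if "x \<le> y" for x using that by (simp add: g_def)
  have g2: "g x = G2 x" if "y < x" for x using that by (simp add: g_def)
  have \<eta>b: "0 \<le> \<eta> n x" "\<eta> n x \<le> 1" for n x by (auto simp: \<eta>_def)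
  have \<eta>c: "continuous_on S (\<eta> n)" for n S unfolding \<eta>_def m_def by (intro continuous_intros)
  have \<rho>c: "continuous_on S \<rho>" for S unfolding \<rho>_def by (intro continuous_intros)
  have \<eta>y: "\<eta> n y = 0" for n using y by (auto simp: \<eta>_def m_def)
  have \<psi>0c: "continuous_on UNIV (\<psi>0 n)" for n
  proof -
    have "continuous_on ({..y} \<union> {y..}) (\<lambda>x. if x \<le> y then G1 x * of_real (\<eta> n x) else G2 x * of_real (\<eta> n x))"
      by (rule continuous_on_If)
         (auto intro!: continuous_intros \<eta>c continuous_on_subset[OF G1] continuous_on_subset[OF G2] simp: \<eta>y antisym)
    moreover have "{..y} \<union> {y..} = UNIV" by auto
    moreover have "\<psi>0 n = (\<lambda>x. if x \<le> y then G1 x * of_real (\<eta> n x) else G2 x * of_real (\<eta> n x))"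
      by (auto simp: \<psi>0_def g_def)
    ultimately show ?thesis by simp
  qed
  have \<psi>c: "continuous_on UNIV (\<psi> n)" for n
    unfolding \<psi>_def by (intro continuous_intros \<psi>0c \<rho>c)
  have "R = of_real (L\<^sup>2 / 4)"
  proof -
    have d: "((\<lambda>x. (max 0 (x + L/2))\<^sup>2 / 2) has_real_derivative max 0 (x + L/2)) (at x)"
      "((\<lambda>x. - (max 0 (L/2 - x))\<^sup>2 / 2) has_real_derivative max 0 (L/2 - x)) (at x)" for x
    proof -
      have "((\<lambda>x. (max 0 (x + L/2))\<^sup>2) has_real_derivative 2 * max 0 (x + L/2) * 1) (at x)"
        "((\<lambda>x. (max 0 (L/2 - x))\<^sup>2) has_real_derivative 2 * max 0 (L/2 - x) * -1) (at x)"
        by (rule DERIV_chain2[where g = "\<lambda>x. x + L/2", OF max0_square_deriv]; auto intro!: derivative_eq_intros)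
           (rule DERIV_chain2[where g = "\<lambda>x. L/2 - x", OF max0_square_deriv]; auto intro!: derivative_eq_intros)
      from DERIV_cdivide[OF this(1), of 2] DERIV_cdivide[OF DERIV_minus[OF this(2)], of 2]
      show "((\<lambda>x. (max 0 (x + L/2))\<^sup>2 / 2) has_real_derivative max 0 (x + L/2)) (at x)"
        "((\<lambda>x. - (max 0 (L/2 - x))\<^sup>2 / 2) has_real_derivative max 0 (L/2 - x)) (at x)" by simp_all
    qed
    have "R = (of_real ((max 0 (0 + L/2))\<^sup>2 / 2) - of_real ((max 0 (-L + L/2))\<^sup>2 / 2)) +
       (of_real (- (max 0 (L/2 - L))\<^sup>2 / 2) - of_real (- (max 0 (L/2 - 0))\<^sup>2 / 2))"
      unfolding R_def
    proof (rule split_FTC(2)[where ?p1.0 = "\<lambda>x. of_real (max 0 (x + L/2))" and ?p2.0 = "\<lambda>x. of_real (max 0 (L/2 - x))"])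
      show "((\<lambda>x. complex_of_real ((max 0 (x + L / 2))\<^sup>2 / 2)) has_vector_derivative complex_of_real (max 0 (x + L / 2))) (at x)" for x
        using d(1)[of x] by (intro has_vector_derivative_of_real) (simp add: has_real_derivative_iff_has_vector_derivative)
      show "((\<lambda>x. complex_of_real (- (max 0 (L / 2 - x))\<^sup>2 / 2)) has_vector_derivative complex_of_real (max 0 (L / 2 - x))) (at x)" for x
        using d(2)[of x] by (intro has_vector_derivative_of_real) (simp add: has_real_derivative_iff_has_vector_derivative)
    qed (use L in \<open>auto intro!: continuous_intros simp: \<rho>_def\<close>)
    also have "\<dots> = of_real (L\<^sup>2 / 4)"
      using L by (simp add: max_def power2_eq_square field_simps)
    finally show ?thesis .
  qed
  then have R: "R \<noteq> 0" using L by (simp only: of_real_eq_0_iff) simp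
  have gL2: "g \<in> L2 L" by (rule piecewise_L2[OF y G1 G2 g1 g2])
  have \<psi>0L2: "\<psi>0 n \<in> L2 L" for n by (rule piecewise_L2[OF y \<psi>0c \<psi>0c]) auto
  have \<rho>L2: "\<rho> \<in> L2 L" by (rule piecewise_L2[OF y \<rho>c \<rho>c]) auto
  have \<psi>L2: "\<psi> n \<in> L2 L" for n by (rule piecewise_L2[OF y \<psi>c \<psi>c]) auto
  have mean0: "integ L (\<psi> n) = 0" for n
  proof -
    have i: "set_integrable lborel {-L<..<L} (\<lambda>x. c n / R * \<rho> x)"
      by (rule set_integrable_mult_right) (rule L2_set_integrable[OF \<rho>L2])
    have "integ L (\<psi> n)
        = integ L (\<psi>0 n) - integ L (\<lambda>x. c n / R * \<rho> x)"
      unfolding \<psi>_def by (rule set_integral_diff(2)[OF L2_set_integrable[OF \<psi>0L2] i])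
    also have "\<dots> = c n - c n / R * R"
      by (simp only: set_integral_mult_right R_def[symmetric]) (simp add: c_def)
    also have "\<dots> = 0" using R by simp
    finally show ?thesis .
  qed
  obtain C where C: "C > 0" "\<And>x. x \<in> {-L<..<L} \<Longrightarrow> cmod (g x) \<le> C"
    using piecewise_bounded[where f = g, OF y G1 G2 g1 g2] by blast
  have \<eta>lim: "(\<lambda>n. \<eta> n x) \<longlonglongrightarrow> 1" if x: "x \<in> {-L<..<L}" "x \<noteq> y" for x
  proof (rule tendsto_eventually)
    have mx: "m x > 0" using x by (auto simp: m_def)
    obtain N :: nat where N: "2 / m x < real N" using reals_Archimedean2 by blast
    have "\<eta> n x = 1" if "n \<ge> N" for n
    proof -
      have "2 / m x \<le> real (Suc n)" using N that by linarith
      then have "2 \<le> real (Suc n) * m x" using mx by (simp add: pos_divide_le_eq)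
      then show ?thesis by (simp add: \<eta>_def)
    qed
    then show "\<forall>\<^sub>F n in sequentially. \<eta> n x = 1" using eventually_ge_at_top[of N] by (rule eventually_mono[rotated])
  qed
  have \<psi>0b: "cmod (\<psi>0 n x) \<le> C" if "x \<in> {-L<..<L}" for n x
    using C(2)[OF that] \<eta>b[of n x] mult_mono[OF C(2)[OF that] \<eta>b(2)[of n x]] C(1) by (simp add: \<psi>0_def norm_mult)
  have clim: "c \<longlonglongrightarrow> 0"
  proof -
    have "c \<longlonglongrightarrow> integ L g"
      unfolding c_def set_lebesgue_integral_def
    proof (rule integral_dominated_convergence)
      show "(\<lambda>x. indicator {-L<..<L} x *\<^sub>R g x) \<in> borel_measurable lborel"
        using gL2 by (simp add: L2_def set_borel_measurable_def)
      show "(\<lambda>x. indicator {-L<..<L} x *\<^sub>R \<psi>0 n x) \<in> borel_measurable lborel" for n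
        using \<psi>0L2 by (simp add: L2_def set_borel_measurable_def)
      show "integrable lborel (\<lambda>x. indicator {-L<..<L} x *\<^sub>R C)"
        using set_integrable_const_interval[of L C] by (simp add: set_integrable_def)
      show "AE x in lborel. (\<lambda>n. indicator {-L<..<L} x *\<^sub>R \<psi>0 n x) \<longlonglongrightarrow> indicator {-L<..<L} x *\<^sub>R g x"
        using AE_lborel_singleton[of y]
      proof eventually_elim
        case (elim x)
        show ?case
        proof (cases "x \<in> {-L<..<L}")
          case True
          have "(\<lambda>n. g x * of_real (\<eta> n x)) \<longlonglongrightarrow> g x * of_real 1"
            by (intro tendsto_intros \<eta>lim True elim)
          then show ?thesis using True by (simp add: \<psi>0_def)
        qed simp
      qed
      show "AE x in lborel. norm (indicator {-L<..<L} x *\<^sub>R \<psi>0 n x) \<le> indicator {-L<..<L} x *\<^sub>R C" for n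
        using \<psi>0b by (intro AE_I2) (auto simp: indicator_def)
    qed
    then show ?thesis using mean by simp
  qed
  have "Bseq (\<lambda>n. c n / R)" by (rule convergent_imp_Bseq, rule convergentI, rule tendsto_divide[OF clim tendsto_const R])
  then obtain K where K: "K > 0" "\<And>n. cmod (c n / R) \<le> K" unfolding Bseq_def by blast
  have \<rho>b: "cmod (\<rho> x) \<le> L" for x using L by (auto simp: \<rho>_def)
  have "(\<lambda>n. integ L (\<lambda>x. (cmod (g x - \<psi> n x))\<^sup>2)) \<longlonglongrightarrow> integ L (\<lambda>x. 0::real)"
    unfolding set_lebesgue_integral_def
  proof (rule integral_dominated_convergence)
    show "(\<lambda>x. indicat_real {-L<..<L} x *\<^sub>R (0::real)) \<in> borel_measurable lborel" by simp
    show "(\<lambda>x. indicator {-L<..<L} x *\<^sub>R (cmod (g x - \<psi> n x))\<^sup>2) \<in> borel_measurable lborel" for n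
      using L2_norm_square_measurable[OF L2_diff[OF gL2 \<psi>L2]] by (simp add: set_borel_measurable_def)
    show "integrable lborel (\<lambda>x. indicator {-L<..<L} x *\<^sub>R (C + (C + K * L))\<^sup>2)"
      using set_integrable_const_interval[of L "(C + (C + K * L))\<^sup>2"] by (simp add: set_integrable_def)
    show "AE x in lborel. (\<lambda>n. indicator {-L<..<L} x *\<^sub>R (cmod (g x - \<psi> n x))\<^sup>2) \<longlonglongrightarrow> indicator {-L<..<L} x *\<^sub>R (0::real)"
      using AE_lborel_singleton[of y]
    proof eventually_elim
      case (elim x)
      show ?case
      proof (cases "x \<in> {-L<..<L}")
        case True
        have "(\<lambda>n. (cmod (g x - (g x * of_real (\<eta> n x) - c n / R * \<rho> x)))\<^sup>2) \<longlonglongrightarrow> (cmod (g x - (g x * of_real 1 - 0 / R * \<rho> x)))\<^sup>2"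
          by (intro tendsto_intros \<eta>lim True elim clim R)
        then show ?thesis using True by (simp add: \<psi>_def \<psi>0_def)
      qed simp
    qed
    show "AE x in lborel. norm (indicator {-L<..<L} x *\<^sub>R (cmod (g x - \<psi> n x))\<^sup>2) \<le> indicator {-L<..<L} x *\<^sub>R (C + (C + K * L))\<^sup>2" for n
    proof (intro AE_I2)
      fix x
      show "norm (indicator {-L<..<L} x *\<^sub>R (cmod (g x - \<psi> n x))\<^sup>2) \<le> indicator {-L<..<L} x *\<^sub>R (C + (C + K * L))\<^sup>2"
      proof (cases "x \<in> {-L<..<L}")
        case True
        have "cmod (c n / R * \<rho> x) \<le> K * L"
          unfolding norm_mult by (intro mult_mono K \<rho>b) (use K in auto)
        then have "cmod (\<psi> n x) \<le> C + K * L"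
          using norm_triangle_ineq4[of "\<psi>0 n x" "c n / R * \<rho> x"] \<psi>0b[OF True, of n] by (simp add: \<psi>_def)
        then have "cmod (g x - \<psi> n x) \<le> C + (C + K * L)"
          using norm_triangle_ineq4[of "g x" "\<psi> n x"] C(2)[OF True] by linarith
        then have "(cmod (g x - \<psi> n x))\<^sup>2 \<le> (C + (C + K * L))\<^sup>2" by (intro power_mono) auto
        then show ?thesis using True by simp
      qed simp
    qed
  qed
  then have "(\<lambda>n. integ L (\<lambda>x. (cmod (g x - \<psi> n x))\<^sup>2)) \<longlonglongrightarrow> 0"
    by (simp add: set_lebesgue_integral_def)
  then have "\<forall>\<^sub>F n in sequentially. integ L (\<lambda>x. (cmod (g x - \<psi> n x))\<^sup>2) < \<delta>"
    using \<delta> by (rule order_tendstoD(2))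
  then obtain n where n: "integ L (\<lambda>x. (cmod (g x - \<psi> n x))\<^sup>2) < \<delta>"
    by (auto simp: eventually_sequentially)
  define r where "r = max (L/2) (L - 1 / real (Suc n))"
  have r: "0 < r" "r < L" using L by (auto simp: r_def less_max_iff_disj)
  have z: "\<psi> n x = 0" if "r < \<bar>x\<bar>" for x
  proof -
    have x: "L/2 < \<bar>x\<bar>" "L - 1 / real (Suc n) < \<bar>x\<bar>" using that by (auto simp: r_def)
    have "m x \<le> 1 / real (Suc n)" using x(2) by (simp add: m_def min_le_iff_disj)
    then have "real (Suc n) * m x \<le> 1" by (simp add: field_simps)
    then have "\<eta> n x = 0" by (simp add: \<eta>_def)
    moreover have "\<rho> x = 0" using x(1) by (simp add: \<rho>_def)
    ultimately show ?thesis by (simp add: \<psi>_def \<psi>0_def)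
  qed
  have "integral {-r..r} (\<psi> n) = set_lebesgue_integral lborel {-r..r} (\<psi> n)"
    by (rule set_borel_integral_eq_integral(2)[symmetric], intro borel_integrable_atLeastAtMost' continuous_on_subset[OF \<psi>c]) simp
  also have "\<dots> = integ L (\<psi> n)"
    unfolding set_lebesgue_integral_def
  proof (rule Bochner_Integration.integral_cong)
    show "indicator {-r..r} x *\<^sub>R \<psi> n x = indicator {-L<..<L} x *\<^sub>R \<psi> n x" for x
      using r z[of x] by (cases "r < \<bar>x\<bar>") (auto simp: indicator_def)
  qed simp
  finally have i: "integral {-r..r} (\<psi> n) = 0" using mean0 by simp
  obtain \<phi> where \<phi>: "\<phi> \<in> test_fun L" "\<And>x. vector_derivative \<phi> (at x) = \<psi> n x"
    using primitive_test_fun[OF r \<psi>c z i] by blast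
  show ?thesis by (rule that[OF \<phi>(1)]) (use n \<phi>(2) in simp)
qed

text \<open>The kinked function \<open>w\<close> and a test function \<open>\<phi>\<close> both vanish at \<open>-L\<close> and \<open>L\<close>, so the \<open>L\<^sup>2\<close> norm of
  the derivative of \<open>w - \<phi>\<close> bounds \<open>w - \<phi>\<close> uniformly. Hence it suffices to approximate the derivative.\<close>
lemma kink_H10:
  assumes y: "-L < y" "y < L"
    and F1: "\<And>x. (F1 has_vector_derivative G1 x) (at x)" and G1: "continuous_on UNIV G1"
    and F2: "\<And>x. (F2 has_vector_derivative G2 x) (at x)" and G2: "continuous_on UNIV G2"
    and match: "F1 y = F2 y" and bc: "F1 (-L) = 0" "F2 L = 0"
  shows "kink L y F1 F2 \<in> H10 L"
    and "AE x in lborel. x \<in> {-L<..<L} \<longrightarrow> wderiv L (kink L y F1 F2) x = (if x \<le> y then G1 x else G2 x)"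
proof -
  define w where "w = kink L y F1 F2"
  define g where "g = (\<lambda>x. if x \<le> y then G1 x else G2 x)"
  have L: "L > 0" using y by simp
  have cF: "continuous_on S F1" "continuous_on S F2" for S
    using F1 F2 by (auto intro!: continuous_at_imp_continuous_on has_vector_derivative_continuous)
  have w1: "w x = F1 x" if "-L < x" "x \<le> y" for x using that y by (simp add: w_def kink_def)
  have w2: "w x = F2 x" if "y < x" "x < L" for x using that y by (simp add: w_def kink_def)
  have g1: "g x = G1 x" if "x \<le> y" for x using that by (simp add: g_def)
  have g2: "g x = G2 x" if "y < x" for x using that by (simp add: g_def)
  have wL2: "w \<in> L2 L" by (rule piecewise_L2[OF y cF w1 w2])
  have gL2: "g \<in> L2 L" by (rule piecewise_L2[OF y G1 G2 g1 g2])
  have wd: "weak_deriv L w g" by (rule weak_deriv_piecewise[OF y F1 G1 F2 G2 match w1 w2 g1 g2])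
  have H1: "w \<in> H1 L" by (rule AE_wderiv(1)[OF L wL2 gL2 wd])
  show "AE x in lborel. x \<in> {-L<..<L} \<longrightarrow> wderiv L (kink L y F1 F2) x = (if x \<le> y then G1 x else G2 x)"
    using AE_wderiv(2)[OF L wL2 gL2 wd] by (simp add: w_def g_def)
  have cont: "continuous_on {-L..L} w"
  proof -
    have "continuous_on ({-L..y} \<union> {y..L}) (\<lambda>x. if x \<le> y then F1 x else F2 x)"
      by (rule continuous_on_If) (use match in \<open>auto intro!: cF simp: antisym\<close>)
    moreover have "{-L..y} \<union> {y..L} = {-L..L}" using y by auto
    ultimately have "continuous_on {-L..L} (\<lambda>x. if x \<le> y then F1 x else F2 x)" by simp
    then show ?thesis by (rule continuous_on_eq) (auto simp: w_def kink_def)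
  qed
  have mean: "integ L g = 0"
    using split_FTC(2)[OF y F1 G1 F2 G2 g1 g2] match bc by simp
  have "\<exists>\<phi>\<in>test_fun L. H1_norm L (\<lambda>x. w x - \<phi> x) < \<epsilon>" if \<epsilon>: "\<epsilon> > 0" for \<epsilon>
  proof -
    define K where "K = 2 + 2 * L * (L + 1/2)\<^sup>2"
    \<comment> \<open>\<open>K - 1\<close> collects both parts of the squared norm, and \<open>K - 1 < K\<^sup>2\<close>\<close>
    define \<delta> where "\<delta> = \<epsilon> / K"
    have K: "K \<ge> 2" using L by (simp add: K_def)
    have \<delta>: "\<delta> > 0" using K \<epsilon> by (simp add: \<delta>_def)
    obtain \<phi> where \<phi>: "\<phi> \<in> test_fun L"
      and B: "integ L (\<lambda>x. (cmod (g x - vector_derivative \<phi> (at x)))\<^sup>2) \<le> \<delta>\<^sup>2"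
      using cutoff_approximation[OF y G1 G2 g_def mean, of "\<delta>\<^sup>2"] \<delta> by auto
    note T = test_fun_D[OF \<phi>] and S = test_fun_H1[OF L \<phi>]
    let ?h = "\<lambda>x. g x - vector_derivative \<phi> (at x)"
    have l2: "(\<lambda>x. w x - \<phi> x) \<in> L2 L" "?h \<in> L2 L" by (intro L2_diff wL2 gL2 S)+
    have wd': "weak_deriv L (\<lambda>x. w x - \<phi> x) ?h" by (intro weak_deriv_diff L wd wL2 gL2 S)
    have l1: "integ L (\<lambda>x. cmod (?h x)) \<le> (L + 1/2) * \<delta>"
      by (rule integral_norm_le_of_square[OF l2(2) L \<delta> B])
    have sup: "cmod (w x - \<phi> x) \<le> (L + 1/2) * \<delta>" if x: "x \<in> {-L<..<L}" for x
    proof (cases "x \<le> y")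
      case True
      have "cmod ((F1 x - \<phi> x) - (F1 (-L) - \<phi> (-L))) \<le> integ L (\<lambda>x. cmod (?h x))"
        by (rule FTC_norm_bound[where P = "\<lambda>x. F1 x - \<phi> x" and p = "\<lambda>x. G1 x - vector_derivative \<phi> (at x)"])
           (use x True y in \<open>auto intro!: has_vector_derivative_diff F1 T continuous_intros G1 L2_set_integrable l2(2) simp: g1\<close>)
      then show ?thesis using bc T l1 w1[of x] x True by simp
    next
      case False
      have "cmod ((F2 L - \<phi> L) - (F2 x - \<phi> x)) \<le> integ L (\<lambda>x. cmod (?h x))"
        by (rule FTC_norm_bound[where P = "\<lambda>x. F2 x - \<phi> x" and p = "\<lambda>x. G2 x - vector_derivative \<phi> (at x)"])
           (use x False y in \<open>auto intro!: has_vector_derivative_diff F2 T continuous_intros G2 L2_set_integrable l2(2) simp: g2\<close>)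
      then show ?thesis using bc T l1 w2[of x] x False by (simp add: norm_minus_commute)
    qed
    have "integ L (\<lambda>x. (cmod (w x - \<phi> x))\<^sup>2)
        \<le> integ L (\<lambda>x. ((L + 1/2) * \<delta>)\<^sup>2)"
      by (rule set_integral_mono[OF _ set_integrable_const_interval])
         (use l2 sup in \<open>auto simp: L2_def intro!: power_mono\<close>)
    also have "\<dots> = 2 * L * ((L + 1/2) * \<delta>)\<^sup>2" using L by (simp add: set_integral_const)
    finally have A: "integ L (\<lambda>x. (cmod (w x - \<phi> x))\<^sup>2) \<le> 2 * L * ((L + 1/2) * \<delta>)\<^sup>2" .
    have "H1_norm L (\<lambda>x. w x - \<phi> x) \<le> sqrt (2 * L * ((L + 1/2) * \<delta>)\<^sup>2 + \<delta>\<^sup>2)"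
      unfolding H1_norm_eq[OF L l2 wd'] using A B by (intro real_sqrt_le_mono add_mono)
    also have "\<dots> = sqrt ((K - 1) * \<delta>\<^sup>2)"
      unfolding K_def power_mult_distrib by (rule arg_cong[of _ _ sqrt]) algebra
    also have "\<dots> < sqrt (K\<^sup>2 * \<delta>\<^sup>2)"
    proof (intro real_sqrt_less_mono mult_strict_right_mono)
      have "K * 1 \<le> K * K" using K by (intro mult_left_mono) auto
      then show "K - 1 < K\<^sup>2" by (simp add: power2_eq_square)
    qed (use \<delta> in auto)
    also have "\<dots> = \<epsilon>" using K \<epsilon> by (simp add: \<delta>_def power_divide)
    finally show ?thesis using \<phi> by blast
  qed
  then show "kink L y F1 F2 \<in> H10 L"
    using H1 cont by (auto simp: H10_def w_def[symmetric]) (auto simp: w_def kink_def)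
qed

text \<open>For a test function in place of \<open>v\<close> this is integration by parts on both sides of \<open>y\<close>. Each term
  depends continuously on \<open>v\<close>: the two integrals have bounded coefficients, and the point value
  is controlled by the approximation lemma above.\<close>
lemma kink_green:
  assumes y: "-L < y" "y < L"
    and F1: "\<And>x. (F1 has_vector_derivative G1 x) (at x)" and G1: "\<And>x. (G1 has_vector_derivative - \<mu> * F1 x) (at x)"
    and F2: "\<And>x. (F2 has_vector_derivative G2 x) (at x)" and G2: "\<And>x. (G2 has_vector_derivative - \<mu> * F2 x) (at x)"
    and match: "F1 y = F2 y" and bc: "F1 (-L) = 0" "F2 L = 0"
    and v: "v \<in> H10 L"
  shows "integ L (\<lambda>x. wderiv L (kink L y F1 F2) x * wderiv L v x)
    = \<mu> * integ L (\<lambda>x. kink L y F1 F2 x * v x) + (G1 y - G2 y) * v y"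
proof -
  define w where "w = kink L y F1 F2"
  define g where "g = (\<lambda>x. if x \<le> y then G1 x else G2 x)"
  have L: "L > 0" using y by simp
  have cF: "continuous_on UNIV F1" "continuous_on UNIV F2" and cG: "continuous_on UNIV G1" "continuous_on UNIV G2"
    using F1 F2 G1 G2 by (auto intro!: continuous_at_imp_continuous_on has_vector_derivative_continuous)
  have w1: "w x = F1 x" if "-L < x" "x \<le> y" for x using that y by (simp add: w_def kink_def)
  have w2: "w x = F2 x" if "y < x" "x < L" for x using that y by (simp add: w_def kink_def)
  have g1: "g x = G1 x" if "x \<le> y" for x using that by (simp add: g_def)
  have g2: "g x = G2 x" if "y < x" for x using that by (simp add: g_def)
  have gm: "set_borel_measurable lborel {-L<..<L} g" by (rule piecewise_measurable[OF cG g1 g2])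
  have wm: "set_borel_measurable lborel {-L<..<L} w" by (rule piecewise_measurable[OF cF w1 w2])
  obtain Cg where Cg: "Cg > 0" "\<And>x. x \<in> {-L<..<L} \<Longrightarrow> cmod (g x) \<le> Cg"
    using piecewise_bounded[where f = g, OF y cG g1 g2] by blast
  obtain Cw where Cw: "Cw > 0" "\<And>x. x \<in> {-L<..<L} \<Longrightarrow> cmod (w x) \<le> Cw"
    using piecewise_bounded[where f = w, OF y cF w1 w2] by blast
  have vH: "v \<in> H1 L" "v \<in> L2 L" using v by (auto simp: H10_def H1_def)
  note W = wderiv_H1[OF vH(1)]
  let ?I = "\<lambda>f. integ L f"
  have ig: "set_integrable lborel {-L<..<L} (\<lambda>x. g x * f x)" if "f \<in> L2 L" for f
    by (rule set_integrable_bounded_mult(1)[OF gm _ Cg(2) L2_set_integrable[OF that]]) auto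
  have iw: "set_integrable lborel {-L<..<L} (\<lambda>x. w x * f x)" if "f \<in> L2 L" for f
    by (rule set_integrable_bounded_mult(1)[OF wm _ Cw(2) L2_set_integrable[OF that]]) auto
  have eq1: "?I (\<lambda>x. wderiv L w x * wderiv L v x) = ?I (\<lambda>x. g x * wderiv L v x)"
  proof (rule set_integral_cong_of_AE)
    have wH: "w \<in> H10 L" unfolding w_def by (rule kink_H10(1)[OF y F1 cG(1) F2 cG(2) match bc])
    have "(\<lambda>x. (indicator {-L<..<L} x *\<^sub>R wderiv L w x) * (indicator {-L<..<L} x *\<^sub>R wderiv L v x)) \<in> borel_measurable lborel"
      using W(1) wderiv_H1(1)[of w L] wH by (intro borel_measurable_times) (auto simp: L2_def H10_def set_borel_measurable_def)
    moreover have "(\<lambda>x. (indicator {-L<..<L} x *\<^sub>R wderiv L w x) * (indicator {-L<..<L} x *\<^sub>R wderiv L v x))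
       = (\<lambda>x. indicator {-L<..<L} x *\<^sub>R (wderiv L w x * wderiv L v x))" by (auto simp: indicator_def)
    ultimately show "set_borel_measurable lborel {-L<..<L} (\<lambda>x. wderiv L w x * wderiv L v x)"
      by (simp add: set_borel_measurable_def)
    show "set_borel_measurable lborel {-L<..<L} (\<lambda>x. g x * wderiv L v x)"
      by (rule set_borel_measurable_of_integrable[OF ig[OF W(1)]])
    show "AE x in lborel. x \<in> {-L<..<L} \<longrightarrow> wderiv L w x * wderiv L v x = g x * wderiv L v x"
      using kink_H10(2)[OF y F1 cG(1) F2 cG(2) match bc] by eventually_elim (auto simp: w_def g_def)
  qed
  define J where "J = G1 y - G2 y"
  define D where "D = ?I (\<lambda>x. g x * wderiv L v x) - \<mu> * ?I (\<lambda>x. w x * v x) - J * v y"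
  have test: "?I (\<lambda>x. g x * vector_derivative \<phi> (at x)) - \<mu> * ?I (\<lambda>x. w x * \<phi> x) - J * \<phi> y = 0" if \<phi>: "\<phi> \<in> test_fun L" for \<phi>
  proof -
    note T = test_fun_D[OF \<phi>] and S = test_fun_H1[OF L \<phi>]
    let ?d = "\<lambda>x. vector_derivative \<phi> (at x)"
    have "?I (\<lambda>x. g x * ?d x - \<mu> * (w x * \<phi> x)) = (G1 y * \<phi> y - G1 (-L) * \<phi> (-L)) + (G2 L * \<phi> L - G2 y * \<phi> y)"
    proof (rule split_FTC(2)[OF y])
      show "((\<lambda>x. G1 x * \<phi> x) has_vector_derivative G1 x * ?d x + - \<mu> * F1 x * \<phi> x) (at x)" 
        "((\<lambda>x. G2 x * \<phi> x) has_vector_derivative G2 x * ?d x + - \<mu> * F2 x * \<phi> x) (at x)" for x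
        by (intro has_vector_derivative_mult G1 G2 T)+
    qed (auto intro!: continuous_intros cF cG T simp: g1 g2 w1 w2)
    then show ?thesis using T ig[OF S(2)] iw[OF S(1)] by (simp add: set_integral_diff J_def algebra_simps)
  qed
  have small: "cmod D \<le> (Cg + cmod \<mu> * Cw + 2 * cmod J) * \<delta>" if \<delta>: "\<delta> > 0" for \<delta>
  proof -
    obtain \<phi> where \<phi>: "\<phi> \<in> test_fun L"
      and a: "?I (\<lambda>x. cmod (v x - \<phi> x)) \<le> \<delta>"
      and b: "?I (\<lambda>x. cmod (wderiv L v x - vector_derivative \<phi> (at x))) \<le> \<delta>"
      and c: "cmod (v y - \<phi> y) \<le> 2 * \<delta>"
      using H10_approx[OF L v \<delta> y] by blast
    note T = test_fun_D[OF \<phi>] and S = test_fun_H1[OF L \<phi>]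
    have "D = ?I (\<lambda>x. g x * (wderiv L v x - vector_derivative \<phi> (at x))) - \<mu> * ?I (\<lambda>x. w x * (v x - \<phi> x)) - J * (v y - \<phi> y)"
      using test[OF \<phi>] ig[OF S(2)] iw[OF S(1)] ig[OF W(1)] iw[OF vH(2)]
      by (simp add: D_def right_diff_distrib set_integral_diff) (simp add: algebra_simps)
    also have "cmod \<dots> \<le> cmod (?I (\<lambda>x. g x * (wderiv L v x - vector_derivative \<phi> (at x)))) + cmod (\<mu> * ?I (\<lambda>x. w x * (v x - \<phi> x))) + cmod (J * (v y - \<phi> y))"
      using norm_triangle_ineq4 order_trans add_right_mono by meson
    also have "\<dots> \<le> Cg * \<delta> + cmod \<mu> * (Cw * \<delta>) + cmod J * (2 * \<delta>)"
    proof (intro add_mono)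
      have "cmod (?I (\<lambda>x. g x * (wderiv L v x - vector_derivative \<phi> (at x)))) \<le> Cg * ?I (\<lambda>x. cmod (wderiv L v x - vector_derivative \<phi> (at x)))"
        by (intro set_integrable_bounded_mult(2)[OF gm _ Cg(2)] L2_set_integrable L2_diff W S) auto
      also have "\<dots> \<le> Cg * \<delta>" using b Cg by (intro mult_left_mono) auto
      finally show "cmod (?I (\<lambda>x. g x * (wderiv L v x - vector_derivative \<phi> (at x)))) \<le> Cg * \<delta>" .
      have "cmod (?I (\<lambda>x. w x * (v x - \<phi> x))) \<le> Cw * ?I (\<lambda>x. cmod (v x - \<phi> x))"
        by (intro set_integrable_bounded_mult(2)[OF wm _ Cw(2)] L2_set_integrable L2_diff vH S) auto
      also have "\<dots> \<le> Cw * \<delta>" using a Cw by (intro mult_left_mono) auto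
      finally show "cmod (\<mu> * ?I (\<lambda>x. w x * (v x - \<phi> x))) \<le> cmod \<mu> * (Cw * \<delta>)"
        unfolding norm_mult by (intro mult_left_mono) auto
      show "cmod (J * (v y - \<phi> y)) \<le> cmod J * (2 * \<delta>)"
        unfolding norm_mult using c by (intro mult_left_mono) auto
    qed
    finally show ?thesis by (simp add: algebra_simps)
  qed
  have "D = 0"
  proof (rule ccontr)
    assume "D \<noteq> 0"
    define M where "M = Cg + cmod \<mu> * Cw + 2 * cmod J"
    have M: "M > 0" using Cg(1) Cw(1) by (simp add: M_def add_pos_nonneg)
    have "cmod D \<le> M * (cmod D / (2 * M))" using small[of "cmod D / (2 * M)"] M \<open>D \<noteq> 0\<close> by (simp add: M_def)
    then show False using M \<open>D \<noteq> 0\<close> by simp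
  qed
  then show ?thesis using eq1 by (simp add: D_def J_def w_def diff_eq_eq add.commute)
qed

section \<open>Green's identity and the characteristic equation\<close>

text \<open>The solution of \<open>w'' = - k\<^sup>2 w\<close> with \<open>w(0) = 0\<close> and \<open>w'(0) = 1\<close>; \<open>cos_sol\<close> is its derivative. With the
  value \<open>x\<close> at \<open>k = 0\<close> the eigenvalue \<open>0\<close> needs no separate treatment in Green's identity.\<close>
definition sin_sol :: "complex \<Rightarrow> real \<Rightarrow> complex" where
  "sin_sol k x = (if k = 0 then of_real x else sin (k * of_real x) / k)"

definition cos_sol :: "complex \<Rightarrow> real \<Rightarrow> complex" where
  "cos_sol k x = cos (k * of_real x)"

lemma sin_sol_deriv: "(sin_sol k has_vector_derivative cos_sol k x) (at x)"
proof (cases "k = 0")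
  case True
  then have "sin_sol k = of_real" "cos_sol k x = of_real 1" by (auto simp: sin_sol_def cos_sol_def)
  then show ?thesis by (simp only:) (rule has_vector_derivative_of_real[OF DERIV_ident])
next
  case False
  have "((\<lambda>z. sin (k * z) / k) has_field_derivative cos (k * of_real x)) (at (of_real x))"
    using False by (auto intro!: derivative_eq_intros)
  from has_vector_derivative_real_field[OF this] show ?thesis
    using False by (simp add: sin_sol_def[abs_def] cos_sol_def)
qed

lemma cos_sol_deriv: "(cos_sol k has_vector_derivative - k\<^sup>2 * sin_sol k x) (at x)"
proof -
  have "((\<lambda>z. cos (k * z)) has_field_derivative - k\<^sup>2 * sin_sol k x) (at (of_real x))"
    by (auto intro!: derivative_eq_intros simp: sin_sol_def power2_eq_square)
  from has_vector_derivative_real_field[OF this] show ?thesis by (simp add: cos_sol_def[abs_def])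
qed

lemma sin_sol_add: "sin_sol k (s + t) = sin_sol k s * cos_sol k t + cos_sol k s * sin_sol k t"
  by (auto simp: sin_sol_def cos_sol_def distrib_left sin_add add_divide_distrib)

lemma sin_sol_double: "sin_sol k (2 * t) = 2 * sin_sol k t * cos_sol k t"
proof -
  have "sin_sol k (2 * t) = sin_sol k (t + t)" by simp
  then show ?thesis unfolding sin_sol_add by simp
qed

lemma sin_sol_0 [simp]: "sin_sol k 0 = 0" by (simp add: sin_sol_def)

text \<open>Green's function of \<open>-w'' - k\<^sup>2 w\<close> with Dirichlet conditions, multiplied by \<open>sin_sol k (2 * L)\<close>: without the
  denominator it is defined for every \<open>k\<close>.\<close>
definition green :: "real \<Rightarrow> complex \<Rightarrow> real \<Rightarrow> real \<Rightarrow> complex" where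
  "green L k y = kink L y (\<lambda>x. sin_sol k (x + L) * sin_sol k (L - y)) (\<lambda>x. sin_sol k (L - x) * sin_sol k (L + y))"

lemma has_vector_derivative_shift:
  assumes "\<And>x. (f has_vector_derivative f' x) (at x)"
  shows "((\<lambda>x. f (x + c)) has_vector_derivative f' (x + c)) (at x)"
    and "((\<lambda>x. f (c - x)) has_vector_derivative - f' (c - x)) (at x)"
proof -
  have "((\<lambda>x. x + c) has_vector_derivative 1) (at x)" "((\<lambda>x. c - x) has_vector_derivative -1) (at x)"
    by (auto intro!: derivative_eq_intros)
  from vector_diff_chain_at[OF this(1) assms] vector_diff_chain_at[OF this(2) assms]
  show "((\<lambda>x. f (x + c)) has_vector_derivative f' (x + c)) (at x)"
    "((\<lambda>x. f (c - x)) has_vector_derivative - f' (c - x)) (at x)"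
    by (simp_all add: o_def)
qed

lemma green_pieces:
  fixes c d :: complex
  shows "((\<lambda>x. sin_sol k (x + L) * c) has_vector_derivative cos_sol k (x + L) * c) (at x)"
  "((\<lambda>x. cos_sol k (x + L) * c) has_vector_derivative - k\<^sup>2 * (sin_sol k (x + L) * c)) (at x)"
  "((\<lambda>x. sin_sol k (L - x) * d) has_vector_derivative - cos_sol k (L - x) * d) (at x)"
  "((\<lambda>x. - cos_sol k (L - x) * d) has_vector_derivative - k\<^sup>2 * (sin_sol k (L - x) * d)) (at x)"
  by (rule has_vector_derivative_mult_left[OF has_vector_derivative_shift(1)[OF sin_sol_deriv]]
      has_vector_derivative_mult_left[OF has_vector_derivative_shift(1)[OF cos_sol_deriv], THEN has_vector_derivative_eq_rhs]
      has_vector_derivative_mult_left[OF has_vector_derivative_shift(2)[OF sin_sol_deriv], THEN has_vector_derivative_eq_rhs]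
      has_vector_derivative_mult_left[OF has_vector_derivative_minus[OF has_vector_derivative_shift(2)[OF cos_sol_deriv]], THEN has_vector_derivative_eq_rhs];
    simp)+

lemma green_H10:
  assumes y: "-L < y" "y < L"
  shows "green L k y \<in> H10 L"
  unfolding green_def
proof (rule kink_H10(1)[OF y green_pieces(1) _ green_pieces(3)])
  show "continuous_on UNIV (\<lambda>x. cos_sol k (x + L) * sin_sol k (L - y))"
    by (intro continuous_at_imp_continuous_on ballI has_vector_derivative_continuous[OF green_pieces(2)])
  show "continuous_on UNIV (\<lambda>x. - cos_sol k (L - x) * sin_sol k (L + y))"
    by (intro continuous_at_imp_continuous_on ballI has_vector_derivative_continuous[OF green_pieces(4)])
qed (simp_all add: add.commute mult.commute)

text \<open>The derivative of \<open>green L k y\<close> drops at \<open>y\<close> by \<open>sin_sol k (2 * L)\<close>, by the addition theorem.\<close>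
lemma green_identity:
  assumes y: "-L < y" "y < L" and v: "v \<in> H10 L"
  shows "integ L (\<lambda>x. wderiv L (green L k y) x * wderiv L v x)
    = k\<^sup>2 * integ L (\<lambda>x. green L k y x * v x) + sin_sol k (2 * L) * v y"
proof -
  have "sin_sol k (2 * L) = sin_sol k ((y + L) + (L - y))" by simp
  also have "\<dots> = cos_sol k (y + L) * sin_sol k (L - y) - (- cos_sol k (L - y) * sin_sol k (L + y))"
    by (subst sin_sol_add) (simp add: algebra_simps)
  finally have J: "sin_sol k (2 * L) = cos_sol k (y + L) * sin_sol k (L - y) - (- cos_sol k (L - y) * sin_sol k (L + y))" .
  show ?thesis unfolding green_def J
    by (rule kink_green[OF y green_pieces _ _ _ v]) (simp_all add: add.commute mult.commute)
qed

lemma H10_nonzero_inside: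
  assumes L: "L > 0" and u: "u \<in> H10 L" "u \<noteq> (\<lambda>x. 0)"
  obtains y where "-L < y" "y < L" "u y \<noteq> 0"
proof (rule ccontr)
  assume "\<not> thesis"
  with that have "\<forall>y. -L < y \<and> y < L \<longrightarrow> u y = 0" by blast
  then have z: "u x = 0" if "x \<in> {-L<..<L}" for x using that by auto
  have c: "closure {-L<..<L} = {-L..L}" using L by (simp add: closure_greaterThanLessThan)
  have "u x = 0" for x
  proof (cases "x \<in> {-L..L}")
    case True
    have "continuous_on (closure {-L<..<L}) u" using u c by (simp add: H10_def)
    then show ?thesis by (rule continuous_constant_on_closure) (use z c True in auto)
  next
    case False then show ?thesis using u by (auto simp: H10_def)
  qed
  then show False using u(2) by auto
qed

lemma A_beta_apply:
  assumes "v \<in> H10 L"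
  shows "A_beta x0 L \<beta> u v = integ L (\<lambda>x. wderiv L u x * wderiv L v x) + of_real \<beta> * u x0 * v 0"
  using assms by (simp add: A_beta_def A_def dirac0_def)

text \<open>Green's identity tested with an eigenfunction \<open>u\<close> gives \<open>sin_sol k (2 * L) * u y = - \<beta> * u x0 * green L k y 0\<close>
  for all \<open>y\<close>. If the factor on the left vanishes, \<open>k\<close> is real and \<open>\<mu>\<close> is a positive Dirichlet
  eigenvalue. Otherwise \<open>u x0\<close> is nonzero, and \<open>y = x0\<close> yields the equation.\<close>
lemma eigenvalue_imp_characteristic:
  assumes x0: "0 < x0" "x0 < L" and \<beta>: "\<beta> \<ge> 0" and \<mu>: "\<mu> \<in> eigenvalues x0 L \<beta>"
  shows "(\<mu> \<in> \<real> \<and> Re \<mu> > 0) \<or>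
    (\<exists>k::complex. \<mu> = k\<^sup>2 \<and> k \<noteq> 0 \<and> 2 * k * cos (k * L) + \<beta> * sin (k * (L - x0)) = 0)"
proof -
  have L: "L > 0" using x0 by simp
  define k where "k = csqrt \<mu>"
  have k: "\<mu> = k\<^sup>2" by (simp add: k_def)
  obtain u where u: "u \<in> H10 L" "u \<noteq> (\<lambda>x. 0)" and ev: "A_beta x0 L \<beta> u = (\<lambda>v\<in>H10 L. \<mu> * emb L u v)"
    using \<mu> by (auto simp: eigenvalues_def)
  have id: "sin_sol k (2 * L) * u y + of_real \<beta> * u x0 * green L k y 0 = 0" if y: "-L < y" "y < L" for y
  proof -
    note g = green_H10[OF y, of k]
    have "A_beta x0 L \<beta> u (green L k y) = \<mu> * emb L u (green L k y)" using ev g by simp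
    then have "integ L (\<lambda>x. wderiv L (green L k y) x * wderiv L u x) + of_real \<beta> * u x0 * green L k y 0
       = \<mu> * integ L (\<lambda>x. green L k y x * u x)"
      using g by (simp add: A_beta_apply emb_def mult.commute)
    then show ?thesis unfolding green_identity[OF y u(1)] k by (simp add: algebra_simps)
  qed
  show ?thesis
  proof (cases "sin_sol k (2 * L) = 0")
    case True
    then have k0: "k \<noteq> 0" and "sin (k * of_real (2 * L)) = 0" using L by (auto simp: sin_sol_def split: if_splits)
    then obtain n :: int where "k * of_real (2 * L) = of_real (of_int n * pi)" by (auto simp: sin_eq_0)
    then have "k = of_real (of_int n * pi / (2 * L))" using L by (simp add: field_simps)
    then obtain r :: real where r: "k = of_real r" by blast
    then have "\<mu> = of_real (r\<^sup>2)" "r \<noteq> 0" using k k0 by auto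
    then show ?thesis by auto
  next
    case False
    obtain y where y: "-L < y" "y < L" "u y \<noteq> 0" using H10_nonzero_inside[OF L u] .
    have ux: "u x0 \<noteq> 0" using id[OF y(1,2)] False y(3) by auto
    have "green L k x0 0 = sin_sol k L * sin_sol k (L - x0)" using x0 by (simp add: green_def kink_def)
    then have "u x0 * (sin_sol k (2 * L) + of_real \<beta> * (sin_sol k L * sin_sol k (L - x0))) = 0"
    proof -
      have "sin_sol k (2 * L) * u x0 + of_real \<beta> * u x0 * (sin_sol k L * sin_sol k (L - x0)) = 0"
        using id[of x0] x0 \<open>green L k x0 0 = _\<close> by simp
      then show ?thesis by algebra
    qed
    moreover have s2: "sin_sol k (2 * L) = 2 * sin_sol k L * cos_sol k L" by (rule sin_sol_double)
    ultimately have "sin_sol k L * (2 * cos_sol k L + of_real \<beta> * sin_sol k (L - x0)) = 0"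
      using ux by algebra
    then have e: "2 * cos_sol k L + of_real \<beta> * sin_sol k (L - x0) = 0" using False s2 by auto
    have "k \<noteq> 0"
    proof
      assume "k = 0"
      then have "of_real (2 + \<beta> * (L - x0)) = (0::complex)" using e by (simp add: sin_sol_def cos_sol_def)
      then have "2 + \<beta> * (L - x0) = 0" by (simp only: of_real_eq_0_iff)
      moreover have "\<beta> * (L - x0) \<ge> 0" using \<beta> x0 by simp
      ultimately show False by linarith
    qed
    moreover have "2 * k * cos (k * L) + \<beta> * sin (k * (L - x0)) = k * (2 * cos_sol k L + of_real \<beta> * sin_sol k (L - x0))"
      using \<open>k \<noteq> 0\<close> by (simp add: sin_sol_def cos_sol_def algebra_simps)
    ultimately show ?thesis using e k by auto
  qed
qed

text \<open>The eigenfunction is \<open>green L k 0\<close>, which is nonzero at \<open>0\<close> because \<open>sin (k L)\<close> has only real zeros.\<close>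
lemma characteristic_imp_eigenvalue:
  assumes x0: "0 < x0" "x0 < L" and k: "Im k \<noteq> 0"
    and e: "2 * k * cos (k * L) + \<beta> * sin (k * (L - x0)) = 0"
  shows "k\<^sup>2 \<in> eigenvalues x0 L \<beta>"
proof -
  have L: "L > 0" "-L < 0" using x0 by auto
  have k0: "k \<noteq> 0" using k by auto
  note g = green_H10[OF L(2,1), of k]
  have "sin_sol k L \<noteq> 0"
  proof
    assume "sin_sol k L = 0"
    then have "sin (k * of_real L) = 0" using k0 by (simp add: sin_sol_def)
    then obtain n :: int where "k * of_real L = of_real (of_int n * pi)" by (auto simp: sin_eq_0)
    then have "k = of_real (of_int n * pi / L)" using L by (simp add: field_simps)
    then show False using k by simp
  qed
  moreover have "green L k 0 0 = sin_sol k L * sin_sol k L" using L by (simp add: green_def kink_def)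
  ultimately have nz: "green L k 0 \<noteq> (\<lambda>x. 0)" by (auto dest: fun_cong[where x = 0])
  have gx: "green L k 0 x0 = sin_sol k (L - x0) * sin_sol k L" using x0 by (simp add: green_def kink_def)
  have e': "2 * cos_sol k L + of_real \<beta> * sin_sol k (L - x0) = 0"
    using e k0 by (simp add: sin_sol_def cos_sol_def field_simps)
  have s2: "sin_sol k (2 * L) = 2 * sin_sol k L * cos_sol k L" by (rule sin_sol_double)
  have "sin_sol k (2 * L) + of_real \<beta> * green L k 0 x0 = sin_sol k L * (2 * cos_sol k L + of_real \<beta> * sin_sol k (L - x0))"
    unfolding s2 gx by algebra
  then have z: "sin_sol k (2 * L) + of_real \<beta> * green L k 0 x0 = 0" using e' by simp
  have "A_beta x0 L \<beta> (green L k 0) = (\<lambda>v\<in>H10 L. k\<^sup>2 * emb L (green L k 0) v)"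
  proof
    fix v
    show "A_beta x0 L \<beta> (green L k 0) v = (\<lambda>v\<in>H10 L. k\<^sup>2 * emb L (green L k 0) v) v"
    proof (cases "v \<in> H10 L")
      case True
      have "A_beta x0 L \<beta> (green L k 0) v = k\<^sup>2 * emb L (green L k 0) v + (sin_sol k (2 * L) + of_real \<beta> * green L k 0 x0) * v 0"
        unfolding A_beta_apply[OF True] green_identity[OF L(2,1) True]
        using True by (simp add: emb_def) algebra
      then show ?thesis using z True by simp
    next
      case False then show ?thesis by (simp add: A_beta_def)
    qed
  qed
  then show ?thesis using g nz by (auto simp: eigenvalues_def)
qed

section \<open>A priori bounds for nonreal roots\<close>

text \<open>For \<open>a = L - x\<^sub>0\<close> this is the value of \<open>\<beta>\<close> for which \<open>k\<close> is a root of the characteristic equation.\<close>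
definition char_quot :: "real \<Rightarrow> real \<Rightarrow> complex \<Rightarrow> complex" where
  "char_quot L a k = - 2 * k * cos (k * of_real L) / sin (k * of_real a)"

lemma Re_cos_cosh: "Re (cos z) = cos (Re z) * cosh (Im z)"
  and Im_cos_sinh: "Im (cos z) = - sin (Re z) * sinh (Im z)"
  and Re_sin_cosh: "Re (sin z) = sin (Re z) * cosh (Im z)"
  and Im_sin_sinh: "Im (sin z) = cos (Re z) * sinh (Im z)"
  by (simp_all add: Re_cos Im_cos Re_sin Im_sin cosh_field_def sinh_field_def field_simps)

lemma sin_mult_real_nonzero:
  assumes "a > 0" "Im k \<noteq> 0" shows "sin (k * of_real a) \<noteq> 0"
proof
  assume "sin (k * of_real a) = 0"
  then obtain n :: int where "k * of_real a = of_real (of_int n * pi)" by (auto simp: sin_eq_0)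
  then have "Im (k * of_real a) = 0" by simp
  then show False using assms by simp
qed

lemma char_quot_eq_iff:
  assumes "sin (k * of_real a) \<noteq> 0"
  shows "char_quot L a k = \<beta> \<longleftrightarrow> 2 * k * cos (k * of_real L) + \<beta> * sin (k * of_real a) = 0"
proof -
  have "char_quot L a k = \<beta> \<longleftrightarrow> - 2 * k * cos (k * of_real L) = \<beta> * sin (k * of_real a)"
    unfolding char_quot_def by (rule nonzero_divide_eq_eq[OF assms])
  also have "\<dots> \<longleftrightarrow> 2 * k * cos (k * of_real L) + \<beta> * sin (k * of_real a) = 0"
    by (auto simp: algebra_simps eq_neg_iff_add_eq_0 neg_eq_iff_add_eq_0)
  finally show ?thesis .
qed

lemma root_real_imag:
  assumes a: "a > 0" and q: "Im k \<noteq> 0" and h: "char_quot L a k = of_real \<beta>"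
  shows "2 * (cos (Re k * L) * cosh (Im k * L)) + \<beta> * Re (sin_sol k a) = 0"
    and "- 2 * (sin (Re k * L) * sinh (Im k * L)) + \<beta> * Im (sin_sol k a) = 0"
proof -
  have k0: "k \<noteq> 0" using q by auto
  have "2 * k * cos (k * of_real L) + of_real \<beta> * sin (k * of_real a) = 0"
    using h char_quot_eq_iff[OF sin_mult_real_nonzero[OF a q]] by blast
  then have e: "2 * cos (k * of_real L) + of_real \<beta> * sin_sol k a = 0" using k0 by (simp add: sin_sol_def field_simps)
  have "Re (2 * cos (k * of_real L) + of_real \<beta> * sin_sol k a) = 0" "Im (2 * cos (k * of_real L) + of_real \<beta> * sin_sol k a) = 0"
    unfolding e by simp_all
  then show "2 * (cos (Re k * L) * cosh (Im k * L)) + \<beta> * Re (sin_sol k a) = 0"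
    "- 2 * (sin (Re k * L) * sinh (Im k * L)) + \<beta> * Im (sin_sol k a) = 0"
    by (simp_all add: Re_cos_cosh Im_cos_sinh)
qed


lemma Re_sin_sol_mean_value:
  assumes a: "a > 0"
  obtains s where "0 < s" "s < a" "Re (sin_sol k a) = a * (cos (Re k * s) * cosh (Im k * s))"
proof -
  have "((\<lambda>x. Re (sin_sol k x)) has_real_derivative Re (cos_sol k x)) (at x)" for x
    using bounded_linear.has_vector_derivative[OF bounded_linear_Re sin_sol_deriv]
    by (simp add: has_real_derivative_iff_has_vector_derivative)
  from MVT2[OF a this] obtain z where "0 < z" "z < a" "Re (sin_sol k a) - Re (sin_sol k 0) = (a - 0) * Re (cos_sol k z)" by blast
  then show ?thesis by (intro that[of z]) (auto simp: cos_sol_def Re_cos_cosh)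
qed

lemma Im_sin_sol_mean_value:
  assumes a: "a > 0"
  obtains s where "0 < s" "s < a" "Im (sin_sol k a) = - a * (sin (Re k * s) * sinh (Im k * s))"
proof -
  have "((\<lambda>x. Im (sin_sol k x)) has_real_derivative Im (cos_sol k x)) (at x)" for x
    using bounded_linear.has_vector_derivative[OF bounded_linear_Im sin_sol_deriv]
    by (simp add: has_real_derivative_iff_has_vector_derivative)
  from MVT2[OF a this] obtain z where "0 < z" "z < a" "Im (sin_sol k a) - Im (sin_sol k 0) = (a - 0) * Im (cos_sol k z)" by blast
  then show ?thesis by (intro that[of z]) (auto simp: cos_sol_def Im_cos_sinh)
qed

text \<open>If \<open>Re k * L < \<pi> / 2\<close>, then the cosines in the real part of the equation are positive, also at the
  intermediate point of the mean value theorem, and its left side cannot vanish.\<close>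
lemma root_Re_lower_bound:
  assumes a: "0 < a" "a < L" and k: "Re k > 0" "Im k \<noteq> 0" and \<beta>: "\<beta> \<ge> 0" and h: "char_quot L a k = of_real \<beta>"
  shows "Re k * L \<ge> pi / 2"
proof (rule ccontr)
  assume "\<not> ?thesis"
  then have lt: "Re k * L < pi / 2" by simp
  obtain s where s: "0 < s" "s < a" "Re (sin_sol k a) = a * (cos (Re k * s) * cosh (Im k * s))"
    using Re_sin_sol_mean_value[OF a(1)] by blast
  have "Re k * s < Re k * L" using s a k by (intro mult_strict_left_mono) auto
  moreover have "0 < Re k * s" using s k by simp
  ultimately have "cos (Re k * s) > 0" using lt by (intro cos_gt_zero_pi) linarith+
  then have "Re (sin_sol k a) \<ge> 0" using s a by simp
  moreover have "0 < Re k * L" using a k by simp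
  then have "cos (Re k * L) > 0" using lt by (intro cos_gt_zero_pi) linarith+
  then have "cos (Re k * L) * cosh (Im k * L) > 0" by (simp add: cosh_real_pos)
  moreover note root_real_imag(1)[OF a(1) k(2) h]
  ultimately show False using \<beta> by (smt (verit) mult_nonneg_nonneg)
qed

lemma abs_sin_add_abs_cos: "1 \<le> \<bar>sin x\<bar> + \<bar>cos (x::real)\<bar>"
proof -
  have "1 = (sin x)\<^sup>2 + (cos x)\<^sup>2" by simp
  also have "\<dots> \<le> \<bar>sin x\<bar> + \<bar>cos x\<bar>"
  proof (rule add_mono)
    have "y\<^sup>2 \<le> \<bar>y\<bar>" if "\<bar>y\<bar> \<le> 1" for y :: real
    proof -
      have "\<bar>y\<bar> * \<bar>y\<bar> \<le> \<bar>y\<bar> * 1" using that by (intro mult_left_mono) auto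
      then show ?thesis by (simp add: power2_eq_square)
    qed
    then show "(sin x)\<^sup>2 \<le> \<bar>sin x\<bar>" "(cos x)\<^sup>2 \<le> \<bar>cos x\<bar>" by simp_all
  qed
  finally show ?thesis .
qed

lemma root_abs_equations:
  assumes a: "0 < a" "a < L" and q: "Im k > 0" and \<beta>: "\<beta> \<ge> 0" and h: "char_quot L a k = of_real \<beta>"
  shows "2 * \<bar>cos (Re k * L)\<bar> * cosh (Im k * L) = \<beta> * \<bar>Re (sin_sol k a)\<bar>"
    and "2 * \<bar>sin (Re k * L)\<bar> * sinh (Im k * L) = \<beta> * \<bar>Im (sin_sol k a)\<bar>"
proof -
  note e = root_real_imag[OF a(1) less_imp_neq[OF q, symmetric] h]
  have pos: "cosh (Im k * L) > 0" "sinh (Im k * L) > 0" using q a by (auto simp: cosh_real_pos)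
  have "2 * \<bar>cos (Re k * L)\<bar> * cosh (Im k * L) = \<bar>2 * (cos (Re k * L) * cosh (Im k * L))\<bar>"
    using pos by (simp add: abs_mult)
  also have "\<dots> = \<bar>\<beta> * Re (sin_sol k a)\<bar>" using e(1) by linarith
  finally show "2 * \<bar>cos (Re k * L)\<bar> * cosh (Im k * L) = \<beta> * \<bar>Re (sin_sol k a)\<bar>" using \<beta> by (simp add: abs_mult)
  have "2 * \<bar>sin (Re k * L)\<bar> * sinh (Im k * L) = \<bar>2 * (sin (Re k * L) * sinh (Im k * L))\<bar>"
    using pos by (simp add: abs_mult)
  also have "\<dots> = \<bar>\<beta> * Im (sin_sol k a)\<bar>" using e(2) by linarith
  finally show "2 * \<bar>sin (Re k * L)\<bar> * sinh (Im k * L) = \<beta> * \<bar>Im (sin_sol k a)\<bar>" using \<beta> by (simp add: abs_mult)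
qed

text \<open>By the mean value theorem the real and imaginary parts of the equation bound
  \<open>\<bar>cos (Re k * L)\<bar>\<close> and \<open>\<bar>sin (Re k * L)\<bar>\<close> by \<open>\<beta> * a / 2\<close>; these two numbers have sum at least \<open>1\<close>.
  Thus all eigenvalues are real for small \<open>\<beta>\<close>.\<close>
lemma root_beta_lower_bound:
  assumes a: "0 < a" "a < L" and q: "Im k > 0" and \<beta>: "\<beta> \<ge> 0" and h: "char_quot L a k = of_real \<beta>"
  shows "\<beta> * a \<ge> 1"
proof -
  note e = root_abs_equations[OF a q \<beta> h]
  obtain s where s: "0 < s" "s < a" "Re (sin_sol k a) = a * (cos (Re k * s) * cosh (Im k * s))"
    using Re_sin_sol_mean_value[OF a(1)] by blast
  obtain r where r: "0 < r" "r < a" "Im (sin_sol k a) = - a * (sin (Re k * r) * sinh (Im k * r))"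
    using Im_sin_sol_mean_value[OF a(1)] by blast
  have C: "cosh (Im k * s) \<le> cosh (Im k * L)" using s a q by (subst cosh_real_nonneg_le_iff) auto
  have S: "sinh (Im k * r) \<le> sinh (Im k * L)" "0 \<le> sinh (Im k * r)" using r a q by auto
  have pos: "cosh (Im k * L) > 0" "sinh (Im k * L) > 0" using q a by (auto simp: cosh_real_pos)
  have "2 * \<bar>cos (Re k * L)\<bar> * cosh (Im k * L) = \<beta> * \<bar>Re (sin_sol k a)\<bar>"
    using e(1) .
  also have "\<dots> = (\<beta> * a) * (\<bar>cos (Re k * s)\<bar> * cosh (Im k * s))"
    using s a \<beta> by (simp add: abs_mult)
  also have "\<dots> \<le> (\<beta> * a) * (1 * cosh (Im k * L))"
    using C a \<beta> by (intro mult_left_mono mult_mono) auto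
  finally have c: "2 * \<bar>cos (Re k * L)\<bar> \<le> \<beta> * a" using pos by simp
  have "2 * \<bar>sin (Re k * L)\<bar> * sinh (Im k * L) = \<beta> * \<bar>Im (sin_sol k a)\<bar>"
    using e(2) .
  also have "\<dots> = (\<beta> * a) * (\<bar>sin (Re k * r)\<bar> * sinh (Im k * r))"
    using r a \<beta> S by (simp add: abs_mult)
  also have "\<dots> \<le> (\<beta> * a) * (1 * sinh (Im k * L))"
    using S a \<beta> by (intro mult_left_mono mult_mono) auto
  finally have d: "2 * \<bar>sin (Re k * L)\<bar> \<le> \<beta> * a" using pos by simp
  show ?thesis using c d abs_sin_add_abs_cos[of "Re k * L"] by linarith
qed

lemma sinh_ge_self:
  assumes "0 \<le> x" shows "x \<le> sinh (x::real)"
proof -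
  have "sinh 0 - 0 \<le> sinh x - x"
  proof (rule DERIV_nonneg_imp_nondecreasing[OF assms])
    fix y :: real
    show "\<exists>d. ((\<lambda>y. sinh y - y) has_real_derivative d) (at y) \<and> 0 \<le> d"
      by (rule exI[of _ "cosh y - 1"]) (auto intro!: derivative_eq_intros simp: cosh_real_ge_1)
  qed
  then show ?thesis by simp
qed

text \<open>The same argument with \<open>\<bar>sin (k a) / k\<bar>\<close> bounded through \<open>\<bar>k\<bar>\<close> instead of \<open>a\<close>: both
  \<open>\<bar>cos (Re k * L)\<bar>\<close> and \<open>\<bar>sin (Re k * L)\<bar>\<close> are of order \<open>\<beta> / \<bar>k\<bar>\<close>.\<close>
lemma root_norm_bound:
  assumes a: "0 < a" "a < L" and q: "Im k > 0" and p: "Re k > 0" and \<beta>: "\<beta> \<ge> 0" and h: "char_quot L a k = of_real \<beta>"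
  shows "cmod k \<le> 1 + \<beta> * (4 + 1 / L)"
proof (cases "cmod k \<le> 1")
  case True
  then show ?thesis using a \<beta> by (simp add: add_increasing2)
next
  case False
  then have n: "cmod k > 1" by simp
  have k0: "k \<noteq> 0" using q by auto
  define n where "n = cmod k"
  have n1: "n > 1" using n by (simp add: n_def)
  have nn: "n\<^sup>2 = (Re k)\<^sup>2 + (Im k)\<^sup>2" by (simp add: n_def cmod_power2)
  have pn: "Re k \<le> n" "Im k \<le> n" by (auto simp: n_def abs_Re_le_cmod abs_Im_le_cmod intro: order_trans[OF abs_ge_self])
  note e = root_abs_equations[OF a q \<beta> h]
  define S where "S = sinh (Im k * L)"
  define C where "C = cosh (Im k * L)"
  have pos: "C > 0" "S > 0" using q a by (auto simp: C_def S_def cosh_real_pos)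
  have Ca: "cosh (Im k * a) \<le> C" unfolding C_def using a q by (subst cosh_real_nonneg_le_iff) auto
  have Sa: "0 \<le> sinh (Im k * a)" "sinh (Im k * a) \<le> S" unfolding S_def using a q by auto
  have SC: "sinh (Im k * a) \<le> cosh (Im k * a)" by (simp add: sinh_le_cosh_real)
  have CS: "cosh (Im k * a) \<le> 1 + S"
  proof -
    have "cosh (Im k * a) - sinh (Im k * a) = exp (- (Im k * a))" by (simp add: cosh_minus_sinh)
    also have "\<dots> \<le> 1" using q a by simp
    finally show ?thesis using Sa by linarith
  qed
  have qS: "Im k \<le> S / L"
  proof -
    have "Im k * L \<le> S" unfolding S_def using q a by (intro sinh_ge_self) auto
    then show ?thesis using a by (simp add: field_simps)
  qed
  have sin_sol: "sin_sol k a = sin (k * of_real a) / k" using k0 by (simp add: sin_sol_def)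
  let ?A = "sin (Re k * a) * cosh (Im k * a)" and ?B = "cos (Re k * a) * sinh (Im k * a)"
  have A: "\<bar>?A\<bar> \<le> cosh (Im k * a)" by (simp add: abs_mult mult_left_le_one_le)
  have B: "\<bar>?B\<bar> \<le> sinh (Im k * a)" using Sa by (simp add: abs_mult mult_left_le_one_le)
  have R: "Re (sin_sol k a) = (?A * Re k + ?B * Im k) / n\<^sup>2"
    unfolding sin_sol nn by (simp add: Re_divide Re_sin_cosh Im_sin_sinh)
  have I: "Im (sin_sol k a) = (?B * Re k - ?A * Im k) / n\<^sup>2"
    unfolding sin_sol nn by (simp add: Im_divide Re_sin_cosh Im_sin_sinh)
  have R': "\<bar>Re (sin_sol k a)\<bar> \<le> C * 2 / n"
  proof -
    have "\<bar>?A * Re k + ?B * Im k\<bar> \<le> \<bar>?A\<bar> * Re k + \<bar>?B\<bar> * Im k"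
      using p q by (intro order_trans[OF abs_triangle_ineq]) (simp add: abs_mult)
    also have "\<dots> \<le> C * n + C * n" using A B Ca Sa SC pn p q pos by (intro add_mono mult_mono) auto
    finally have "\<bar>?A * Re k + ?B * Im k\<bar> / n\<^sup>2 \<le> (C * n + C * n) / n\<^sup>2" by (intro divide_right_mono) auto
    also have "\<dots> = C * 2 / n" using n1 by (simp add: field_simps power2_eq_square)
    finally show ?thesis unfolding R using n1 by simp
  qed
  have I': "\<bar>Im (sin_sol k a)\<bar> \<le> S * (2 + 1 / L) / n"
  proof -
    have "\<bar>?B * Re k - ?A * Im k\<bar> \<le> \<bar>?B\<bar> * Re k + \<bar>?A\<bar> * Im k"
      using p q by (intro order_trans[OF abs_triangle_ineq4]) (simp add: abs_mult)
    also have "\<dots> \<le> S * n + (1 + S) * Im k" using A B CS Sa pn p q pos by (intro add_mono mult_mono) auto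
    also have "\<dots> \<le> S * n + S / L + S * n"
    proof -
      have "S * Im k \<le> S * n" using pos by (intro mult_left_mono pn) auto
      then show ?thesis using qS unfolding distrib_right by linarith
    qed
    also have "\<dots> \<le> S * n + S / L * n + S * n"
      using n1 pos a mult_left_mono[of 1 n "S / L"] by simp
    finally have "\<bar>?B * Re k - ?A * Im k\<bar> / n\<^sup>2 \<le> (S * n + S / L * n + S * n) / n\<^sup>2" by (intro divide_right_mono) auto
    also have "\<dots> = S * (2 + 1 / L) / n" using n1 a by (simp add: field_simps power2_eq_square)
    finally show ?thesis unfolding I using n1 by simp
  qed
  have "2 * \<bar>cos (Re k * L)\<bar> * C = \<beta> * \<bar>Re (sin_sol k a)\<bar>"
    using e(1) unfolding C_def .
  also have "\<dots> \<le> \<beta> * (C * 2 / n)" by (rule mult_left_mono[OF R' \<beta>])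
  finally have "2 * \<bar>cos (Re k * L)\<bar> * C \<le> (\<beta> * 2 / n) * C" by (simp add: mult_ac)
  then have c: "2 * \<bar>cos (Re k * L)\<bar> \<le> \<beta> * 2 / n" using pos by (simp only: mult_le_cancel_right_pos)
  have "2 * \<bar>sin (Re k * L)\<bar> * S = \<beta> * \<bar>Im (sin_sol k a)\<bar>"
    using e(2) unfolding S_def .
  also have "\<dots> \<le> \<beta> * (S * (2 + 1 / L) / n)" by (rule mult_left_mono[OF I' \<beta>])
  finally have "2 * \<bar>sin (Re k * L)\<bar> * S \<le> (\<beta> * (2 + 1 / L) / n) * S" by (simp add: mult.commute mult.left_commute)
  then have d: "2 * \<bar>sin (Re k * L)\<bar> \<le> \<beta> * (2 + 1 / L) / n" using pos by (simp only: mult_le_cancel_right_pos)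
  have "2 \<le> \<beta> * 2 / n + \<beta> * (2 + 1 / L) / n"
    using c d abs_sin_add_abs_cos[of "Re k * L"] by linarith
  also have "\<dots> = \<beta> * (4 + 1 / L) / n" by (simp add: add_divide_distrib[symmetric] distrib_left)
  finally have "2 * n \<le> \<beta> * (4 + 1 / L)" using n1 by (simp add: field_simps)
  then show ?thesis using n1 by (simp add: n_def)
qed

section \<open>Roots on the diagonal\<close>

text \<open>Up to positive factors, \<open>cross_im\<close> and \<open>cross_re\<close> are the imaginary and real parts of
  \<open>char_quot\<close> on the diagonal \<open>Re k = Im k\<close>.\<close>
definition cross_im :: "real \<Rightarrow> real \<Rightarrow> real" where
  "cross_im \<sigma> t = sinh \<sigma> * cos t + cosh \<sigma> * sin t - sinh t * cos \<sigma> - cosh t * sin \<sigma>"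

definition cross_re :: "real \<Rightarrow> real \<Rightarrow> real" where
  "cross_re \<sigma> t = cosh \<sigma> * sin t - sinh \<sigma> * cos t + sinh t * cos \<sigma> - cosh t * sin \<sigma>"

text \<open>The product-to-sum formula for \<open>cos (k L)\<close> times the conjugate of \<open>sin (k a)\<close> separates the sum
  \<open>\<sigma> = s (L + a)\<close> from the difference \<open>t = s (L - a) = s x\<^sub>0\<close>. Values of \<open>h\<close> on the diagonal are
  real exactly where \<open>cross_im\<close> vanishes, and then have the sign of \<open>cross_re\<close>.\<close>
lemma char_quot_diagonal:
  assumes a: "a > 0" and s: "s > 0"
  shows "char_quot L a (Complex s s) * (of_real (cmod (sin (Complex s s * of_real a))))\<^sup>2
    = Complex (s * cross_re (s * (L + a)) (s * (L - a))) (s * cross_im (s * (L + a)) (s * (L - a)))"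
proof -
  let ?k = "Complex s s"
  have nz: "sin (?k * of_real a) \<noteq> 0" using a s by (intro sin_mult_real_nonzero) auto
  have "(of_real (cmod (sin (?k * of_real a))))\<^sup>2 = sin (?k * of_real a) * cnj (sin (?k * of_real a))"
    using complex_norm_square[of "sin (?k * of_real a)"] by simp
  then have "char_quot L a ?k * (of_real (cmod (sin (?k * of_real a))))\<^sup>2 = - 2 * ?k * (cos (?k * of_real L) * cnj (sin (?k * of_real a)))"
    using nz by (simp add: char_quot_def)
  also have "\<dots> = Complex (s * cross_re (s * (L + a)) (s * (L - a))) (s * cross_im (s * (L + a)) (s * (L - a)))"
    unfolding cross_re_def cross_im_def distrib_left right_diff_distrib
    by (simp add: complex_eq_iff Re_cos_cosh Im_cos_sinh Re_sin_cosh Im_sin_sinh cosh_add sinh_add cosh_diff sinh_diff sin_add cos_add sin_diff cos_diff)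
       (auto simp: algebra_simps)
  finally show ?thesis .
qed

text \<open>The function vanishes at \<open>\<sigma> = t\<close> and increases in \<open>\<sigma>\<close>. For \<open>\<sigma> \<le> \<pi>\<close> the derivative is positive
  term by term; for \<open>\<sigma> > \<pi>\<close> the growth of \<open>sinh \<sigma>\<close> dominates \<open>exp t \<le> exp 1\<close>.\<close>
lemma cross_im_pos:
  assumes t: "0 < t" "t \<le> 1" and \<sigma>: "t < \<sigma>"
  shows "cross_im \<sigma> t > 0"
proof -
  have t2: "t < pi / 2" using t pi_gt3 by linarith
  have ct: "cos t > 0" using t t2 by (intro cos_gt_zero_pi) auto
  have st: "sin t > 0" using t t2 by (intro sin_gt_zero) auto
  have sht: "sinh t > 0" using t by simp
  have "cross_im t t < cross_im \<sigma> t"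
  proof (rule DERIV_pos_imp_increasing[OF \<sigma>])
    fix x assume x: "t \<le> x" "x \<le> \<sigma>"
    define D where "D = cosh x * cos t + sinh x * sin t + sinh t * sin x - cosh t * cos x"
    have "((\<lambda>x. cross_im x t) has_real_derivative D) (at x)"
      unfolding cross_im_def D_def by (auto intro!: derivative_eq_intros simp: algebra_simps)
    moreover have "D > 0"
    proof (cases "x \<le> pi")
      case True
      have "cos x \<le> cos t" using x True t by (subst cos_mono_le_eq) auto
      then have "cosh t * cos x \<le> cosh t * cos t" by (intro mult_left_mono) (auto simp: less_imp_le cosh_real_pos)
      also have "\<dots> \<le> cosh x * cos t" using x t ct by (intro mult_right_mono) (auto simp: cosh_real_nonneg_le_iff)
      finally have "cosh t * cos x \<le> cosh x * cos t" .
      moreover have "sinh x * sin t > 0" using x t st by auto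
      moreover have "sinh t * sin x \<ge> 0" using sht x t True by (intro mult_nonneg_nonneg sin_ge_zero) auto
      ultimately show ?thesis by (simp add: D_def)
    next
      case False
      have "1 \<le> sin t + cos t" using abs_sin_add_abs_cos[of t] st ct by simp
      then have "sinh x * 1 \<le> sinh x * (sin t + cos t)" using x t by (intro mult_left_mono) auto
      also have "\<dots> \<le> sinh x * sin t + cosh x * cos t"
        using mult_right_mono[OF sinh_le_cosh_real[of x], of "cos t"] ct by (simp add: distrib_left)
      finally have 1: "sinh x \<le> sinh x * sin t + cosh x * cos t" by simp
      have "- (sinh t * 1) \<le> sinh t * sin x"
        using mult_left_mono[OF sin_ge_minus_one[of x], of "sinh t"] sht by simp
      moreover have "cosh t * cos x \<le> cosh t"
        using mult_left_mono[OF cos_le_one[of x], of "cosh t"] by (simp add: less_imp_le cosh_real_pos)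
      ultimately have 2: "sinh t * sin x - cosh t * cos x \<ge> - exp t"
        using sinh_plus_cosh[of t] by linarith
      have "exp t \<le> exp 1" using t by simp
      moreover have "exp 1 < sinh x"
      proof -
        have e1: "exp (1::real) \<ge> 2" using exp_ge_add_one_self[of "1::real"] by simp
        have "exp (3::real) = exp 1 * (exp 1 * exp 1)" by (simp add: exp_add[symmetric])
        moreover have "exp 1 * (2 * 2) \<le> exp 1 * (exp 1 * exp (1::real))" using e1 by (intro mult_left_mono mult_mono) auto
        moreover have "exp 3 \<le> exp x" using False pi_gt3 by simp
        ultimately have "4 * exp 1 \<le> exp x" by linarith
        moreover have "exp (-x) \<le> 1" using False pi_gt3 by simp
        moreover have "sinh x = (exp x - exp (-x)) / 2" by (simp add: sinh_field_def)
        ultimately show ?thesis using e1 by argo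
      qed
      ultimately show ?thesis using 1 2 unfolding D_def by argo
    qed
    ultimately show "\<exists>y. ((\<lambda>x. cross_im x t) has_real_derivative y) (at x) \<and> y > 0" by blast
  qed
  then show ?thesis by (simp add: cross_im_def)
qed

lemma exp_multiple_le:
  fixes t \<sigma> :: real
  assumes t: "t \<ge> 1" and \<sigma>: "\<sigma> \<ge> 7 * t"
  shows "7 * exp t \<le> exp \<sigma>"
proof -
  have "7 * exp t \<le> exp (6 * t) * exp t"
  proof (rule mult_right_mono)
    show "7 \<le> exp (6 * t)" using exp_ge_add_one_self[of "6 * t"] t by linarith
  qed simp
  also have "\<dots> = exp (7 * t)" by (simp add: exp_add[symmetric])
  also have "\<dots> \<le> exp \<sigma>" using \<sigma> by simp
  finally show ?thesis .
qed

text \<open>For large \<open>\<sigma>\<close> the sign is that of \<open>sin t + cos t\<close>, which is negative at \<open>5 \<pi> / 6\<close>. The choice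
  of this point keeps \<open>sin t \<ge> 1 / 2\<close> for \<open>1 \<le> t \<le> 5 \<pi> / 6\<close>, which fixes the sign of \<open>cross_re\<close> there.\<close>
lemma cross_im_neg:
  assumes t: "t = 5 * pi / 6" and \<sigma>: "\<sigma> \<ge> 7 * t"
  shows "cross_im \<sigma> t < 0"
proof -
  have tt: "t = pi - pi / 6" unfolding t by simp
  have st: "sin t = 1 / 2" unfolding tt sin_pi_minus by (rule sin_30)
  have ct: "cos t = - sqrt 3 / 2" unfolding tt cos_pi_minus cos_30 by simp
  have t1: "t \<ge> 5/2" using pi_gt3 unfolding t by simp
  have e: "exp t \<ge> 7/2" using exp_ge_add_one_self[of t] t1 by linarith
  have em: "exp (-\<sigma>) \<le> 1" "exp (-\<sigma>) > 0" using \<sigma> t1 by auto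
  have big: "16 * exp t \<le> exp \<sigma>"
  proof -
    have "16 * exp t \<le> exp (6 * t) * exp t"
    proof (rule mult_right_mono)
      show "16 \<le> exp (6 * t)" using exp_ge_add_one_self[of "6 * t"] t1 by linarith
    qed simp
    also have "\<dots> = exp (7 * t)" by (simp add: exp_add[symmetric])
    also have "\<dots> \<le> exp \<sigma>" using \<sigma> by simp
    finally show ?thesis .
  qed
  have s3: "sqrt 3 \<ge> 17/10" by (rule real_le_rsqrt) (simp add: power2_eq_square)
  have sh: "sinh \<sigma> \<ge> 0" using \<sigma> t1 by simp
  have "sinh \<sigma> * (- sqrt 3 / 2) \<le> - (17/20) * sinh \<sigma>" using mult_right_mono[OF s3 sh] by (simp add: mult.commute)
  moreover have "- sinh t * cos \<sigma> \<le> sinh t"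
    using mult_left_mono[OF cos_ge_minus_one[of \<sigma>], of "sinh t"] t1 by simp
  moreover have "- cosh t * sin \<sigma> \<le> cosh t"
    using mult_left_mono[OF sin_ge_minus_one[of \<sigma>], of "cosh t"] by (simp add: less_imp_le cosh_real_pos)
  ultimately have "cross_im \<sigma> t \<le> - (17/20) * sinh \<sigma> + cosh \<sigma> / 2 + exp t"
    using sinh_plus_cosh[of t] by (simp add: cross_im_def st ct)
  moreover have "sinh \<sigma> = (exp \<sigma> - exp (-\<sigma>)) / 2" "cosh \<sigma> = (exp \<sigma> + exp (-\<sigma>)) / 2"
    by (simp_all add: sinh_field_def cosh_field_def)
  ultimately show ?thesis using big e em by argo
qed

text \<open>Where \<open>cross_im\<close> vanishes, \<open>cross_re\<close> equals \<open>2 (cosh \<sigma> sin t - cosh t sin \<sigma>)\<close>. The first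
  product dominates, as \<open>sin t \<ge> 1 / 2\<close> on this range of \<open>t\<close>.\<close>
lemma cross_re_pos:
  assumes t: "1 \<le> t" "t \<le> 5 * pi / 6" and \<sigma>: "\<sigma> \<ge> 7 * t" and z: "cross_im \<sigma> t = 0"
  shows "cross_re \<sigma> t > 0"
proof -
  have "sin t \<ge> 1/2"
  proof -
    have "\<bar>t - pi / 2\<bar> \<le> pi / 3" 
      using t pi_less_4 unfolding abs_le_iff by (intro conjI; linarith)
    then have "cos (pi / 3) \<le> cos \<bar>t - pi / 2\<bar>" using pi_gt3 by (subst cos_mono_le_eq) auto
    moreover have "cos \<bar>t - pi / 2\<bar> = sin t" by (simp add: cos_diff)
    ultimately show ?thesis by (simp add: cos_60)
  qed
  then have "cosh \<sigma> * (1/2) \<le> cosh \<sigma> * sin t" by (intro mult_left_mono) (auto simp: less_imp_le cosh_real_pos)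
  moreover have "cosh t * sin \<sigma> \<le> cosh t * 1" by (intro mult_left_mono) (auto simp: less_imp_le cosh_real_pos)
  moreover have "cosh t \<le> exp t" using t by (simp add: cosh_field_def)
  moreover have "cosh \<sigma> > 2 * exp t"
  proof -
    have "4 * exp t < 7 * exp t" by simp
    also have "\<dots> \<le> exp \<sigma>" by (rule exp_multiple_le[OF t(1) \<sigma>])
    also have "\<dots> < exp \<sigma> + exp (-\<sigma>)" by simp
    finally show ?thesis by (simp add: cosh_field_def)
  qed
  moreover have "cross_re \<sigma> t = 2 * (cosh \<sigma> * sin t - cosh t * sin \<sigma>)"
    using z unfolding cross_re_def cross_im_def right_diff_distrib by linarith
  ultimately show ?thesis by argo
qed

text \<open>The intermediate value theorem between \<open>t = 1\<close> and \<open>t = 5 \<pi> / 6\<close>, where \<open>\<sigma> \<ge> 7 t\<close> since \<open>L \<ge> 4 x\<^sub>0\<close>.\<close>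
lemma exists_crossing:
  assumes x0: "0 < x0" and L: "L \<ge> 4 * x0"
  obtains s \<beta> where "s > 0" "\<beta> > 0" "char_quot L (L - x0) (Complex s s) = of_real \<beta>"
proof -
  define f where "f = (\<lambda>s. cross_im (s * (2 * L - x0)) (s * x0))"
  define s1 s2 where "s1 = 1 / x0" and "s2 = (5 * pi / 6) / x0"
  have s12: "0 < s1" "s1 \<le> s2" using x0 pi_gt3 by (auto simp: s1_def s2_def field_simps)
  have \<sigma>: "s * (2 * L - x0) \<ge> 7 * (s * x0)" if "s > 0" for s
    using mult_left_mono[of "7 * x0" "2 * L - x0" s] L that by (simp add: mult.left_commute)
  have "f s1 > 0" unfolding f_def using x0 L
    by (intro cross_im_pos) (auto simp: s1_def field_simps)
  moreover have "f s2 < 0" unfolding f_def using \<sigma>[of s2] s12 x0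
    by (intro cross_im_neg) (auto simp: s2_def)
  moreover have "continuous_on {s1..s2} f" unfolding f_def cross_im_def by (intro continuous_intros)
  ultimately obtain s where s: "s1 \<le> s" "s \<le> s2" "f s = 0"
    using IVT2'[of f s2 0 s1] s12 by auto
  have spos: "s > 0" using s s12 by linarith
  have t: "1 \<le> s * x0" "s * x0 \<le> 5 * pi / 6"
    using s x0 by (auto simp: s1_def s2_def pos_divide_le_eq pos_le_divide_eq)
  have re: "cross_re (s * (2 * L - x0)) (s * x0) > 0"
    using cross_re_pos[OF t \<sigma>[OF spos]] s(3) by (simp add: f_def)
  define n where "n = (cmod (sin (Complex s s * of_real (L - x0))))\<^sup>2"
  have "sin (Complex s s * of_real (L - x0)) \<noteq> 0" using spos L x0 by (intro sin_mult_real_nonzero) auto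
  then have n: "n > 0" by (simp add: n_def)
  have "char_quot L (L - x0) (Complex s s) * of_real n = of_real (s * cross_re (s * (2 * L - x0)) (s * x0))"
    using char_quot_diagonal[of "L - x0" s L] spos x0 L s(3) unfolding n_def
    by (simp add: f_def complex_eq_iff)
  then have "char_quot L (L - x0) (Complex s s) = of_real (s * cross_re (s * (2 * L - x0)) (s * x0) / n)"
    using n by (simp add: field_simps)
  then show ?thesis using spos re n by (intro that[of s "s * cross_re (s * (2 * L - x0)) (s * x0) / n"]) auto
qed

lemma crossing_bound:
  assumes x0: "0 < x0" "x0 < L" and s: "s > 0" and h: "char_quot L (L - x0) (Complex s s) = of_real \<beta>"
  shows "s * x0 > 1"
proof (rule ccontr)
  assume "\<not> ?thesis"
  then have "cross_im (s * (2 * L - x0)) (s * x0) > 0"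
    using x0 s by (intro cross_im_pos) auto
  moreover have "Complex (s * cross_re (s * (2 * L - x0)) (s * x0)) (s * cross_im (s * (2 * L - x0)) (s * x0))
     = of_real (\<beta> * (cmod (sin (Complex s s * of_real (L - x0))))\<^sup>2)"
    using char_quot_diagonal[of "L - x0" s L] s x0 unfolding h by simp
  then have "s * cross_im (s * (2 * L - x0)) (s * x0) = 0" by (simp add: complex_eq_iff)
  ultimately show False using s by simp
qed

text \<open>For large \<open>X\<close> the tangent of \<open>X (1 + i)\<close> is close to \<open>i\<close>, so the imaginary part is close to \<open>X\<close>; the
  denominator \<open>sinh\<^sup>2 X + cos\<^sup>2 X \<ge> X\<^sup>2\<close> makes the error explicit.\<close>
lemma Im_diagonal_tan:
  assumes "X > 0"
  shows "Im (Complex X X * sin (Complex X X) / cos (Complex X X)) \<ge> X - 3 / (2 * X)"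
proof -
  let ?s = "sin X" and ?c = "cos X" and ?S = "sinh X" and ?C = "cosh X"
  have py: "?s * ?s + ?c * ?c = 1" "?C * ?C = ?S * ?S + 1"
    using sin_cos_squared_add[of X] cosh_square_eq[of X] by (auto simp: power2_eq_square)
  have S: "?S \<ge> X" using assms by (intro sinh_ge_self) auto
  have C: "?C \<ge> ?S" by (rule sinh_le_cosh_real)
  have den: "?S\<^sup>2 + ?c\<^sup>2 = (?c * ?C)\<^sup>2 + (?s * ?S)\<^sup>2"
    using py unfolding power2_eq_square by algebra
  have XS: "X\<^sup>2 \<le> ?S\<^sup>2 + ?c\<^sup>2" using power_mono[OF S, of 2] assms by (simp add: add_increasing2)
  then have dpos: "?S\<^sup>2 + ?c\<^sup>2 > 0" using assms by (smt (verit) zero_less_power)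
  have "Im (Complex X X * sin (Complex X X) / cos (Complex X X)) = X * (?s * ?c + ?S * ?C) / (?S\<^sup>2 + ?c\<^sup>2)"
  proof -
    have "Im (Complex X X * sin (Complex X X) / cos (Complex X X))
      = (X * (?s * ?C + ?c * ?S) * (?c * ?C) + X * (?s * ?C - ?c * ?S) * (?s * ?S)) / (?S\<^sup>2 + ?c\<^sup>2)"
      unfolding den by (simp add: Im_divide Re_cos_cosh Im_cos_sinh Re_sin_cosh Im_sin_sinh algebra_simps)
    also have "X * (?s * ?C + ?c * ?S) * (?c * ?C) + X * (?s * ?C - ?c * ?S) * (?s * ?S) = X * (?s * ?c + ?S * ?C)"
      using py by algebra
    finally show ?thesis .
  qed
  also have "\<dots> = X + X * (?s * ?c + ?S * ?C - ?S\<^sup>2 - ?c\<^sup>2) / (?S\<^sup>2 + ?c\<^sup>2)"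
  proof -
    have "X * (?S\<^sup>2 + ?c\<^sup>2) / (?S\<^sup>2 + ?c\<^sup>2) = X" using dpos by simp
    then show ?thesis unfolding diff_diff_eq right_diff_distrib[of X] diff_divide_distrib by linarith
  qed
  also have "\<dots> \<ge> X + X * (- (3/2)) / X\<^sup>2"
  proof -
    have "(?s + ?c) * (?s + ?c) = 1 + 2 * (?s * ?c)" using py(1) by algebra
    then have "0 \<le> 1 + 2 * (?s * ?c)" using zero_le_square[of "?s + ?c"] by (simp only:)
    then have "?s * ?c \<ge> - 1/2" by linarith
    moreover have "?S * ?C \<ge> ?S\<^sup>2" using C S assms by (simp add: power2_eq_square mult_left_mono)
    moreover have "?c\<^sup>2 \<le> 1" by (simp add: abs_square_le_1)
    ultimately have "?s * ?c + ?S * ?C - ?S\<^sup>2 - ?c\<^sup>2 \<ge> - (3/2)" by argo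
    then have "X * (- (3/2)) / (?S\<^sup>2 + ?c\<^sup>2) \<le> X * (?s * ?c + ?S * ?C - ?S\<^sup>2 - ?c\<^sup>2) / (?S\<^sup>2 + ?c\<^sup>2)"
      using assms dpos by (intro divide_right_mono mult_left_mono) auto
    moreover have "X * (3/2) / (?S\<^sup>2 + ?c\<^sup>2) \<le> X * (3/2) / X\<^sup>2"
      using assms XS dpos by (intro divide_left_mono) auto
    ultimately show ?thesis by simp
  qed
  finally show ?thesis using assms by (simp add: power2_eq_square)
qed

text \<open>The counterpart for the cotangent, which is close to \<open>-i\<close>.\<close>
lemma Im_diagonal_cot:
  assumes "Y > 0"
  shows "Im (Complex Y Y * cos (Complex Y Y) / sin (Complex Y Y)) \<ge> - Y - 1 / Y"
proof -
  let ?s = "sin Y" and ?c = "cos Y" and ?S = "sinh Y" and ?C = "cosh Y"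
  have py: "?s * ?s + ?c * ?c = 1" "?C * ?C = ?S * ?S + 1"
    using sin_cos_squared_add[of Y] cosh_square_eq[of Y] by (auto simp: power2_eq_square)
  have S: "?S \<ge> Y" using assms by (intro sinh_ge_self) auto
  have den: "?S\<^sup>2 + ?s\<^sup>2 = (?s * ?C)\<^sup>2 + (?c * ?S)\<^sup>2"
    using py unfolding power2_eq_square by algebra
  have YS: "Y\<^sup>2 \<le> ?S\<^sup>2 + ?s\<^sup>2" using power_mono[OF S, of 2] assms by (simp add: add_increasing2)
  then have dpos: "?S\<^sup>2 + ?s\<^sup>2 > 0" using assms by (smt (verit) zero_less_power)
  have "Im (Complex Y Y * cos (Complex Y Y) / sin (Complex Y Y)) = Y * (?s * ?c - ?S * ?C) / (?S\<^sup>2 + ?s\<^sup>2)"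
  proof -
    have "Im (Complex Y Y * cos (Complex Y Y) / sin (Complex Y Y))
      = (Y * (?c * ?C - ?s * ?S) * (?s * ?C) - Y * (?c * ?C + ?s * ?S) * (?c * ?S)) / (?S\<^sup>2 + ?s\<^sup>2)"
      unfolding den by (simp add: Im_divide Re_cos_cosh Im_cos_sinh Re_sin_cosh Im_sin_sinh algebra_simps)
    also have "Y * (?c * ?C - ?s * ?S) * (?s * ?C) - Y * (?c * ?C + ?s * ?S) * (?c * ?S) = Y * (?s * ?c - ?S * ?C)"
      using py by algebra
    finally show ?thesis .
  qed
  also have "\<dots> = - Y + Y * (?s * ?c - ?S * ?C + ?S\<^sup>2 + ?s\<^sup>2) / (?S\<^sup>2 + ?s\<^sup>2)"
  proof -
    have "Y * (?S\<^sup>2 + ?s\<^sup>2) / (?S\<^sup>2 + ?s\<^sup>2) = Y" using dpos by simp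
    then show ?thesis unfolding add.assoc distrib_left[of Y "?s * ?c - ?S * ?C"] add_divide_distrib by linarith
  qed
  also have "\<dots> \<ge> - Y + Y * (- 1) / Y\<^sup>2"
  proof -
    have "(?s + ?c) * (?s + ?c) = 1 + 2 * (?s * ?c)" using py(1) by algebra
    then have "0 \<le> 1 + 2 * (?s * ?c)" using zero_le_square[of "?s + ?c"] by (simp only:)
    then have "?s * ?c \<ge> - 1/2" by linarith
    moreover have "?S * ?C - ?S\<^sup>2 \<le> 1/2"
    proof -
      have "?S * ?C - ?S\<^sup>2 = ?S * exp (-Y)" unfolding cosh_minus_sinh[symmetric] by (simp add: power2_eq_square algebra_simps)
      also have "\<dots> = (1 - exp (-Y) * exp (-Y)) / 2" by (simp add: sinh_field_def algebra_simps exp_add[symmetric])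
      also have "\<dots> \<le> 1/2" by simp
      finally show ?thesis .
    qed
    ultimately have "?s * ?c - ?S * ?C + ?S\<^sup>2 + ?s\<^sup>2 \<ge> - 1" using zero_le_power2[of ?s] by linarith
    then have "Y * (- 1) / (?S\<^sup>2 + ?s\<^sup>2) \<le> Y * (?s * ?c - ?S * ?C + ?S\<^sup>2 + ?s\<^sup>2) / (?S\<^sup>2 + ?s\<^sup>2)"
      using assms dpos by (intro divide_right_mono mult_left_mono) auto
    moreover have "Y * 1 / (?S\<^sup>2 + ?s\<^sup>2) \<le> Y * 1 / Y\<^sup>2"
      using assms YS dpos by (intro divide_left_mono) auto
    ultimately show ?thesis by simp
  qed
  finally show ?thesis using assms by (simp add: power2_eq_square)
qed

section \<open>Transversality and local branches of roots\<close>

definition quadrant :: "complex set" where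
  "quadrant = {k. 0 < Re k} \<inter> {k. 0 < Im k}"

lemma open_quadrant: "open quadrant"
  unfolding quadrant_def by (intro open_Int open_halfspace_Re_gt open_halfspace_Im_gt)

lemma convex_quadrant: "convex quadrant"
  unfolding quadrant_def by (intro convex_Int convex_halfspace_Re_gt convex_halfspace_Im_gt)

lemma char_quot_holomorphic:
  assumes "a > 0" shows "char_quot L a holomorphic_on quadrant"
  unfolding char_quot_def[abs_def]
  by (intro holomorphic_intros) (use sin_mult_real_nonzero[OF assms] in \<open>auto simp: quadrant_def\<close>)

lemma char_quot_deriv:
  assumes "k \<noteq> 0" "cos (k * of_real L) \<noteq> 0" "sin (k * of_real a) \<noteq> 0"
  shows "(char_quot L a has_field_derivative
    char_quot L a k * (1 - (k * of_real L * sin (k * of_real L) / cos (k * of_real L) + k * of_real a * cos (k * of_real a) / sin (k * of_real a))) / k) (at k)"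
proof -
  let ?c = "cos (k * of_real L)" and ?s = "sin (k * of_real L)" and ?C = "cos (k * of_real a)" and ?S = "sin (k * of_real a)"
  have "(char_quot L a has_field_derivative
     ((- 2 * ?c + 2 * k * of_real L * ?s) * ?S - (- 2 * k * ?c) * (of_real a * ?C)) / (?S * ?S)) (at k)"
    unfolding char_quot_def[abs_def] using assms
    by (auto intro!: derivative_eq_intros simp: field_simps)
  moreover have "((- 2 * ?c + 2 * k * of_real L * ?s) * ?S - (- 2 * k * ?c) * (of_real a * ?C)) / (?S * ?S)
     = char_quot L a k * (1 - (k * of_real L * ?s / ?c + k * of_real a * ?C / ?S)) / k"
    using assms by (simp add: char_quot_def divide_simps) (simp add: algebra_simps)
  ultimately show ?thesis by simp
qed

text \<open>With \<open>M = k L tan (k L) + k a cot (k a)\<close> one has \<open>h' = \<beta> (1 - M) / k\<close>, and \<open>k\<^sup>2 = 2 i s\<^sup>2\<close>. Hence the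
  derivative \<open>2 k / h'\<close> of \<open>k\<^sup>2\<close> in \<open>\<beta>\<close> has the sign of \<open>Re (i / (1 - M))\<close>, which is that of \<open>- Im M\<close>.
  The two estimates above give \<open>Im M \<ge> s x\<^sub>0 - 3 / (2 s L) - 1 / (s a) > 0\<close>, because \<open>s x\<^sub>0 > 1\<close>
  and \<open>L \<ge> 4 x\<^sub>0\<close> imply \<open>s a > 3\<close>.\<close>
lemma crossing_transversal:
  assumes x0: "0 < x0" and L: "L \<ge> 4 * x0" and s: "s > 0" and \<beta>: "\<beta> > 0"
    and h: "char_quot L (L - x0) (Complex s s) = of_real \<beta>"
  obtains D where "(char_quot L (L - x0) has_field_derivative D) (at (Complex s s))" "D \<noteq> 0"
    "Re (2 * Complex s s / D) < 0"
proof -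
  define a where "a = L - x0"
  define k where "k = Complex s s"
  define M where "M = k * of_real L * sin (k * of_real L) / cos (k * of_real L) + k * of_real a * cos (k * of_real a) / sin (k * of_real a)"
  define D where "D = of_real \<beta> * (1 - M) / k"
  have a: "a \<ge> 3 * x0" "a > 0" "a < L" using x0 L by (auto simp: a_def)
  have k0: "k \<noteq> 0" using s by (simp add: k_def complex_eq_iff)
  have Sz: "sin (k * of_real a) \<noteq> 0" using a s by (intro sin_mult_real_nonzero) (auto simp: k_def)
  have cz: "cos (k * of_real L) \<noteq> 0" using h \<beta> by (auto simp: char_quot_def k_def[symmetric])
  have t: "s * x0 > 1" by (rule crossing_bound[OF x0 _ s h]) (use x0 L in auto)
  have X: "k * of_real L = Complex (s * L) (s * L)" and Y: "k * of_real a = Complex (s * a) (s * a)"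
    by (simp_all add: k_def complex_eq_iff)
  have pos: "s * L > 0" "s * a > 0" using s a by auto
  have Y3: "s * a > 3"
  proof -
    have "3 < 3 * (s * x0)" using t by simp
    also have "\<dots> = s * (3 * x0)" by simp
    also have "\<dots> \<le> s * a" using a(1) s by (intro mult_left_mono) auto
    finally show ?thesis .
  qed
  have XY: "s * L > s * a + 1" using t by (simp add: a_def right_diff_distrib)
  have "Im M \<ge> s * L - 3 / (2 * (s * L)) + (- (s * a) - 1 / (s * a))"
    unfolding M_def X Y using Im_diagonal_tan[OF pos(1)] Im_diagonal_cot[OF pos(2)] by simp
  moreover have "3 / (2 * (s * L)) \<le> 3 / (2 * 3)"
  proof (rule divide_left_mono)
    show "2 * 3 \<le> 2 * (s * L)" using XY Y3 by linarith
  qed (use pos in simp_all)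
  moreover have "1 / (s * a) \<le> 1 / 3"
  proof (rule divide_left_mono)
    show "3 \<le> s * a" using Y3 by linarith
  qed (use pos in simp_all)
  ultimately have M: "Im M > 0" using XY by linarith
  then have M1: "1 - M \<noteq> 0" by auto
  have "(char_quot L a has_field_derivative D) (at k)"
    using char_quot_deriv[OF k0 cz Sz] h unfolding D_def M_def by (simp add: k_def a_def)
  moreover have "D \<noteq> 0" using \<beta> M1 k0 by (simp add: D_def)
  moreover have "Re (2 * k / D) < 0"
  proof -
    have "2 * k / D = of_real (4 * s\<^sup>2 / \<beta>) * (\<i> / (1 - M))"
    proof -
      have "k * k = \<i> * of_real (2 * s\<^sup>2)" by (simp add: k_def complex_eq_iff power2_eq_square)
      moreover have "2 * k / D = 2 * (k * k) / (of_real \<beta> * (1 - M))" using k0 by (simp add: D_def)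
      ultimately show ?thesis using \<beta> M1 by (simp add: field_simps)
    qed
    then have "Re (2 * k / D) = 4 * s\<^sup>2 / \<beta> * Re (\<i> / (1 - M))"
      by (simp only: times_complex.sel Re_complex_of_real Im_complex_of_real mult_zero_left diff_zero)
    moreover have "Re (\<i> / (1 - M)) = - Im M / (cmod (1 - M))\<^sup>2"
      by (simp add: Re_divide cmod_power2)
    moreover have "- Im M / (cmod (1 - M))\<^sup>2 < 0" using M M1 by (simp add: divide_neg_pos)
    moreover have "4 * s\<^sup>2 / \<beta> > 0" using s \<beta> by simp
    ultimately show ?thesis by (metis mult_pos_neg)
  qed
  ultimately show ?thesis using that by (simp add: a_def k_def)
qed

text \<open>The derivative at a diagonal root is nonzero.\<close>
lemma char_quot_nonconstant:
  assumes x0: "0 < x0" and L: "L \<ge> 4 * x0"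
  shows "\<not> char_quot L (L - x0) constant_on quadrant"
proof
  assume "char_quot L (L - x0) constant_on quadrant"
  then obtain c where c: "\<And>k. k \<in> quadrant \<Longrightarrow> char_quot L (L - x0) k = c" by (auto simp: constant_on_def)
  obtain s \<beta> where s: "s > 0" "\<beta> > 0" "char_quot L (L - x0) (Complex s s) = of_real \<beta>"
    using exists_crossing[OF x0 L] .
  obtain D where D: "(char_quot L (L - x0) has_field_derivative D) (at (Complex s s))" "D \<noteq> 0"
    using crossing_transversal[OF x0 L s] by blast
  have "((\<lambda>_. c) has_field_derivative D) (at (Complex s s))"
    by (rule has_field_derivative_transform_within_open[OF D(1) open_quadrant])
       (use c s in \<open>auto simp: quadrant_def\<close>)
  then have "D = 0" using DERIV_const DERIV_unique by blast
  then show False using D by simp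
qed

text \<open>The open mapping theorem, restricted to real values.\<close>
lemma open_real_values:
  assumes x0: "0 < x0" and L: "L \<ge> 4 * x0" and U: "open U" "U \<subseteq> quadrant"
  shows "open {\<beta>::real. of_real \<beta> \<in> char_quot L (L - x0) ` U}"
proof -
  have "open (char_quot L (L - x0) ` U)"
    using open_mapping_thm[OF char_quot_holomorphic open_quadrant convex_connected[OF convex_quadrant] U char_quot_nonconstant[OF x0 L]]
      x0 L by simp
  then have "open (complex_of_real -` (char_quot L (L - x0) ` U))"
    by (rule open_vimage) (intro continuous_intros)
  then show ?thesis by (simp add: vimage_def)
qed

lemma open_real_left:
  assumes "open B" "b \<in> (B::real set)" "b > 0"
  obtains c where "0 \<le> c" "c < b" "c \<in> B"
proof -
  obtain e where e: "e > 0" "\<And>y. dist y b < e \<Longrightarrow> y \<in> B" using assms unfolding open_dist by blast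
  show ?thesis
    by (rule that[of "max 0 (b - e / 2)"]) (use e assms in \<open>auto simp: dist_real_def max_def intro!: e(2)\<close>)
qed

text \<open>The bounds on roots give compactness, and keep the limit away from the imaginary axis and from the
  trivial root \<open>0\<close> of the equation.\<close>
lemma root_limit:
  assumes a: "0 < a" "a < L" and \<beta>: "\<And>n. \<beta> n \<ge> (0::real)" "\<beta> \<longlonglongrightarrow> b"
    and k: "\<And>n. k n \<in> quadrant" "\<And>n. char_quot L a (k n) = of_real (\<beta> n)"
  obtains r l where "strict_mono r" "(k \<circ> r) \<longlonglongrightarrow> l" "Re l > 0" "Im l \<ge> 0"
    "2 * l * cos (l * of_real L) + of_real b * sin (l * of_real a) = 0"
proof -
  have kq: "Re (k n) > 0" "Im (k n) > 0" for n using k(1)[of n] by (auto simp: quadrant_def)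
  have "Bseq \<beta>" using \<beta>(2) by (intro convergent_imp_Bseq convergentI)
  then obtain B where B: "\<And>n. \<beta> n \<le> B" "B > 0" unfolding Bseq_def by (auto simp: abs_le_iff)
  have nb: "norm (k n) \<le> 1 + B * (4 + 1 / L)" for n
  proof -
    have "cmod (k n) \<le> 1 + \<beta> n * (4 + 1 / L)" by (rule root_norm_bound[OF a kq(2) kq(1) \<beta>(1) k(2)])
    also have "\<dots> \<le> 1 + B * (4 + 1 / L)" using a B by (intro add_left_mono mult_right_mono) auto
    finally show ?thesis .
  qed
  have "bounded (range k)" unfolding bounded_iff using nb by blast
  then obtain l r where r: "strict_mono r" "(k \<circ> r) \<longlonglongrightarrow> l"
    using bounded_imp_convergent_subsequence by blast
  have Rel: "Re l \<ge> pi / (2 * L)"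
  proof (rule LIMSEQ_le_const[OF tendsto_Re[OF r(2)]])
    have "Re (k n) * L \<ge> pi / 2" for n
      using root_Re_lower_bound[OF a kq(1) _ \<beta>(1) k(2)] kq(2)[of n] by (metis less_numeral_extra(3))
    then have "pi / (2 * L) \<le> Re (k n)" for n using a by (simp add: field_simps)
    then show "\<exists>N. \<forall>n\<ge>N. pi / (2 * L) \<le> Re ((k \<circ> r) n)" by auto
  qed
  have "pi / (2 * L) > 0" using a by simp
  then have Rel: "Re l > 0" using Rel by linarith
  have Iml: "Im l \<ge> 0"
    by (rule LIMSEQ_le_const[OF tendsto_Im[OF r(2)]]) (use kq in \<open>auto intro!: less_imp_le\<close>)
  have br: "(\<lambda>n. \<beta> (r n)) \<longlonglongrightarrow> b" using LIMSEQ_subseq_LIMSEQ[OF \<beta>(2) r(1)] by (simp add: o_def)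
  have lim: "(\<lambda>n. 2 * (k \<circ> r) n * cos ((k \<circ> r) n * of_real L) + of_real (\<beta> (r n)) * sin ((k \<circ> r) n * of_real a))
     \<longlonglongrightarrow> 2 * l * cos (l * of_real L) + of_real b * sin (l * of_real a)"
    by (intro tendsto_intros r br)
  have "2 * k n * cos (k n * of_real L) + of_real (\<beta> n) * sin (k n * of_real a) = 0" for n
    using char_quot_eq_iff[OF sin_mult_real_nonzero[OF a(1)]] kq(2)[of n] k(2)[of n]
    by (metis less_numeral_extra(3))
  then have "(\<lambda>n. 0) \<longlonglongrightarrow> 2 * l * cos (l * of_real L) + of_real b * sin (l * of_real a)"
    using lim by simp
  then have "2 * l * cos (l * of_real L) + of_real b * sin (l * of_real a) = 0"
    by (simp add: LIMSEQ_const_iff)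
  then show ?thesis using that r Rel Iml by blast
qed

text \<open>Let \<open>n\<close> be the order of \<open>H - b\<close> at \<open>x\<close>, so that \<open>H = b + \<phi>\<^sup>n\<close> near \<open>x\<close> with an invertible \<open>\<phi>\<close>, whose
  inverse is \<open>\<psi>\<close>. The preimages of \<open>b + t\<^sup>n\<close> near \<open>x\<close> are \<open>\<psi>(\<omega> t)\<close> with \<open>\<omega>\<^sup>n = 1\<close>. A single nonreal
  preimage selects an \<open>\<omega>\<close> for which \<open>\<psi>(\<omega> u) - cnj (\<psi>(\<omega> cnj u))\<close> is not identically zero. This
  function is holomorphic in \<open>u\<close>, equals \<open>2 i Im \<psi>(\<omega> u)\<close> for real \<open>u\<close>, and vanishes at \<open>0\<close>, where its zero
  is isolated.\<close>
lemma nonreal_branch: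
  fixes H :: "complex \<Rightarrow> complex" and x b :: real
  assumes H: "H analytic_on {of_real x}" and Hx: "H (of_real x) = of_real b"
    and near: "\<And>e. e > 0 \<Longrightarrow> \<exists>k \<beta>. k \<in> ball (of_real x) e \<and> b < \<beta> \<and> H k = of_real \<beta> \<and> Im k \<noteq> 0"
    and e: "e > 0"
  obtains \<epsilon> where "\<epsilon> > 0" "\<And>\<beta>. b < \<beta> \<Longrightarrow> \<beta> < b + \<epsilon> \<Longrightarrow> \<exists>k\<in>ball (of_real x) e. Im k \<noteq> 0 \<and> H k = of_real \<beta>"
proof -
  let ?x = "of_real x :: complex"
  obtain r0 where r0: "r0 > 0" "H holomorphic_on ball ?x r0" using H by (auto simp: analytic_on_def)
  have "\<exists>n>0. (deriv ^^ n) H ?x \<noteq> 0"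
  proof (rule ccontr)
    assume "\<not> ?thesis"
    then have n: "(deriv ^^ m) H ?x = 0" if "0 < m" for m using that by blast
    obtain k \<beta> where k: "k \<in> ball ?x r0" "b < \<beta>" "H k = of_real \<beta>" using near[OF r0(1)] by blast
    have "H k = H ?x"
      by (rule holomorphic_fun_eq_const_on_connected[OF r0(2) open_ball connected_ball n]) (use k(1) r0(1) in simp_all)
    then show False using k Hx by simp
  qed
  then obtain n where n: "n > 0" "(deriv ^^ n) H ?x \<noteq> 0" "\<And>i. 0 < i \<Longrightarrow> i < n \<Longrightarrow> (deriv ^^ i) H ?x = 0"
  proof -
    define P where "P = (\<lambda>n. n > 0 \<and> (deriv ^^ n) H ?x \<noteq> 0)"
    have ex: "\<exists>n. P n" using \<open>\<exists>n>0. (deriv ^^ n) H ?x \<noteq> 0\<close> by (simp add: P_def)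
    have P: "P (LEAST n. P n)" by (rule LeastI_ex[OF ex])
    have min: "\<not> P i" if "i < (LEAST n. P n)" for i using that by (rule not_less_Least)
    show thesis
    proof (rule that)
      show "(LEAST n. P n) > 0" "(deriv ^^ (LEAST n. P n)) H ?x \<noteq> 0" using P by (simp_all add: P_def)
      show "(deriv ^^ i) H ?x = 0" if "0 < i" "i < (LEAST n. P n)" for i
        using min[OF that(2)] that(1) by (simp add: P_def)
    qed
  qed
  have xc: "?x \<in> ball ?x r0" using r0(1) by simp
  obtain g r1 where r1: "r1 > 0" "g holomorphic_on ball ?x r1"
    "\<And>w. w \<in> ball ?x r1 \<Longrightarrow> H w - H ?x = ((w - ?x) * g w) ^ n" "\<And>w. w \<in> ball ?x r1 \<Longrightarrow> g w \<noteq> 0"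
    by (rule holomorphic_factor_order_of_zero_strong[OF r0(2) open_ball xc n(1,2,3)];
        (assumption | (rule that; assumption)))
  define S where "S = ball ?x (min r1 e)"
  have S: "open S" "?x \<in> S" "S \<subseteq> ball ?x r1" "S \<subseteq> ball ?x e" using r1 e by (auto simp: S_def)
  define \<phi> where "\<phi> = (\<lambda>w. (w - ?x) * g w)"
  have \<phi>h: "\<phi> holomorphic_on S" unfolding \<phi>_def using r1(2) S(3) by (intro holomorphic_intros) (auto intro: holomorphic_on_subset)
  have "(g has_field_derivative deriv g ?x) (at ?x)"
    using r1(1) by (intro holomorphic_derivI[OF r1(2) open_ball]) auto
  then have "(\<phi> has_field_derivative g ?x) (at ?x)"
    unfolding \<phi>_def by (auto intro!: derivative_eq_intros)
  then have "deriv \<phi> ?x = g ?x" by (rule DERIV_imp_deriv)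
  then have "deriv \<phi> ?x \<noteq> 0" using r1(1) r1(4)[of ?x] by simp
  then obtain r2 where r2: "r2 > 0" "ball ?x r2 \<subseteq> S" "open (\<phi> ` ball ?x r2)" "inj_on \<phi> (ball ?x r2)"
    using has_complex_derivative_locally_invertible[OF \<phi>h S(2,1)] by blast
  have \<phi>h2: "\<phi> holomorphic_on ball ?x r2" using \<phi>h r2(2) by (rule holomorphic_on_subset)
  obtain \<psi> where \<psi>: "\<psi> holomorphic_on \<phi> ` ball ?x r2" "\<And>z. z \<in> ball ?x r2 \<Longrightarrow> \<psi> (\<phi> z) = z"
    using holomorphic_has_inverse[OF \<phi>h2 open_ball r2(4)] by metis
  have \<phi>0: "\<phi> ?x = 0" by (simp add: \<phi>_def)
  then have "0 \<in> \<phi> ` ball ?x r2" using r2(1) by (intro image_eqI[of _ _ ?x]) auto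
  then obtain \<delta> where \<delta>: "\<delta> > 0" "ball 0 \<delta> \<subseteq> \<phi> ` ball ?x r2" using r2(3) openE by blast
  have \<psi>0: "\<psi> 0 = ?x" using \<psi>(2)[of ?x] \<phi>0 r2(1) by simp
  have \<psi>r: "\<psi> u \<in> ball ?x r2 \<and> \<phi> (\<psi> u) = u" if u: "u \<in> ball 0 \<delta>" for u
  proof -
    obtain w where w: "w \<in> ball ?x r2" "u = \<phi> w" using u \<delta>(2) by blast
    then show ?thesis using \<psi>(2)[OF w(1)] by simp
  qed
  have Hf: "H w = of_real b + \<phi> w ^ n" if "w \<in> ball ?x r2" for w
  proof -
    have "w \<in> ball ?x r1" using that r2(2) S(3) by blast
    then show ?thesis using r1(3)[of w] Hx by (simp add: \<phi>_def algebra_simps)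
  qed
  obtain d where d: "d > 0" "\<And>w. w \<in> ball ?x d \<Longrightarrow> w \<in> ball ?x r2 \<and> cmod (\<phi> w) < \<delta>"
  proof -
    have "isCont \<phi> ?x"
      using \<open>(\<phi> has_field_derivative g ?x) (at ?x)\<close> by (rule DERIV_isCont)
    then obtain d where "d > 0" "\<And>w. dist w ?x < d \<Longrightarrow> dist (\<phi> w) (\<phi> ?x) < \<delta>"
      using \<delta>(1) unfolding continuous_at_eps_delta by blast
    then show ?thesis using r2(1) \<phi>0 by (intro that[of "min d r2"]) (auto simp: dist_commute)
  qed
  obtain k \<beta> where k: "k \<in> ball ?x d" "b < \<beta>" "H k = of_real \<beta>" "Im k \<noteq> 0" using near[OF d(1)] by blast
  define t where "t = root n (\<beta> - b)"
  have t: "t > 0" "t ^ n = \<beta> - b" using n(1) k(2) by (auto simp: t_def)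
  have \<phi>k: "\<phi> k ^ n = of_real t ^ n"
  proof -
    have "of_real b + \<phi> k ^ n = of_real \<beta>" using Hf[of k] d(2)[OF k(1)] k(3) by simp
    then have "\<phi> k ^ n = of_real (\<beta> - b)" by (metis add_diff_cancel_left' of_real_diff)
    also have "\<dots> = of_real t ^ n" by (metis t(2) of_real_power)
    finally show ?thesis .
  qed
  define \<omega> where "\<omega> = \<phi> k / of_real t"
  have \<omega>n: "\<omega> ^ n = 1" unfolding \<omega>_def power_divide \<phi>k using t(1) by simp
  then have "cmod \<omega> ^ n = 1" using norm_power[of \<omega> n] by simp
  then have \<omega>1: "cmod \<omega> = 1" using n(1) power_eq_imp_eq_base[of "cmod \<omega>" n 1] by simp
  have \<omega>t: "\<omega> * of_real t = \<phi> k" using t(1) by (simp add: \<omega>_def)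
  have t\<delta>: "t < \<delta>"
  proof -
    have "cmod (\<phi> k) = t" unfolding \<omega>t[symmetric] norm_mult using t(1) \<omega>1 by simp
    then show ?thesis using d(2)[OF k(1)] by simp
  qed
  define f where "f = (\<lambda>u. \<psi> (\<omega> * u))"
  have in\<delta>: "\<omega> * u \<in> ball 0 \<delta>" if "u \<in> ball 0 \<delta>" for u using that \<omega>1 by (simp add: norm_mult)
  have fh: "f holomorphic_on ball 0 \<delta>"
  proof -
    have "(\<psi> \<circ> (\<lambda>u. \<omega> * u)) holomorphic_on ball 0 \<delta>"
    proof (rule holomorphic_on_compose_gen[OF _ \<psi>(1)])
      show "(\<lambda>u. \<omega> * u) holomorphic_on ball 0 \<delta>" by (intro holomorphic_intros)
      show "(\<lambda>u. \<omega> * u) ` ball 0 \<delta> \<subseteq> \<phi> ` ball ?x r2" using in\<delta> \<delta>(2) by blast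
    qed
    then show ?thesis by (simp only: f_def o_def)
  qed
  have cnjball: "cnj ` ball 0 \<delta> = ball 0 \<delta>"
  proof (intro equalityI subsetI)
    fix z assume "z \<in> ball (0::complex) \<delta>"
    then show "z \<in> cnj ` ball 0 \<delta>" by (intro image_eqI[of _ _ "cnj z"]) simp_all
  next
    fix z assume "z \<in> cnj ` ball (0::complex) \<delta>"
    then obtain w where "z = cnj w" "w \<in> ball 0 \<delta>" by blast
    then show "z \<in> ball 0 \<delta>" by simp
  qed
  \<comment> \<open>Schwarz reflection turns the imaginary part into a holomorphic function\<close>
  define E where "E = (\<lambda>u. f u - (cnj \<circ> f \<circ> cnj) u)"
  have Eh: "E holomorphic_on ball 0 \<delta>"
    unfolding E_def
    by (intro holomorphic_on_diff fh holomorphic_on_compose_cnj_cnj) (simp_all only: cnjball fh open_ball)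
  have E0: "E 0 = 0" by (simp add: E_def f_def \<psi>0)
  have Et: "E (of_real t) \<noteq> 0"
  proof -
    have "f (of_real t) = k" unfolding f_def \<omega>t by (rule \<psi>(2)) (use d(2)[OF k(1)] in blast)
    then have "E (of_real t) = k - cnj k" by (simp add: E_def)
    then show ?thesis using k(4) by (simp add: complex_eq_iff)
  qed
  obtain r3 where r3: "r3 > 0" "ball (0::complex) r3 \<subseteq> ball 0 \<delta>" "\<And>z. z \<in> ball 0 r3 - {0} \<Longrightarrow> E z \<noteq> 0"
  proof -
    have mem: "(0::complex) \<in> ball 0 \<delta>" "complex_of_real t \<in> ball 0 \<delta>" using \<delta>(1) t\<delta> t(1) by simp_all
    show thesis
      by (rule isolated_zeros[OF Eh open_ball connected_ball mem(1) E0 mem(2) Et]) (rule that, assumption, assumption, blast)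
  qed
  show ?thesis
  proof (rule that[of "r3 ^ n"])
    show "r3 ^ n > 0" using r3 by simp
    fix \<beta>' assume \<beta>': "b < \<beta>'" "\<beta>' < b + r3 ^ n"
    define u where "u = root n (\<beta>' - b)"
    have u: "u > 0" "u ^ n = \<beta>' - b" using n(1) \<beta>'(1) by (auto simp: u_def)
    have "u < r3"
    proof (rule ccontr)
      assume "\<not> u < r3"
      then have "r3 ^ n \<le> u ^ n" using r3(1) by (intro power_mono) auto
      then show False using u(2) \<beta>'(2) by simp
    qed
    then have ub1: "of_real u \<in> ball (0::complex) r3" using u(1) by simp
    with r3(2) have ub: "of_real u \<in> ball (0::complex) r3" "of_real u \<in> ball (0::complex) \<delta>" by blast+
    define k' where "k' = f (of_real u)"
    have k': "k' \<in> ball ?x r2" "\<phi> k' = \<omega> * of_real u"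
      using \<psi>r[OF in\<delta>[OF ub(2)]] by (auto simp: k'_def f_def)
    have "E (of_real u) \<noteq> 0" using r3(3) ub u(1) by auto
    then have "k' - cnj k' \<noteq> 0" by (simp add: E_def k'_def)
    then have "Im k' \<noteq> 0" by (auto simp: complex_eq_iff)
    moreover have "H k' = of_real \<beta>'"
    proof -
      have "H k' = of_real b + of_real (u ^ n)" using Hf[OF k'(1)] by (simp add: k'(2) power_mult_distrib \<omega>n)
      then show ?thesis by (simp add: u(2) del: of_real_power)
    qed
    moreover have "k' \<in> ball ?x e" using k'(1) r2(2) S(4) by blast
    ultimately show "\<exists>k\<in>ball ?x e. Im k \<noteq> 0 \<and> H k = of_real \<beta>'" by blast
  qed
qed

section \<open>The two critical values\<close>

lemma eigenvalue_of_root: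
  assumes x0: "0 < x0" "x0 < L" and k: "Im k \<noteq> 0" and h: "char_quot L (L - x0) k = of_real \<beta>"
  shows "k\<^sup>2 \<in> eigenvalues x0 L \<beta>" "cnj (k\<^sup>2) \<in> eigenvalues x0 L \<beta>"
proof -
  have e: "2 * k * cos (k * L) + of_real \<beta> * sin (k * of_real (L - x0)) = 0"
    using h char_quot_eq_iff[OF sin_mult_real_nonzero[of "L - x0" k]] x0 k by auto
  then have e1: "2 * k * cos (k * L) + \<beta> * sin (k * (L - x0)) = 0" by simp
  have "cnj (2 * k * cos (k * L) + of_real \<beta> * sin (k * of_real (L - x0))) = 0" unfolding e by simp
  then have e2: "2 * cnj k * cos (cnj k * L) + \<beta> * sin (cnj k * (L - x0)) = 0"
    by (simp add: cnj_cos cnj_sin)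
  show "k\<^sup>2 \<in> eigenvalues x0 L \<beta>" by (rule characteristic_imp_eigenvalue[OF x0 k e1])
  have "(cnj k)\<^sup>2 \<in> eigenvalues x0 L \<beta>"
    by (rule characteristic_imp_eigenvalue[OF x0 _ e2]) (use k in simp)
  then show "cnj (k\<^sup>2) \<in> eigenvalues x0 L \<beta>" by simp
qed

text \<open>The symmetries of the characteristic equation move a root into the closed first quadrant. The real
  axis would give \<open>\<mu> > 0\<close>, and on the imaginary axis the real part of the
  equation is a sum of a positive and a nonnegative term.\<close>
lemma eigenvalue_cases:
  assumes x0: "0 < x0" "x0 < L" and \<beta>: "\<beta> \<ge> 0" and \<mu>: "\<mu> \<in> eigenvalues x0 L \<beta>"
    and not_pos: "\<not> (\<mu> \<in> \<real> \<and> Re \<mu> > 0)"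
  obtains k where "k \<in> quadrant" "char_quot L (L - x0) k = of_real \<beta>" "\<mu> = k\<^sup>2 \<or> \<mu> = cnj (k\<^sup>2)"
proof -
  obtain k0 :: complex where k0: "\<mu> = k0\<^sup>2" "k0 \<noteq> 0" and e0: "2 * k0 * cos (k0 * L) + \<beta> * sin (k0 * (L - x0)) = 0"
    using eigenvalue_imp_characteristic[OF x0 \<beta> \<mu>] not_pos by auto
  have a: "L - x0 > 0" "L - x0 < L" using x0 by auto
  have sym: "2 * k * cos (k * L) + of_real \<beta> * sin (k * of_real (L - x0)) = 0"
    if "k = k0 \<or> k = - k0 \<or> k = cnj k0 \<or> k = - cnj k0" for k
  proof -
    have 1: "2 * k0 * cos (k0 * L) + of_real \<beta> * sin (k0 * of_real (L - x0)) = 0" using e0 by simp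
    then have "cnj (2 * k0 * cos (k0 * L) + of_real \<beta> * sin (k0 * of_real (L - x0))) = 0" by simp
    then have 2: "2 * cnj k0 * cos (cnj k0 * L) + of_real \<beta> * sin (cnj k0 * of_real (L - x0)) = 0"
      by (simp add: cnj_cos cnj_sin)
    have neg: "2 * (- k) * cos (- k * L) + of_real \<beta> * sin (- k * of_real (L - x0)) = - (2 * k * cos (k * L) + of_real \<beta> * sin (k * of_real (L - x0)))" for k :: complex
      by (simp only: mult_minus_left mult_minus_right sin_minus cos_minus minus_add_distrib)
    from that consider "k = k0" | "k = cnj k0" | "k = - k0" | "k = - cnj k0" by blast
    then show ?thesis
      by cases (use 1 2 neg[of k0] neg[of "cnj k0"] in simp_all)
  qed
  define k where "k = Complex \<bar>Re k0\<bar> \<bar>Im k0\<bar>"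
  have kc: "k = k0 \<or> k = - k0 \<or> k = cnj k0 \<or> k = - cnj k0"
    by (auto simp: k_def complex_eq_iff abs_if)
  then have e: "2 * k * cos (k * L) + of_real \<beta> * sin (k * of_real (L - x0)) = 0" by (rule sym)
  have \<mu>k: "\<mu> = k\<^sup>2 \<or> \<mu> = cnj (k\<^sup>2)" using kc k0(1) by auto
  have Im: "Im k \<noteq> 0"
  proof
    assume "Im k = 0"
    then have "k0 = of_real (Re k0)" by (simp add: k_def complex_eq_iff)
    then obtain r :: real where r: "k0 = of_real r" by blast
    then have "\<mu> = of_real (r\<^sup>2)" "r \<noteq> 0" using k0 by auto
    then show False using not_pos by auto
  qed
  then have Imp: "Im k > 0" by (simp add: k_def)
  have h: "char_quot L (L - x0) k = of_real \<beta>"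
    using char_quot_eq_iff[OF sin_mult_real_nonzero[OF a(1) Im]] e by blast
  have "Re k \<noteq> 0"
  proof
    assume R: "Re k = 0"
    obtain s where s: "0 < s" "s < L - x0" "Re (sin_sol k (L - x0)) = (L - x0) * (cos (Re k * s) * cosh (Im k * s))"
      using Re_sin_sol_mean_value[OF a(1)] by blast
    have "2 * cosh (Im k * L) + \<beta> * ((L - x0) * cosh (Im k * s)) = 0"
      using root_real_imag(1)[OF a(1) Im h] s(3) by (simp add: R)
    moreover have "\<beta> * ((L - x0) * cosh (Im k * s)) \<ge> 0" using \<beta> a by (simp add: less_imp_le cosh_real_pos)
    moreover have "cosh (Im k * L) > 0" by (rule cosh_real_pos)
    ultimately show False by linarith
  qed
  then have "Re k > 0" by (simp add: k_def)
  then show ?thesis using that[of k] Imp h \<mu>k by (simp add: quadrant_def)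
qed

lemma Inf_parameters_pos:
  assumes a: "0 < a" "a < L" and ne: "S \<noteq> {}"
    and S: "\<And>\<beta>. \<beta> \<in> S \<Longrightarrow> 0 \<le> \<beta> \<and> of_real \<beta> \<in> char_quot L a ` quadrant"
  shows "0 < Inf S"
proof -
  have "1 / a \<le> Inf S"
  proof (rule cInf_greatest[OF ne])
    fix \<beta> assume "\<beta> \<in> S"
    from S[OF this] obtain k where k: "k \<in> quadrant" "char_quot L a k = of_real \<beta>" "\<beta> \<ge> 0" by auto
    then have "\<beta> * a \<ge> 1" by (intro root_beta_lower_bound[OF a _ k(3,2)]) (auto simp: quadrant_def)
    then show "1 / a \<le> \<beta>" using a by (simp add: field_simps)
  qed
  moreover have "0 < 1 / a" using a by simp
  ultimately show ?thesis by linarith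
qed

text \<open>Nonreal roots for parameters decreasing to \<open>Inf S\<close> accumulate at a root \<open>l\<close>. It is real, for
  otherwise \<open>Inf S\<close> would belong to \<open>S\<close>, which is relatively open. Both \<open>cos (k L)\<close> and \<open>sin (k a)\<close> may
  vanish at \<open>l\<close>; since \<open>h\<close> has the finite limit \<open>Inf S\<close> along the roots, \<open>l\<close> is then a removable
  singularity, and the lemma on branches applies to the extension \<open>H\<close>.\<close>
lemma nonreal_after_threshold:
  assumes x0: "0 < x0" and L: "L \<ge> 4 * x0"
    and S_def: "S = {\<beta>. 0 \<le> \<beta> \<and> of_real \<beta> \<in> char_quot L (L - x0) ` quadrant}" and ne: "S \<noteq> {}"
  shows "0 < Inf S" and "\<exists>\<epsilon>>0. \<forall>\<beta>\<in>{Inf S<..<Inf S+\<epsilon>}. \<not> eigenvalues x0 L \<beta> \<subseteq> \<real>"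
    and "\<And>\<beta>. \<beta> \<in> S \<Longrightarrow> Inf S < \<beta>"
proof -
  define a where "a = L - x0"
  have a: "0 < a" "a < L" "x0 < L" using x0 L by (auto simp: a_def)
  have bdd: "bdd_below S" unfolding S_def by (rule bdd_belowI[of _ 0]) auto
  show b0: "0 < Inf S" by (rule Inf_parameters_pos[OF a(1,2) ne]) (simp add: S_def a_def)
  have openS: "open {\<beta>::real. of_real \<beta> \<in> char_quot L (L - x0) ` quadrant}"
    by (rule open_real_values[OF x0 L open_quadrant order.refl])
  have lt: "Inf S < \<beta>" if "\<beta> \<in> S" for \<beta>
  proof -
    have "\<beta> > 0" using b0 cInf_lower[OF that bdd] by linarith
    moreover have "\<beta> \<in> {\<beta>::real. of_real \<beta> \<in> char_quot L (L - x0) ` quadrant}" using that by (simp add: S_def)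
    ultimately obtain c where c: "0 \<le> c" "c < \<beta>" "c \<in> {\<beta>::real. of_real \<beta> \<in> char_quot L (L - x0) ` quadrant}"
      using open_real_left[OF openS] by blast
    then have "c \<in> S" by (simp add: S_def)
    then have "Inf S \<le> c" by (rule cInf_lower[OF _ bdd])
    then show ?thesis using c(2) by simp
  qed
  then show "\<And>\<beta>. \<beta> \<in> S \<Longrightarrow> Inf S < \<beta>" .
  define b where "b = Inf S"
  have "b \<in> closure S" unfolding b_def by (rule closure_contains_Inf[OF ne bdd])
  then obtain \<beta> where \<beta>: "\<And>n. \<beta> n \<in> S" "\<beta> \<longlonglongrightarrow> b" unfolding closure_sequential by blast
  have "\<exists>k. k \<in> quadrant \<and> char_quot L a k = of_real (\<beta> n)" for n
    using \<beta>(1)[of n] by (auto simp: S_def a_def)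
  then obtain k where k: "\<And>n. k n \<in> quadrant" "\<And>n. char_quot L a (k n) = of_real (\<beta> n)" by metis
  have \<beta>0: "\<beta> n \<ge> 0" for n using \<beta>(1)[of n] by (simp add: S_def)
  obtain r l where r: "strict_mono r" "(k \<circ> r) \<longlonglongrightarrow> l" "Re l > 0" "Im l \<ge> 0"
    and el: "2 * l * cos (l * of_real L) + of_real b * sin (l * of_real a) = 0"
    using root_limit[OF a(1,2) \<beta>0 \<beta>(2) k] by blast
  have "Im l = 0"
  proof (rule ccontr)
    assume i: "Im l \<noteq> 0"
    then have "l \<in> quadrant" using r by (simp add: quadrant_def)
    moreover have "char_quot L a l = of_real b"
      using char_quot_eq_iff[OF sin_mult_real_nonzero[OF a(1) i]] el by blast
    ultimately have "b \<in> S" using b0 unfolding S_def a_def b_def by (metis (mono_tags, lifting) imageI less_imp_le mem_Collect_eq)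
    then show False using lt[of b] by (simp add: b_def)
  qed
  then have lx: "l = of_real (Re l)" by (simp add: complex_eq_iff)
  define x where "x = Re l"
  have x: "l = of_real x" "x > 0" using lx r(3) by (auto simp: x_def)
  have mero: "char_quot L a meromorphic_on {l}"
    unfolding char_quot_def[abs_def]
    by (intro meromorphic_on_divide analytic_on_imp_meromorphic_on analytic_intros)
  define H where "H = remove_sings (char_quot L a)"
  have iso: "isolated_singularity_at (char_quot L a) l" by (rule meromorphic_on_isolated_singularity[OF mero])
  have kl: "(k \<circ> r) n \<noteq> l" for n using k(1)[of "r n"] \<open>Im l = 0\<close> by (auto simp: quadrant_def)
  have filt: "filterlim (k \<circ> r) (at l) sequentially"
    using r(2) kl by (simp add: filterlim_at eventually_sequentially)
  have br: "(\<lambda>n. complex_of_real (\<beta> (r n))) \<longlonglongrightarrow> of_real b"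
    using LIMSEQ_subseq_LIMSEQ[OF \<beta>(2) r(1)] by (intro tendsto_of_real) (simp add: o_def)
  \<comment> \<open>along the roots \<open>k (r n)\<close> the quotient takes the bounded values \<open>\<beta> (r n)\<close>\<close>
  have "\<not> is_pole (char_quot L a) l"
  proof
    assume "is_pole (char_quot L a) l"
    then have "filterlim (\<lambda>n. char_quot L a ((k \<circ> r) n)) at_infinity sequentially"
      unfolding is_pole_def by (rule filterlim_compose[OF _ filt])
    then have "filterlim (\<lambda>n. complex_of_real (\<beta> (r n))) at_infinity sequentially" using k(2) by simp
    then show False using br not_tendsto_and_filterlim_at_infinity[OF sequentially_bot] by blast
  qed
  then obtain c where c: "char_quot L a \<midarrow>l\<rightarrow> c"
    using meromorphic_on_not_essential[OF mero] by (auto simp: not_essential_def)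
  have Han: "H analytic_on {l}" unfolding H_def by (rule remove_sings_analytic_at[OF iso c])
  have "c = of_real b"
  proof -
    have "(\<lambda>n. char_quot L a ((k \<circ> r) n)) \<longlonglongrightarrow> c" by (rule filterlim_compose[OF c filt])
    then show ?thesis using br k(2) LIMSEQ_unique by auto
  qed
  then have Hl: "H l = of_real b" unfolding H_def by (intro remove_sings_eqI) (use c in simp)
  obtain e1 where e1: "e1 > 0" "\<And>w. w \<noteq> l \<Longrightarrow> dist w l < e1 \<Longrightarrow> H w = char_quot L a w"
    using eventually_remove_sings_eq_at[OF iso] unfolding eventually_at H_def by blast
  have near: "\<exists>w \<gamma>. w \<in> ball (of_real x) d \<and> b < \<gamma> \<and> H w = of_real \<gamma> \<and> Im w \<noteq> 0" if d: "d > 0" for d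
  proof -
    obtain n where "dist ((k \<circ> r) n) l < min d e1"
      using r(2) d e1(1) unfolding lim_sequentially by (metis min_less_iff_conj order.refl)
    then have n: "dist (k (r n)) l < d" "dist (k (r n)) l < e1" by auto
    have "H (k (r n)) = of_real (\<beta> (r n))" using e1(2)[of "k (r n)"] n kl[of n] k(2) by simp
    moreover have "b < \<beta> (r n)" using lt[OF \<beta>(1)] by (simp add: b_def)
    moreover have "Im (k (r n)) \<noteq> 0" using k(1)[of "r n"] by (auto simp: quadrant_def)
    ultimately show ?thesis using n(1) x(1) by (intro exI[of _ "k (r n)"] exI[of _ "\<beta> (r n)"]) (auto simp: dist_commute)
  qed
  have em: "min e1 x > 0" using e1 x by simp
  obtain \<epsilon> where \<epsilon>: "\<epsilon> > 0" "\<And>\<gamma>. b < \<gamma> \<Longrightarrow> \<gamma> < b + \<epsilon> \<Longrightarrow> \<exists>w\<in>ball (of_real x) (min e1 x). Im w \<noteq> 0 \<and> H w = of_real \<gamma>"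
    using nonreal_branch[OF Han[unfolded x(1)] Hl[unfolded x(1)] near em] by blast
  have "\<not> eigenvalues x0 L \<gamma> \<subseteq> \<real>" if \<gamma>: "b < \<gamma>" "\<gamma> < b + \<epsilon>" for \<gamma>
  proof -
    obtain w where w: "w \<in> ball (of_real x) (min e1 x)" "Im w \<noteq> 0" "H w = of_real \<gamma>" using \<epsilon>(2)[OF \<gamma>] by blast
    have "w \<noteq> l" using w(2) \<open>Im l = 0\<close> by auto
    then have "char_quot L (L - x0) w = of_real \<gamma>" using e1(2)[of w] w x(1) by (simp add: dist_commute a_def)
    then have "w\<^sup>2 \<in> eigenvalues x0 L \<gamma>" by (rule eigenvalue_of_root(1)[OF x0 a(3) w(2)])
    moreover have "Re w > 0"
    proof -
      have "\<bar>x - Re w\<bar> \<le> cmod (of_real x - w)" using abs_Re_le_cmod[of "of_real x - w"] by simp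
      also have "\<dots> < x" using w(1) by (simp add: dist_norm)
      finally show ?thesis by linarith
    qed
    then have "Im (w\<^sup>2) \<noteq> 0" using w(2) by (simp add: power2_eq_square)
    ultimately show ?thesis using complex_is_Real_iff by blast
  qed
  then show "\<exists>\<epsilon>>0. \<forall>\<beta>\<in>{Inf S<..<Inf S+\<epsilon>}. \<not> eigenvalues x0 L \<beta> \<subseteq> \<real>"
    using \<epsilon>(1) by (auto simp: b_def intro!: exI[of _ \<epsilon>])
qed

text \<open>The limit point of roots for parameters decreasing to \<open>Inf T\<close> satisfies \<open>0 < Re k \<le> Im k\<close>, so it
  lies in the quadrant and \<open>Inf T\<close> is attained. A strict inequality would by openness allow smaller
  parameters.\<close>
lemma first_crossing:
  assumes x0: "0 < x0" and L: "L \<ge> 4 * x0"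
    and T_def: "T = {\<beta>. 0 \<le> \<beta> \<and> (\<exists>k\<in>quadrant. Re k \<le> Im k \<and> char_quot L (L - x0) k = of_real \<beta>)}"
  obtains s where "s > 0" "Inf T > 0" "char_quot L (L - x0) (Complex s s) = of_real (Inf T)" "\<And>\<beta>. \<beta> \<in> T \<Longrightarrow> Inf T \<le> \<beta>"
proof -
  define a where "a = L - x0"
  have a: "0 < a" "a < L" "x0 < L" using x0 L by (auto simp: a_def)
  have bdd: "bdd_below T" unfolding T_def by (rule bdd_belowI[of _ 0]) auto
  have ne: "T \<noteq> {}"
  proof -
    obtain s \<beta> where "s > 0" "\<beta> > 0" "char_quot L (L - x0) (Complex s s) = of_real \<beta>"
      using exists_crossing[OF x0 L] .
    then have "\<beta> \<in> T" unfolding T_def by (auto intro!: bexI[of _ "Complex s s"] simp: quadrant_def)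
    then show ?thesis by blast
  qed
  define b where "b = Inf T"
  have b0: "b > 0" unfolding b_def
  proof (rule Inf_parameters_pos[OF a(1,2) ne])
    fix \<beta> assume "\<beta> \<in> T"
    then obtain k where k: "0 \<le> \<beta>" "k \<in> quadrant" "char_quot L a k = of_real \<beta>"
      unfolding T_def a_def by blast
    have "char_quot L a k \<in> char_quot L a ` quadrant" using k(2) by (rule imageI)
    then show "0 \<le> \<beta> \<and> of_real \<beta> \<in> char_quot L a ` quadrant" using k(1) unfolding k(3) by blast
  qed
  have "b \<in> closure T" unfolding b_def by (rule closure_contains_Inf[OF ne bdd])
  then obtain \<beta> where \<beta>: "\<And>n. \<beta> n \<in> T" "\<beta> \<longlonglongrightarrow> b" unfolding closure_sequential by blast
  have "\<exists>k. k \<in> quadrant \<and> Re k \<le> Im k \<and> char_quot L a k = of_real (\<beta> n)" for n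
    using \<beta>(1)[of n] by (auto simp: T_def a_def)
  then have "\<forall>n. \<exists>k. k \<in> quadrant \<and> Re k \<le> Im k \<and> char_quot L a k = of_real (\<beta> n)" by blast
  from choice[OF this] obtain k
    where "\<forall>n. k n \<in> quadrant \<and> Re (k n) \<le> Im (k n) \<and> char_quot L a (k n) = of_real (\<beta> n)" by blast
  then have k: "\<And>n. k n \<in> quadrant" "\<And>n. Re (k n) \<le> Im (k n)" "\<And>n. char_quot L a (k n) = of_real (\<beta> n)"
    by blast+
  have \<beta>0: "\<beta> n \<ge> 0" for n using \<beta>(1)[of n] by (simp add: T_def)
  obtain r l where r: "strict_mono r" "(k \<circ> r) \<longlonglongrightarrow> l" "Re l > 0" "Im l \<ge> 0"
    and el: "2 * l * cos (l * of_real L) + of_real b * sin (l * of_real a) = 0"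
    using root_limit[OF a(1,2) \<beta>0 \<beta>(2) k(1,3)] by blast
  have RI: "Re l \<le> Im l"
    by (rule LIMSEQ_le[OF tendsto_Re[OF r(2)] tendsto_Im[OF r(2)]]) (use k(2) in auto)
  then have lq: "l \<in> quadrant" "Im l \<noteq> 0" using r(3) by (auto simp: quadrant_def)
  have hl: "char_quot L a l = of_real b"
    using char_quot_eq_iff[OF sin_mult_real_nonzero[OF a(1) lq(2)]] el by blast
  have "Re l = Im l"
  proof (rule ccontr)
    assume "Re l \<noteq> Im l"
    define U where "U = quadrant \<inter> {k. Re k < Im k}"
    have U: "open U" "U \<subseteq> quadrant"
      unfolding U_def by (intro open_Int open_quadrant open_Collect_less continuous_intros, blast)
    have "l \<in> U" using RI \<open>Re l \<noteq> Im l\<close> lq(1) by (simp add: U_def)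
    with hl have "of_real b \<in> char_quot L (L - x0) ` U" unfolding a_def by (metis imageI)
    then have bU: "b \<in> {\<beta>::real. of_real \<beta> \<in> char_quot L (L - x0) ` U}" by simp
    obtain c where c: "0 \<le> c" "c < b" "c \<in> {\<beta>::real. of_real \<beta> \<in> char_quot L (L - x0) ` U}"
      using open_real_left[OF open_real_values[OF x0 L U] bU b0] .
    from c(3) have "of_real c \<in> char_quot L (L - x0) ` U" by simp
    then obtain w where w: "of_real c = char_quot L (L - x0) w" "w \<in> U" by (rule imageE)
    then have "w \<in> quadrant" "Re w \<le> Im w" by (simp_all add: U_def)
    then have "c \<in> T" using c(1) w(1) unfolding T_def by (simp only: mem_Collect_eq) metis
    then have "b \<le> c" unfolding b_def by (rule cInf_lower[OF _ bdd])
    then show False using c(2) by simp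
  qed
  then have "Complex (Re l) (Re l) = l" by (simp add: complex_eq_iff)
  then have "char_quot L (L - x0) (Complex (Re l) (Re l)) = of_real (Inf T)"
    using hl by (simp only: a_def b_def)
  then show ?thesis
    by (rule that[OF r(3) b0[unfolded b_def]]) (rule cInf_lower[OF _ bdd])
qed

text \<open>The branch is \<open>z(\<beta>) = (g(\<beta>))\<^sup>2\<close> for the local inverse \<open>g\<close> of \<open>h\<close>; by transversality its real part
  is strictly decreasing through \<open>0\<close>.\<close>
lemma crossing_pair:
  assumes x0: "0 < x0" and L: "L \<ge> 4 * x0" and s: "s > 0" and b: "b > 0"
    and h: "char_quot L (L - x0) (Complex s s) = of_real b"
  shows "pair_crosses_imaginary_axis (eigenvalues x0 L) b"
proof -
  let ?h = "char_quot L (L - x0)" and ?k = "Complex s s"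
  have a: "L - x0 > 0" "x0 < L" using x0 L by auto
  obtain D where D: "(?h has_field_derivative D) (at ?k)" "D \<noteq> 0" "Re (2 * ?k / D) < 0"
    using crossing_transversal[OF x0 L s b h] .
  have kq: "?k \<in> quadrant" using s by (simp add: quadrant_def)
  have hol: "?h holomorphic_on quadrant" by (rule char_quot_holomorphic[OF a(1)])
  have dD: "deriv ?h ?k = D" by (rule DERIV_imp_deriv[OF D(1)])
  obtain r where r: "r > 0" "ball ?k r \<subseteq> quadrant" "open (?h ` ball ?k r)" "inj_on ?h (ball ?k r)"
    using has_complex_derivative_locally_invertible[OF hol kq open_quadrant] dD D(2) by blast
  have hol2: "?h holomorphic_on ball ?k r" using hol r(2) by (rule holomorphic_on_subset)
  obtain g where g: "g holomorphic_on ?h ` ball ?k r"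
    "\<And>z. z \<in> ball ?k r \<Longrightarrow> deriv ?h z * deriv g (?h z) = 1" "\<And>z. z \<in> ball ?k r \<Longrightarrow> g (?h z) = z"
    using holomorphic_has_inverse[OF hol2 open_ball r(4)] by metis
  have kb: "?k \<in> ball ?k r" using r(1) by simp
  have bI: "of_real b \<in> ?h ` ball ?k r" using kb h by (metis image_eqI)
  define z where "z = (\<lambda>\<beta>::real. (g (of_real \<beta>))\<^sup>2)"
  have gb: "g (of_real b) = ?k" using g(3)[OF kb] h by simp
  have gd: "(g has_field_derivative 1 / D) (at (of_real b))"
  proof -
    have "(g has_field_derivative deriv g (of_real b)) (at (of_real b))"
      by (rule holomorphic_derivI[OF g(1) r(3) bI])
    moreover have "D * deriv g (of_real b) = 1" using g(2)[OF kb] dD h by simp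
    then have "deriv g (of_real b) = 1 / D" using D(2) by (simp add: field_simps)
    ultimately show ?thesis by simp
  qed
  have "((\<lambda>w. (g w)\<^sup>2) has_field_derivative 2 * ?k / D) (at (of_real b))"
    using DERIV_power[OF gd, of 2] gb by (simp add: field_simps)
  from has_vector_derivative_real_field[OF this]
  have zd: "(z has_vector_derivative 2 * ?k / D) (at b)" by (simp add: z_def)
  have "((\<lambda>\<beta>. Re (z \<beta>)) has_real_derivative Re (2 * ?k / D)) (at b)"
    using bounded_linear.has_vector_derivative[OF bounded_linear_Re zd]
    by (simp add: has_real_derivative_iff_has_vector_derivative)
  then obtain d1 d2 where d1: "d1 > 0" "\<And>t. 0 < t \<Longrightarrow> t < d1 \<Longrightarrow> Re (z b) < Re (z (b - t))"
    and d2: "d2 > 0" "\<And>t. 0 < t \<Longrightarrow> t < d2 \<Longrightarrow> Re (z (b + t)) < Re (z b)"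
    using DERIV_neg_dec_left DERIV_neg_dec_right D(3) by metis
  have zb: "Re (z b) = 0" by (simp add: z_def gb power2_eq_square)
  have "open (complex_of_real -` (?h ` ball ?k r))"
    by (rule open_vimage[OF r(3)]) (intro continuous_intros)
  then obtain d3 where d3: "d3 > 0" "\<And>\<beta>. dist \<beta> b < d3 \<Longrightarrow> of_real \<beta> \<in> ?h ` ball ?k r"
    using bI unfolding open_dist by (metis vimageE vimageI2)
  define \<epsilon> where "\<epsilon> = min d3 (min d1 d2)"
  have \<epsilon>: "\<epsilon> > 0" "\<epsilon> \<le> d1" "\<epsilon> \<le> d2" "\<epsilon> \<le> d3" using d1 d2 d3 by (auto simp: \<epsilon>_def)
  have img: "of_real \<beta> \<in> ?h ` ball ?k r" if "\<beta> \<in> {b-\<epsilon><..<b+\<epsilon>}" for \<beta>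
    using that \<epsilon> by (intro d3(2)) (auto simp: dist_real_def abs_less_iff)
  have cont: "continuous_on {b-\<epsilon><..<b+\<epsilon>} z"
    unfolding z_def
    by (intro continuous_on_power continuous_on_compose2[OF holomorphic_on_imp_continuous_on[OF g(1)]] continuous_intros)
       (use img in auto)
  have mem: "z \<beta> \<in> eigenvalues x0 L \<beta> \<and> cnj (z \<beta>) \<in> eigenvalues x0 L \<beta> \<and> Im (z \<beta>) \<noteq> 0" if \<beta>: "\<beta> \<in> {b-\<epsilon><..<b+\<epsilon>}" for \<beta>
  proof -
    obtain w where w: "w \<in> ball ?k r" "of_real \<beta> = ?h w" using img[OF \<beta>] by blast
    have zw: "z \<beta> = w\<^sup>2" using g(3)[OF w(1)] by (simp add: z_def w(2))
    have wq: "Re w > 0" "Im w > 0" using w(1) r(2) by (auto simp: quadrant_def)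
    show ?thesis unfolding zw
      using eigenvalue_of_root[OF x0 a(2) _ w(2)[symmetric]] wq by (auto simp: power2_eq_square)
  qed
  have left: "Re (z \<beta>) > 0" if "\<beta> \<in> {b-\<epsilon><..<b}" for \<beta>
    using d1(2)[of "b - \<beta>"] that \<epsilon> zb by auto
  have right: "Re (z \<beta>) < 0" if "\<beta> \<in> {b<..<b+\<epsilon>}" for \<beta>
    using d2(2)[of "\<beta> - b"] that \<epsilon> zb by auto
  show ?thesis unfolding pair_crosses_imaginary_axis_def
    using \<epsilon>(1) cont mem left right zb by blast
qed

theorem proposition3p5:
  fixes x0 :: real
  assumes "x0 > 0"
  shows "\<exists>L0\<ge>x0. \<forall>L>L0. \<exists>\<beta>0 \<beta>1. 0 < \<beta>0 \<and> \<beta>0 < \<beta>1 \<and>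
    (\<forall>\<beta>\<in>{0..<\<beta>0}. eigenvalues x0 L \<beta> \<subseteq> \<real>) \<and>
    (\<exists>\<epsilon>>0. \<forall>\<beta>\<in>{\<beta>0<..<\<beta>0+\<epsilon>}. \<not> eigenvalues x0 L \<beta> \<subseteq> \<real>) \<and>
    (\<forall>\<beta>\<in>{0..<\<beta>1}. \<forall>\<mu>\<in>eigenvalues x0 L \<beta>. Re \<mu> > 0) \<and>
    pair_crosses_imaginary_axis (eigenvalues x0 L) \<beta>1"
proof (rule exI[of _ "4 * x0"], intro conjI allI impI)
  show "x0 \<le> 4 * x0" using assms by linarith
  fix L assume "4 * x0 < L"
  then have L: "L \<ge> 4 * x0" "x0 < L" using assms by auto
  define S where "S = {\<beta>. 0 \<le> \<beta> \<and> of_real \<beta> \<in> char_quot L (L - x0) ` quadrant}"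
  define T where "T = {\<beta>. 0 \<le> \<beta> \<and> (\<exists>k\<in>quadrant. Re k \<le> Im k \<and> char_quot L (L - x0) k = of_real \<beta>)}"
  obtain s where s: "s > 0" "Inf T > 0" "char_quot L (L - x0) (Complex s s) = of_real (Inf T)"
    and Tle: "\<And>\<beta>. \<beta> \<in> T \<Longrightarrow> Inf T \<le> \<beta>"
    by (rule first_crossing[OF assms L(1) T_def]) (rule that)
  have "Complex s s \<in> quadrant" using s(1) by (simp add: quadrant_def)
  then have "of_real (Inf T) \<in> char_quot L (L - x0) ` quadrant" using s(3) by (metis imageI)
  then have TS: "Inf T \<in> S" using s(2) by (simp add: S_def)
  then have ne: "S \<noteq> {}" by blast
  note N = nonreal_after_threshold[OF assms L(1) S_def ne]
  have real: "eigenvalues x0 L \<beta> \<subseteq> \<real>" if \<beta>: "\<beta> \<in> {0..<Inf S}" for \<beta>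
  proof (rule subsetI, rule ccontr)
    fix \<mu> assume \<mu>: "\<mu> \<in> eigenvalues x0 L \<beta>" "\<mu> \<notin> \<real>"
    obtain k where "k \<in> quadrant" "char_quot L (L - x0) k = of_real \<beta>"
    proof (rule eigenvalue_cases[OF assms L(2) _ \<mu>(1)])
      show "0 \<le> \<beta>" "\<not> (\<mu> \<in> \<real> \<and> Re \<mu> > 0)" using \<beta> \<mu>(2) by simp_all
    qed (rule that)
    then have "of_real \<beta> \<in> char_quot L (L - x0) ` quadrant" by (metis imageI)
    then have "\<beta> \<in> S" using \<beta> by (simp add: S_def)
    then have "Inf S < \<beta>" by (rule N(3))
    then show False using \<beta> by simp
  qed
  have pos: "Re \<mu> > 0" if \<beta>: "\<beta> \<in> {0..<Inf T}" and \<mu>: "\<mu> \<in> eigenvalues x0 L \<beta>" for \<beta> \<mu>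
  proof (rule ccontr)
    assume n: "\<not> Re \<mu> > 0"
    obtain k where k: "k \<in> quadrant" "char_quot L (L - x0) k = of_real \<beta>" "\<mu> = k\<^sup>2 \<or> \<mu> = cnj (k\<^sup>2)"
    proof (rule eigenvalue_cases[OF assms L(2) _ \<mu>])
      show "0 \<le> \<beta>" "\<not> (\<mu> \<in> \<real> \<and> Re \<mu> > 0)" using \<beta> n by simp_all
    qed (rule that)
    have "Re \<mu> = Re (k\<^sup>2)"
      using k(3)
    proof
      assume "\<mu> = cnj (k\<^sup>2)"
      then show ?thesis by (simp only: cnj.sel)
    qed (rule arg_cong)
    moreover have "Re (k\<^sup>2) = (Re k)\<^sup>2 - (Im k)\<^sup>2" by (simp add: power2_eq_square)
    ultimately have "(Re k)\<^sup>2 \<le> (Im k)\<^sup>2" using n by linarith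
    moreover have "0 \<le> Im k" using k(1) by (simp add: quadrant_def)
    ultimately have "Re k \<le> Im k" by (rule power2_le_imp_le)
    moreover have "0 \<le> \<beta>" using \<beta> by simp
    ultimately have "\<beta> \<in> T" using k(1,2) unfolding T_def by blast
    then have "Inf T \<le> \<beta>" by (rule Tle)
    then show False using \<beta> by simp
  qed
  show "\<exists>\<beta>0 \<beta>1. 0 < \<beta>0 \<and> \<beta>0 < \<beta>1 \<and>
    (\<forall>\<beta>\<in>{0..<\<beta>0}. eigenvalues x0 L \<beta> \<subseteq> \<real>) \<and>
    (\<exists>\<epsilon>>0. \<forall>\<beta>\<in>{\<beta>0<..<\<beta>0+\<epsilon>}. \<not> eigenvalues x0 L \<beta> \<subseteq> \<real>) \<and>
    (\<forall>\<beta>\<in>{0..<\<beta>1}. \<forall>\<mu>\<in>eigenvalues x0 L \<beta>. Re \<mu> > 0) \<and>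
    pair_crosses_imaginary_axis (eigenvalues x0 L) \<beta>1"
  proof (rule exI[of _ "Inf S"], rule exI[of _ "Inf T"], intro conjI)
    show "0 < Inf S" by (rule N(1))
    show "Inf S < Inf T" by (rule N(3)[OF TS])
    show "\<forall>\<beta>\<in>{0..<Inf S}. eigenvalues x0 L \<beta> \<subseteq> \<real>" using real by (rule ballI)
    show "\<exists>\<epsilon>>0. \<forall>\<beta>\<in>{Inf S<..<Inf S + \<epsilon>}. \<not> eigenvalues x0 L \<beta> \<subseteq> \<real>" by (rule N(2))
    show "\<forall>\<beta>\<in>{0..<Inf T}. \<forall>\<mu>\<in>eigenvalues x0 L \<beta>. Re \<mu> > 0" by (intro ballI pos)
    show "pair_crosses_imaginary_axis (eigenvalues x0 L) (Inf T)" by (rule crossing_pair[OF assms L(1) s])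
  qed
qed

end
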